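(* Let $(M,L)$ be a Finsler manifold of dimension $n\geq 3$. If $(M,L)$ is concircularly flat, i.e. its concircular curvature tensor $C=R-\frac{r}{n(n-1)}G$ vanishes, then $(M,L)$ is of constant curvature.
   Context: Setting. $(M,L)$ is a Finsler manifold (in the usual sense: $L:TM\to[0,\infty)$ is smooth on nonzero vectors, positively homogeneous of degree 1 in the fibre variable $y$, and the vertical Hessian $g$ of $\frac12L^2$ is positive definite). $\pi:\mathcal{T}M\to M$ is the bundle of nonzero tangent vectors, $\pi^{-1}(TM)$ is the pullback bundle over $\mathcal{T}M$, and $g$ is regarded as a metric on $\pi^{-1}(TM)$. Sections of $\pi^{-1}(TM)$ are called $\pi$-vector fields, denoted $\overline{X},\overline{Y},\dots$; their module is $\mathfrak{X}(\pi(M))$; tensor fields on $\pi^{-1}(TM)$ are called $\pi$-tensor fields. The fundamental $\pi$-vector field is $\overline{\eta}(u)=(u,u)$. In the exact sequence $0\to\pi^{-1}(TM)\xrightarrow{\gamma}T(\mathcal{T}M)\xrightarrow{\rho}\pi^{-1}(TM)\to0$, $\gamma(u,v)=\frac{d}{dt}\big|_{0}(u+tv)$ is the vertical lift and $\rho(X)=(u,d\pi(X))$ for $X\in T_u(\mathcal{T}M)$. Connections. For a linear connection $D$ on $\pi^{-1}(TM)$ let $K(X)=D_X\overline{\eta}$; the horizontal space at $u$ is $H_u=\{X\in T_u(\mathcal{T}M):K(X)=0\}$ and the vertical space is $V_u=\ker d\pi$; $D$ is regular if $T_u(\mathcal{T}M)=V_u\oplus H_u$ for all $u$, and then $\beta:=(\rho|_{H})^{-1}$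 is the horizontal map. The classical torsion is $\mathbf{T}(X,Y)=D_X\rho Y-D_Y\rho X-\rho[X,Y]$, with $Q(\overline{X},\overline{Y})=\mathbf{T}(\beta\overline{X},\beta\overline{Y})$ and $T(\overline{X},\overline{Y})=\mathbf{T}(\gamma\overline{X},\beta\overline{Y})$. The Cartan connection $\nabla$ is the unique regular connection on $\pi^{-1}(TM)$ with $\nabla g=0$, $Q=0$ and $g(T(\overline{X},\overline{Y}),\overline{Z})=g(T(\overline{X},\overline{Z}),\overline{Y})$. Curvature. The classical curvature is taken with the sign convention $\mathbf{K}(X,Y)\overline{Z}=-\nabla_X\nabla_Y\overline{Z}+\nabla_Y\nabla_X\overline{Z}+\nabla_{[X,Y]}\overline{Z}$. The horizontal curvature tensor is $R(\overline{X},\overline{Y})\overline{Z}=\mathbf{K}(\beta\overline{X},\beta\overline{Y})\overline{Z}$, and $\widehat{R}(\overline{X},\overline{Y})=R(\overline{X},\overline{Y})\overline{\eta}$. The horizontal Ricci tensor is $Ric(\overline{X},\overline{Z})=\mathrm{Tr}\{\overline{Y}\mapsto R(\overline{X},\overline{Y})\overline{Z}\}$ and the horizontal scalar curvature $r$ is its $g$-trace. $G$ is the $\pi$-tensor field $G(\overline{X},\overline{Y})\overline{Z}=g(\overline{X},\overline{Z})\overline{Y}-g(\overline{Y},\overline{Z})\overline{X}$. The concircular curvature tensor is $C:=R-\frac{r}{n(n-1)}G$. Constant curvature. Let $\ell(\overline{X})=L^{-1}g(\overline{\eta},\overline{X})$, let $\hbar=g-\ell\otimes\ell$ be the angular metric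 tensor, and let $\phi$ be defined by $g(\phi(\overline{X}),\overline{Y})=\hbar(\overline{X},\overline{Y})$. The deviation tensor is $H:=i_{\overline{\eta}}\widehat{R}$, i.e. $H(\overline{X})=\widehat{R}(\overline{\eta},\overline{X})$. A Finsler manifold of dimension $n\ge3$ is of scalar curvature if $H=\varepsilon L^2\phi$ for some scalar function $\varepsilon$ positively homogeneous of degree $0$ in $y$; it is of constant curvature if moreover $\varepsilon$ is constant.
   Formalization: The manifold M is assumed connected; without this the claim fails, e.g. for the disjoint union of two round 3-spheres of different radii, which is concircularly flat but whose curvature is only locally constant. *)

theory Defs
  imports "HOL-Analysis.Analysis" "HOL-Library.Function_Algebras"
begin

instantiation "fun" :: (type, real_vector) real_vector
begin

definition scaleR_fun :: "real \<Rightarrow> ('a \<Rightarrow> 'b) \<Rightarrow> 'a \<Rightarrow> 'b" where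
  "scaleR_fun r f = (\<lambda>x. r *\<^sub>R f x)"

instance
  by standard (simp_all add: scaleR_fun_def fun_eq_iff scaleR_add_right scaleR_add_left)

end

text \<open>Only meaningful for open sets \<open>S\<close>.\<close>

primrec Ck_on :: "nat \<Rightarrow> 'a::real_normed_vector set \<Rightarrow> ('a \<Rightarrow> 'b::real_normed_vector) \<Rightarrow> bool" where
  "Ck_on 0 S f \<longleftrightarrow> continuous_on S f"
| "Ck_on (Suc k) S f \<longleftrightarrow>
     (\<forall>x\<in>S. f differentiable (at x)) \<and> (\<forall>v. Ck_on k S (\<lambda>x. frechet_derivative f (at x) v))"

definition smooth_on :: "'a::real_normed_vector set \<Rightarrow> ('a \<Rightarrow> 'b::real_normed_vector) \<Rightarrow> bool" where
  "smooth_on S f \<longleftrightarrow> (\<forall>k. Ck_on k S f)"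

text \<open>A chart is a domain together with a coordinate map; the values of the map outside the
  domain are irrelevant. A manifold is given by its atlas (not required to be maximal), which
  determines the underlying set, the topology and the smooth structure. The dimension is
  \<open>DIM('e)\<close>.\<close>

type_synonym ('a, 'e) chart = "'a set \<times> ('a \<Rightarrow> 'e)"

abbreviation chart_inv :: "('a, 'e) chart \<Rightarrow> 'e \<Rightarrow> 'a" where
  "chart_inv c \<equiv> inv_into (fst c) (snd c)"

definition mcarrier :: "('a, 'e) chart set \<Rightarrow> 'a set" where
  "mcarrier A = (\<Union>c\<in>A. fst c)"

definition smooth_atlas :: "('a, 'e::euclidean_space) chart set \<Rightarrow> bool" where
  "smooth_atlas A \<longleftrightarrow>
     (\<forall>c\<in>A. inj_on (snd c) (fst c) \<and> open (snd c ` fst c)) \<and>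
     (\<forall>c\<in>A. \<forall>d\<in>A. open (snd c ` (fst c \<inter> fst d)) \<and>
        smooth_on (snd c ` (fst c \<inter> fst d)) (snd d \<circ> chart_inv c))"

definition manifold_topology :: "('a, 'e::euclidean_space) chart set \<Rightarrow> 'a topology" where
  "manifold_topology A =
     topology (\<lambda>W. W \<subseteq> mcarrier A \<and> (\<forall>c\<in>A. open (snd c ` (W \<inter> fst c))))"

definition smooth_manifold :: "('a, 'e::euclidean_space) chart set \<Rightarrow> bool" where
  "smooth_manifold A \<longleftrightarrow> smooth_atlas A \<and>
     Hausdorff_space (manifold_topology A) \<and> second_countable (manifold_topology A)"

lemma openin_manifold_topology:
  assumes "smooth_atlas A"
  shows "openin (manifold_topology A) W \<longleftrightarrow>
    W \<subseteq> mcarrier A \<and> (\<forall>c\<in>A. open (snd c ` (W \<inter> fst c)))"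
proof -
  have "istopology (\<lambda>W. W \<subseteq> mcarrier A \<and> (\<forall>c\<in>A. open (snd c ` (W \<inter> fst c))))"
    unfolding istopology_def
  proof (intro conjI allI impI ballI)
    fix S T c
    assume S: "S \<subseteq> mcarrier A \<and> (\<forall>c\<in>A. open (snd c ` (S \<inter> fst c)))"
      and T: "T \<subseteq> mcarrier A \<and> (\<forall>c\<in>A. open (snd c ` (T \<inter> fst c)))" and c: "c \<in> A"
    have "inj_on (snd c) (fst c)"
      using assms c by (auto simp: smooth_atlas_def)
    then have "snd c ` (S \<inter> T \<inter> fst c) = snd c ` (S \<inter> fst c) \<inter> snd c ` (T \<inter> fst c)"
      by (auto simp: inj_on_def)
    then show "open (snd c ` (S \<inter> T \<inter> fst c))"
      using S T c by (simp add: open_Int)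
  next
    fix \<K> c
    assume K: "\<forall>S\<in>\<K>. S \<subseteq> mcarrier A \<and> (\<forall>c\<in>A. open (snd c ` (S \<inter> fst c)))" and c: "c \<in> A"
    have "snd c ` (\<Union>\<K> \<inter> fst c) = (\<Union>S\<in>\<K>. snd c ` (S \<inter> fst c))"
      by auto
    then show "open (snd c ` (\<Union>\<K> \<inter> fst c))"
      using K c by auto
  qed auto
  then show ?thesis
    unfolding manifold_topology_def by (simp add: topology_inverse')
qed

definition smooth_fun :: "('a, 'e::euclidean_space) chart \<Rightarrow> ('a \<Rightarrow> 'b::real_normed_vector) \<Rightarrow> bool" where
  "smooth_fun c f \<longleftrightarrow> smooth_on (snd c ` fst c) (f \<circ> chart_inv c)"

definition Cinf :: "('a, 'e::euclidean_space) chart set \<Rightarrow> ('a \<Rightarrow> real) set" where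
  "Cinf A = {f. \<forall>c\<in>A. smooth_fun c f}"

text \<open>A tangent vector at \<open>p\<close> is the family of its coordinate vectors in all charts around \<open>p\<close>,
  related by the derivatives of the transition maps and set to zero at all other charts.\<close>

type_synonym ('a, 'e) tvec = "('a, 'e) chart \<Rightarrow> 'e"

definition tangent_space :: "('a, 'e::euclidean_space) chart set \<Rightarrow> 'a \<Rightarrow> ('a, 'e) tvec set" where
  "tangent_space A p =
     {v. (\<forall>c. c \<notin> A \<or> p \<notin> fst c \<longrightarrow> v c = 0) \<and>
         (\<forall>c\<in>A. \<forall>d\<in>A. p \<in> fst c \<inter> fst d \<longrightarrow>
            v d = frechet_derivative (snd d \<circ> chart_inv c) (at (snd c p)) (v c))}"

text \<open>The derivative of \<open>f\<close> (smooth near \<open>p\<close>) along a tangent vector at \<open>p\<close>, computed in any chart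
  around \<open>p\<close>.\<close>

definition dir_deriv :: "('a, 'e::euclidean_space) chart set \<Rightarrow> 'a \<Rightarrow> ('a, 'e) tvec \<Rightarrow>
    ('a \<Rightarrow> 'b::real_normed_vector) \<Rightarrow> 'b" where
  "dir_deriv A p v f =
     (let c = (SOME c. c \<in> A \<and> p \<in> fst c)
      in frechet_derivative (f \<circ> chart_inv c) (at (snd c p)) (v c))"

definition velocity :: "('a, 'e::euclidean_space) chart set \<Rightarrow> (real \<Rightarrow> 'a) \<Rightarrow> ('a, 'e) tvec" where
  "velocity A \<sigma> =
     (\<lambda>c. if c \<in> A \<and> \<sigma> 0 \<in> fst c then vector_derivative (\<lambda>t. snd c (\<sigma> t)) (at 0) else 0)"

text \<open>Vector fields and other sections are extensional, so that equality of sections is equality of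
  functions.\<close>

definition vector_fields :: "('a, 'e::euclidean_space) chart set \<Rightarrow> ('a \<Rightarrow> ('a, 'e) tvec) set" where
  "vector_fields A =
     {X \<in> extensional (mcarrier A). (\<forall>p\<in>mcarrier A. X p \<in> tangent_space A p) \<and>
        (\<forall>c\<in>A. smooth_fun c (\<lambda>p. X p c))}"

definition lie_bracket :: "('a, 'e::euclidean_space) chart set \<Rightarrow> ('a \<Rightarrow> ('a, 'e) tvec) \<Rightarrow>
    ('a \<Rightarrow> ('a, 'e) tvec) \<Rightarrow> 'a \<Rightarrow> ('a, 'e) tvec" where
  "lie_bracket A X Y = (\<lambda>p\<in>mcarrier A. \<lambda>c.
     if c \<in> A \<and> p \<in> fst c
     then frechet_derivative ((\<lambda>q. Y q c) \<circ> chart_inv c) (at (snd c p)) (X p c) -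
          frechet_derivative ((\<lambda>q. X q c) \<circ> chart_inv c) (at (snd c p)) (Y p c)
     else 0)"

definition trace_on :: "'v::real_vector set \<Rightarrow> ('v \<Rightarrow> 'v) \<Rightarrow> real" where
  "trace_on S f = (let B = (SOME B. independent B \<and> span B = S)
                   in \<Sum>b\<in>B. representation B (f b) b)"

definition raise_on :: "'v set \<Rightarrow> ('v \<Rightarrow> 'v \<Rightarrow> real) \<Rightarrow> ('v \<Rightarrow> 'v \<Rightarrow> real) \<Rightarrow> 'v \<Rightarrow> 'v" where
  "raise_on S g b x = (THE y. y \<in> S \<and> (\<forall>z\<in>S. g y z = b x z))"

definition metric_trace :: "'v::real_vector set \<Rightarrow> ('v \<Rightarrow> 'v \<Rightarrow> real) \<Rightarrow> ('v \<Rightarrow> 'v \<Rightarrow> real) \<Rightarrow> real" where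
  "metric_trace S g b = trace_on S (raise_on S g b)"

type_synonym ('a, 'e) tm = "'a \<times> ('a, 'e) tvec"
type_synonym ('a, 'e) ttvec = "(('a, 'e) tm, 'e \<times> 'e) tvec"
type_synonym ('a, 'e) vfield = "('a, 'e) tm \<Rightarrow> ('a, 'e) ttvec"

text \<open>The fibre of the pullback bundle over \<open>u\<close> consists of the pairs \<open>(u, v)\<close> with \<open>v\<close> tangent at
  the base point of \<open>u\<close>; the redundant first component is dropped.\<close>

type_synonym ('a, 'e) pifield = "('a, 'e) tm \<Rightarrow> ('a, 'e) tvec"

definition TM :: "('a, 'e::euclidean_space) chart set \<Rightarrow> ('a, 'e) tm set" where
  "TM A = (SIGMA p:mcarrier A. tangent_space A p)"

definition slit_chart :: "('a, 'e::euclidean_space) chart set \<Rightarrow> ('a, 'e) chart \<Rightarrow>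
    (('a, 'e) tm, 'e \<times> 'e) chart" where
  "slit_chart A c = ((SIGMA p:fst c. tangent_space A p - {0}), (\<lambda>(p, v). (snd c p, v c)))"

definition slit_atlas :: "('a, 'e::euclidean_space) chart set \<Rightarrow> (('a, 'e) tm, 'e \<times> 'e) chart set" where
  "slit_atlas A = slit_chart A ` A"

abbreviation slitTM :: "('a, 'e::euclidean_space) chart set \<Rightarrow> ('a, 'e) tm set" where
  "slitTM A \<equiv> mcarrier (slit_atlas A)"

lemma slitTM_eq: "slitTM A = {u \<in> TM A. snd u \<noteq> 0}"
  by (auto simp: mcarrier_def slit_atlas_def slit_chart_def TM_def)

abbreviation fibre :: "('a, 'e::euclidean_space) chart set \<Rightarrow> ('a, 'e) tm \<Rightarrow> ('a, 'e) tvec set" where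
  "fibre A u \<equiv> tangent_space A (fst u)"

definition pifields :: "('a, 'e::euclidean_space) chart set \<Rightarrow> ('a, 'e) pifield set" where
  "pifields A =
     {X \<in> extensional (slitTM A). (\<forall>u\<in>slitTM A. X u \<in> fibre A u) \<and>
        (\<forall>c\<in>A. smooth_fun (slit_chart A c) (\<lambda>u. X u c))}"

definition eta :: "('a, 'e::euclidean_space) chart set \<Rightarrow> ('a, 'e) pifield" where
  "eta A = (\<lambda>u\<in>slitTM A. snd u)"

text \<open>Some \<open>\<pi>\<close>-vector field with value \<open>x\<close> at \<open>u\<close>; used to evaluate tensorial operators at a point.\<close>

definition pi_extend :: "('a, 'e::euclidean_space) chart set \<Rightarrow> ('a, 'e) tm \<Rightarrow> ('a, 'e) tvec \<Rightarrow>
    ('a, 'e) pifield" where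
  "pi_extend A u x = (SOME X. X \<in> pifields A \<and> X u = x)"

definition vlift :: "('a, 'e::euclidean_space) chart set \<Rightarrow> ('a, 'e) tm \<Rightarrow> ('a, 'e) tvec \<Rightarrow>
    ('a, 'e) ttvec" where
  "vlift A u v = velocity (slit_atlas A) (\<lambda>t. (fst u, snd u + t *\<^sub>R v))"

text \<open>The differential of the projection of the slit tangent bundle to the base.\<close>

definition rho :: "('a, 'e::euclidean_space) chart set \<Rightarrow> ('a, 'e) tm \<Rightarrow> ('a, 'e) ttvec \<Rightarrow>
    ('a, 'e) tvec" where
  "rho A u x = (\<lambda>c. if c \<in> A \<and> fst u \<in> fst c
                    then dir_deriv (slit_atlas A) u x (snd c \<circ> fst) else 0)"

definition vlift_field :: "('a, 'e::euclidean_space) chart set \<Rightarrow> ('a, 'e) pifield \<Rightarrow> ('a, 'e) vfield" where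
  "vlift_field A X = (\<lambda>u\<in>slitTM A. vlift A u (X u))"

definition rho_field :: "('a, 'e::euclidean_space) chart set \<Rightarrow> ('a, 'e) vfield \<Rightarrow> ('a, 'e) pifield" where
  "rho_field A X = (\<lambda>u\<in>slitTM A. rho A u (X u))"

text \<open>\<open>D u x Y\<close> is the covariant derivative of the \<open>\<pi>\<close>-vector field \<open>Y\<close> along the tangent vector \<open>x\<close>
  of the slit tangent bundle at \<open>u\<close>.\<close>

type_synonym ('a, 'e) connection =
  "('a, 'e) tm \<Rightarrow> ('a, 'e) ttvec \<Rightarrow> ('a, 'e) pifield \<Rightarrow> ('a, 'e) tvec"

definition cov :: "('a, 'e::euclidean_space) chart set \<Rightarrow> ('a, 'e) connection \<Rightarrow> ('a, 'e) vfield \<Rightarrow>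
    ('a, 'e) pifield \<Rightarrow> ('a, 'e) pifield" where
  "cov A D X Y = (\<lambda>u\<in>slitTM A. D u (X u) Y)"

definition linear_connection :: "('a, 'e::euclidean_space) chart set \<Rightarrow> ('a, 'e) connection \<Rightarrow> bool" where
  "linear_connection A D \<longleftrightarrow>
     (\<forall>u\<in>slitTM A. \<forall>x\<in>tangent_space (slit_atlas A) u. \<forall>Y\<in>pifields A. D u x Y \<in> fibre A u) \<and>
     (\<forall>u\<in>slitTM A. \<forall>x\<in>tangent_space (slit_atlas A) u. \<forall>y\<in>tangent_space (slit_atlas A) u.
        \<forall>a b. \<forall>Y\<in>pifields A. D u (a *\<^sub>R x + b *\<^sub>R y) Y = a *\<^sub>R D u x Y + b *\<^sub>R D u y Y) \<and>
     (\<forall>u\<in>slitTM A. \<forall>x\<in>tangent_space (slit_atlas A) u. \<forall>Y\<in>pifields A. \<forall>Z\<in>pifields A.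
        D u x (\<lambda>w\<in>slitTM A. Y w + Z w) = D u x Y + D u x Z) \<and>
     (\<forall>u\<in>slitTM A. \<forall>x\<in>tangent_space (slit_atlas A) u. \<forall>f\<in>Cinf (slit_atlas A). \<forall>Y\<in>pifields A.
        D u x (\<lambda>w\<in>slitTM A. f w *\<^sub>R Y w) =
          dir_deriv (slit_atlas A) u x f *\<^sub>R Y u + f u *\<^sub>R D u x Y) \<and>
     (\<forall>X\<in>vector_fields (slit_atlas A). \<forall>Y\<in>pifields A. cov A D X Y \<in> pifields A)"

definition vertical_space :: "('a, 'e::euclidean_space) chart set \<Rightarrow> ('a, 'e) tm \<Rightarrow> ('a, 'e) ttvec set" where
  "vertical_space A u = {x \<in> tangent_space (slit_atlas A) u. rho A u x = 0}"

definition horizontal_space :: "('a, 'e::euclidean_space) chart set \<Rightarrow> ('a, 'e) connection \<Rightarrow>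
    ('a, 'e) tm \<Rightarrow> ('a, 'e) ttvec set" where
  "horizontal_space A D u = {x \<in> tangent_space (slit_atlas A) u. D u x (eta A) = 0}"

definition regular_connection :: "('a, 'e::euclidean_space) chart set \<Rightarrow> ('a, 'e) connection \<Rightarrow> bool" where
  "regular_connection A D \<longleftrightarrow> linear_connection A D \<and>
     (\<forall>u\<in>slitTM A.
        vertical_space A u \<inter> horizontal_space A D u = {0} \<and>
        tangent_space (slit_atlas A) u =
          {x + y |x y. x \<in> vertical_space A u \<and> y \<in> horizontal_space A D u})"

definition hlift :: "('a, 'e::euclidean_space) chart set \<Rightarrow> ('a, 'e) connection \<Rightarrow> ('a, 'e) tm \<Rightarrow>
    ('a, 'e) tvec \<Rightarrow> ('a, 'e) ttvec" where
  "hlift A D u = inv_into (horizontal_space A D u) (rho A u)"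

definition hlift_field :: "('a, 'e::euclidean_space) chart set \<Rightarrow> ('a, 'e) connection \<Rightarrow>
    ('a, 'e) pifield \<Rightarrow> ('a, 'e) vfield" where
  "hlift_field A D X = (\<lambda>u\<in>slitTM A. hlift A D u (X u))"

definition torsion :: "('a, 'e::euclidean_space) chart set \<Rightarrow> ('a, 'e) connection \<Rightarrow>
    ('a, 'e) vfield \<Rightarrow> ('a, 'e) vfield \<Rightarrow> ('a, 'e) pifield" where
  "torsion A D X Y = (\<lambda>u\<in>slitTM A.
     cov A D X (rho_field A Y) u - cov A D Y (rho_field A X) u -
     rho_field A (lie_bracket (slit_atlas A) X Y) u)"

definition h_torsion :: "('a, 'e::euclidean_space) chart set \<Rightarrow> ('a, 'e) connection \<Rightarrow>
    ('a, 'e) pifield \<Rightarrow> ('a, 'e) pifield \<Rightarrow> ('a, 'e) pifield" where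
  "h_torsion A D X Y = torsion A D (hlift_field A D X) (hlift_field A D Y)"

definition hv_torsion :: "('a, 'e::euclidean_space) chart set \<Rightarrow> ('a, 'e) connection \<Rightarrow>
    ('a, 'e) pifield \<Rightarrow> ('a, 'e) pifield \<Rightarrow> ('a, 'e) pifield" where
  "hv_torsion A D X Y = torsion A D (vlift_field A X) (hlift_field A D Y)"

definition curvature :: "('a, 'e::euclidean_space) chart set \<Rightarrow> ('a, 'e) connection \<Rightarrow>
    ('a, 'e) vfield \<Rightarrow> ('a, 'e) vfield \<Rightarrow> ('a, 'e) pifield \<Rightarrow> ('a, 'e) pifield" where
  "curvature A D X Y Z = (\<lambda>u\<in>slitTM A.
     - cov A D X (cov A D Y Z) u + cov A D Y (cov A D X Z) u +
     cov A D (lie_bracket (slit_atlas A) X Y) Z u)"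

definition h_curvature :: "('a, 'e::euclidean_space) chart set \<Rightarrow> ('a, 'e) connection \<Rightarrow>
    ('a, 'e) pifield \<Rightarrow> ('a, 'e) pifield \<Rightarrow> ('a, 'e) pifield \<Rightarrow> ('a, 'e) pifield" where
  "h_curvature A D X Y Z = curvature A D (hlift_field A D X) (hlift_field A D Y) Z"

definition h_curvature_hat :: "('a, 'e::euclidean_space) chart set \<Rightarrow> ('a, 'e) connection \<Rightarrow>
    ('a, 'e) pifield \<Rightarrow> ('a, 'e) pifield \<Rightarrow> ('a, 'e) pifield" where
  "h_curvature_hat A D X Y = h_curvature A D X Y (eta A)"

definition deviation :: "('a, 'e::euclidean_space) chart set \<Rightarrow> ('a, 'e) connection \<Rightarrow>
    ('a, 'e) pifield \<Rightarrow> ('a, 'e) pifield" where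
  "deviation A D X = h_curvature_hat A D (eta A) X"

definition ricci :: "('a, 'e::euclidean_space) chart set \<Rightarrow> ('a, 'e) connection \<Rightarrow> ('a, 'e) tm \<Rightarrow>
    ('a, 'e) tvec \<Rightarrow> ('a, 'e) tvec \<Rightarrow> real" where
  "ricci A D u x z = trace_on (fibre A u)
     (\<lambda>y. h_curvature A D (pi_extend A u x) (pi_extend A u y) (pi_extend A u z) u)"

definition finsler_metric :: "(('a, 'e) tm \<Rightarrow> real) \<Rightarrow> ('a, 'e::euclidean_space) tm \<Rightarrow>
    ('a, 'e) tvec \<Rightarrow> ('a, 'e) tvec \<Rightarrow> real" where
  "finsler_metric L u x y =
     deriv (\<lambda>s. deriv (\<lambda>t. (1/2) * (L (fst u, snd u + s *\<^sub>R x + t *\<^sub>R y))\<^sup>2) 0) 0"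

definition finsler_manifold :: "('a, 'e::euclidean_space) chart set \<Rightarrow> (('a, 'e) tm \<Rightarrow> real) \<Rightarrow> bool" where
  "finsler_manifold A L \<longleftrightarrow> smooth_manifold A \<and>
     (\<forall>u\<in>TM A. 0 \<le> L u) \<and>
     L \<in> Cinf (slit_atlas A) \<and>
     (\<forall>u\<in>TM A. \<forall>a>0. L (fst u, a *\<^sub>R snd u) = a * L u) \<and>
     (\<forall>u\<in>slitTM A. \<forall>x\<in>fibre A u. x \<noteq> 0 \<longrightarrow> 0 < finsler_metric L u x x)"

definition cartan_connection :: "('a, 'e::euclidean_space) chart set \<Rightarrow> (('a, 'e) tm \<Rightarrow> real) \<Rightarrow>
    ('a, 'e) connection \<Rightarrow> bool" where
  "cartan_connection A L D \<longleftrightarrow> regular_connection A D \<and>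
     (\<forall>u\<in>slitTM A. \<forall>x\<in>tangent_space (slit_atlas A) u. \<forall>Y\<in>pifields A. \<forall>Z\<in>pifields A.
        dir_deriv (slit_atlas A) u x (\<lambda>w. finsler_metric L w (Y w) (Z w)) =
          finsler_metric L u (D u x Y) (Z u) + finsler_metric L u (Y u) (D u x Z)) \<and>
     (\<forall>X\<in>pifields A. \<forall>Y\<in>pifields A. \<forall>u\<in>slitTM A. h_torsion A D X Y u = 0) \<and>
     (\<forall>X\<in>pifields A. \<forall>Y\<in>pifields A. \<forall>Z\<in>pifields A. \<forall>u\<in>slitTM A.
        finsler_metric L u (hv_torsion A D X Y u) (Z u) =
        finsler_metric L u (hv_torsion A D X Z u) (Y u))"

definition scalar_curvature :: "('a, 'e::euclidean_space) chart set \<Rightarrow> (('a, 'e) tm \<Rightarrow> real) \<Rightarrow>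
    ('a, 'e) connection \<Rightarrow> ('a, 'e) tm \<Rightarrow> real" where
  "scalar_curvature A L D u = metric_trace (fibre A u) (finsler_metric L u) (ricci A D u)"

definition G_tensor :: "('a, 'e::euclidean_space) chart set \<Rightarrow> (('a, 'e) tm \<Rightarrow> real) \<Rightarrow>
    ('a, 'e) pifield \<Rightarrow> ('a, 'e) pifield \<Rightarrow> ('a, 'e) pifield \<Rightarrow> ('a, 'e) pifield" where
  "G_tensor A L X Y Z = (\<lambda>u\<in>slitTM A.
     finsler_metric L u (X u) (Z u) *\<^sub>R Y u - finsler_metric L u (Y u) (Z u) *\<^sub>R X u)"

definition concircular_curvature :: "('a, 'e::euclidean_space) chart set \<Rightarrow> (('a, 'e) tm \<Rightarrow> real) \<Rightarrow>
    ('a, 'e) connection \<Rightarrow> ('a, 'e) pifield \<Rightarrow> ('a, 'e) pifield \<Rightarrow> ('a, 'e) pifield \<Rightarrow>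
    ('a, 'e) pifield" where
  "concircular_curvature A L D X Y Z = (\<lambda>u\<in>slitTM A.
     h_curvature A D X Y Z u -
     (scalar_curvature A L D u / (real DIM('e) * (real DIM('e) - 1))) *\<^sub>R G_tensor A L X Y Z u)"

definition concircularly_flat :: "('a, 'e::euclidean_space) chart set \<Rightarrow> (('a, 'e) tm \<Rightarrow> real) \<Rightarrow>
    ('a, 'e) connection \<Rightarrow> bool" where
  "concircularly_flat A L D \<longleftrightarrow>
     (\<forall>X\<in>pifields A. \<forall>Y\<in>pifields A. \<forall>Z\<in>pifields A. \<forall>u\<in>slitTM A.
        concircular_curvature A L D X Y Z u = 0)"

definition ell :: "(('a, 'e) tm \<Rightarrow> real) \<Rightarrow> ('a, 'e::euclidean_space) tm \<Rightarrow> ('a, 'e) tvec \<Rightarrow> real" where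
  "ell L u x = finsler_metric L u (snd u) x / L u"

definition angular_metric :: "(('a, 'e) tm \<Rightarrow> real) \<Rightarrow> ('a, 'e::euclidean_space) tm \<Rightarrow>
    ('a, 'e) tvec \<Rightarrow> ('a, 'e) tvec \<Rightarrow> real" where
  "angular_metric L u x y = finsler_metric L u x y - ell L u x * ell L u y"

definition phi_tensor :: "('a, 'e::euclidean_space) chart set \<Rightarrow> (('a, 'e) tm \<Rightarrow> real) \<Rightarrow>
    ('a, 'e) tm \<Rightarrow> ('a, 'e) tvec \<Rightarrow> ('a, 'e) tvec" where
  "phi_tensor A L u = raise_on (fibre A u) (finsler_metric L u) (angular_metric L u)"

definition of_scalar_curvature :: "('a, 'e::euclidean_space) chart set \<Rightarrow> (('a, 'e) tm \<Rightarrow> real) \<Rightarrow>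
    ('a, 'e) connection \<Rightarrow> (('a, 'e) tm \<Rightarrow> real) \<Rightarrow> bool" where
  "of_scalar_curvature A L D \<epsilon> \<longleftrightarrow>
     \<epsilon> \<in> Cinf (slit_atlas A) \<and>
     (\<forall>u\<in>slitTM A. \<forall>a>0. \<epsilon> (fst u, a *\<^sub>R snd u) = \<epsilon> u) \<and>
     (\<forall>X\<in>pifields A. \<forall>u\<in>slitTM A.
        deviation A D X u = (\<epsilon> u * (L u)\<^sup>2) *\<^sub>R phi_tensor A L u (X u))"

definition of_constant_curvature :: "('a, 'e::euclidean_space) chart set \<Rightarrow> (('a, 'e) tm \<Rightarrow> real) \<Rightarrow>
    ('a, 'e) connection \<Rightarrow> bool" where
  "of_constant_curvature A L D \<longleftrightarrow>
     (\<exists>\<epsilon>. of_scalar_curvature A L D \<epsilon> \<and> (\<exists>k. \<forall>u\<in>slitTM A. \<epsilon> u = k))"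

end

theory Submission
  imports Defs
begin

text \<open>Put \<open>\<lambda> = r / (n (n - 1))\<close>. Flatness applied to \<open>\<eta>\<close> says that the curvature of the
  nonlinear connection \<open>N\<close> of the Cartan connection is \<open>R(a, b) = \<lambda> (\<theta>(a) b - \<theta>(b) a)\<close>, where
  \<open>\<theta> = g(\<eta>, _)\<close>. In a chart, the Christoffel formula for the Cartan connection, contracted with
  \<open>\<eta>\<close>, shows that \<open>N\<close> is half the vertical derivative of the spray \<open>S = N(\<eta>)\<close>. Hence the vertical
  derivative of \<open>N\<close> is symmetric, and \<open>R\<close> satisfies a vertical Bianchi identity (the cyclic sum of
  its vertical derivative vanishes) and a horizontal one (the Jacobi identity for horizontal lifts).
  For \<open>n \<ge> 3\<close> the first makes the vertical derivative of \<open>\<lambda>\<close> proportional to \<open>\<theta>\<close>, and then it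
  vanishes because \<open>\<lambda>\<close> is homogeneous of degree 0. Therefore \<open>\<lambda>\<close> is a function on the base, and the
  second makes \<open>d\<lambda>\<close> proportional to \<open>\<theta>\<close> for every direction of \<open>\<eta>\<close>; taking \<open>\<eta>\<close> in the kernel of
  \<open>d\<lambda>\<close> gives \<open>d\<lambda> = 0\<close>. So \<open>\<lambda>\<close> is constant, and flatness applied once more gives
  \<open>H = \<lambda> L\<^sup>2 \<phi>\<close>.\<close>

section \<open>Smooth maps\<close>

text \<open>The connection acts on global sections, and its smoothness is stated through global
  fields only. Hence coordinate computations go through truncated coordinate fields, and the
  Hausdorff property supplies the cut-offs. Two objects come without regularity. The horizontal map
  is a set-theoretic inverse, yet the torsion conditions already contain Lie brackets of horizontal
  lifts. Therefore N is first shown to be merely differentiable, as the solution of a linear system;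
  the torsion conditions then turn the matrix of that system into the identity, which makes N
  smooth. The factor \<lambda> is built from traces over chosen bases; it is differentiable because
  the flatness identity exhibits it as a quotient of differentiable functions. The dimension bound
  enters through a vector orthogonal to two given ones, which isolates a single coefficient of a
  cyclic sum. The passage from local to global constancy rests on the connectedness of M and of the
  punctured fibres.\<close>

lemma frechet_derivative_worksI:
  "f differentiable (at x) \<Longrightarrow> (f has_derivative frechet_derivative f (at x)) (at x)"
  by (simp add: frechet_derivative_works)

lemma Ck_on_SucD: "Ck_on (Suc k) S f \<Longrightarrow> Ck_on k S f"
proof (induction k arbitrary: f)
  case 0
  then show ?case
    by (auto intro!: continuous_at_imp_continuous_on differentiable_imp_continuous_within)
next
  case (Suc k)
  then have "\<forall>v. Ck_on (Suc k) S (\<lambda>x. frechet_derivative f (at x) v)" "\<forall>x\<in>S. f differentiable (at x)"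
    using Ck_on.simps(2) by blast+
  then show ?case
    using Suc.IH Ck_on.simps(2) by blast
qed

lemma Ck_on_subset: "Ck_on k S f \<Longrightarrow> T \<subseteq> S \<Longrightarrow> Ck_on k T f"
  by (induction k arbitrary: f) (auto intro: continuous_on_subset)

text \<open>No differentiability is assumed: \<open>frechet_derivative\<close> is a choice from the
  set of derivatives, and that set depends only on the germ of the function.\<close>

lemma frechet_derivative_cong_open:
  assumes "open S" "x \<in> S" "\<And>y. y \<in> S \<Longrightarrow> f y = g y"
  shows "frechet_derivative f (at x) = frechet_derivative g (at x)"
proof -
  have "(f has_derivative D) (at x) \<longleftrightarrow> (g has_derivative D) (at x)" for D
    using has_derivative_transform_within_open[OF _ assms(1,2), of f D UNIV g]
      has_derivative_transform_within_open[OF _ assms(1,2), of g D UNIV f] assms(3) by auto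
  then show ?thesis unfolding frechet_derivative_def by simp
qed

lemma differentiable_cong_open:
  assumes "open S" "x \<in> S" "\<And>y. y \<in> S \<Longrightarrow> f y = g y"
  shows "f differentiable (at x) \<longleftrightarrow> g differentiable (at x)"
  using has_derivative_transform_within_open[OF _ assms(1,2), of f _ UNIV g]
    has_derivative_transform_within_open[OF _ assms(1,2), of g _ UNIV f] assms(3)
  unfolding differentiable_def by metis

lemma Ck_on_cong:
  assumes "open S" "\<And>x. x \<in> S \<Longrightarrow> f x = g x" "Ck_on k S f"
  shows "Ck_on k S g"
  using assms(2,3)
proof (induction k arbitrary: f g)
  case 0
  then show ?case by (simp cong: continuous_on_cong)
next
  case (Suc k)
  have "Ck_on k S (\<lambda>x. frechet_derivative g (at x) v)" for v
    using Suc.IH[of "\<lambda>x. frechet_derivative f (at x) v" "\<lambda>x. frechet_derivative g (at x) v"] Suc.prems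
      frechet_derivative_cong_open[OF assms(1), of _ f g] by auto
  then show ?case
    using Suc.prems differentiable_cong_open[OF assms(1), of _ f g] by auto
qed

lemma Ck_on_local:
  assumes "\<And>x. x \<in> S \<Longrightarrow> \<exists>T. open T \<and> x \<in> T \<and> Ck_on k T f"
  shows "Ck_on k S f"
  using assms
proof (induction k arbitrary: f)
  case 0
  then show ?case
    by (auto intro!: continuous_at_imp_continuous_on) (metis continuous_on_eq_continuous_at)
next
  case (Suc k)
  then show ?case
    by (auto 0 4) (metis Ck_on.simps(2))+
qed

lemma has_derivative_imp_frechet:
  "(f has_derivative D) (at x) \<Longrightarrow> frechet_derivative f (at x) v = D v"
  using frechet_derivative_at by metis

lemma Ck_on_const [simp]: "Ck_on k S (\<lambda>x. c)"
  by (induction k arbitrary: c) (auto simp: has_derivative_imp_frechet[OF has_derivative_const])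

lemma Ck_on_bounded_linear:
  assumes "bounded_linear h"
  shows "Ck_on k S h"
proof (cases k)
  case 0
  then show ?thesis using assms
    by (simp add: linear_continuous_on)
next
  case (Suc l)
  have d: "(h has_derivative h) (at x)" for x using assms by (rule bounded_linear_imp_has_derivative)
  have "(\<lambda>x. frechet_derivative h (at x) v) = (\<lambda>x. h v)" for v
    using has_derivative_imp_frechet[OF d] by auto
  then show ?thesis using Suc d
    by (auto simp: differentiable_def)
qed

lemma Ck_on_add:
  assumes "open S" "Ck_on k S f" "Ck_on k S g"
  shows "Ck_on k S (\<lambda>x. f x + g x)"
  using assms(2,3)
proof (induction k arbitrary: f g)
  case 0
  then show ?case by (auto intro: continuous_intros)
next
  case (Suc k)
  have d: "((\<lambda>x. f x + g x) has_derivative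
      (\<lambda>v. frechet_derivative f (at x) v + frechet_derivative g (at x) v)) (at x)" if "x \<in> S" for x
    using Suc.prems that by (auto intro!: has_derivative_add simp: frechet_derivative_worksI)
  have "Ck_on k S (\<lambda>x. frechet_derivative (\<lambda>x. f x + g x) (at x) v)" for v
    by (rule Ck_on_cong[OF assms(1) _ Suc.IH[of "\<lambda>x. frechet_derivative f (at x) v" "\<lambda>x. frechet_derivative g (at x) v"]])
      (use Suc.prems has_derivative_imp_frechet[OF d] in auto)
  then show ?case using d by (auto simp: differentiable_def)
qed

lemma Ck_on_sum:
  assumes "open S" "\<And>i. i \<in> I \<Longrightarrow> Ck_on k S (f i)"
  shows "Ck_on k S (\<lambda>x. \<Sum>i\<in>I. f i x)"
  using assms(2) by (induction I rule: infinite_finite_induct) (auto intro: Ck_on_add assms(1))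

lemma Ck_on_bilinear:
  assumes "open S" "bounded_bilinear p" "Ck_on k S f" "Ck_on k S g"
  shows "Ck_on k S (\<lambda>x. p (f x) (g x))"
  using assms(3,4)
proof (induction k arbitrary: f g)
  case 0
  then show ?case using bounded_bilinear.continuous_on[OF assms(2)] by auto
next
  case (Suc k)
  have d: "((\<lambda>x. p (f x) (g x)) has_derivative
      (\<lambda>v. p (f x) (frechet_derivative g (at x) v) + p (frechet_derivative f (at x) v) (g x))) (at x)"
    if "x \<in> S" for x
    using Suc.prems that
    by (auto intro!: bounded_bilinear.FDERIV[OF assms(2)] simp: frechet_derivative_worksI)
  have "Ck_on k S (\<lambda>x. p (f x) (frechet_derivative g (at x) v) + p (frechet_derivative f (at x) v) (g x))" for v
    using Suc.prems Suc.prems[THEN Ck_on_SucD] by (auto intro!: Ck_on_add Suc.IH assms(1))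
  then have "Ck_on k S (\<lambda>x. frechet_derivative (\<lambda>x. p (f x) (g x)) (at x) v)" for v
    by (rule Ck_on_cong[OF assms(1), rotated]) (use has_derivative_imp_frechet[OF d] in auto)
  then show ?case using d by (auto simp: differentiable_def)
qed

lemma Ck_on_linear_comp:
  assumes "open S" "bounded_linear h" "Ck_on k S f"
  shows "Ck_on k S (\<lambda>x. h (f x))"
  using assms(3)
proof (induction k arbitrary: f)
  case 0
  then show ?case using bounded_linear.continuous_on[OF assms(2)] by auto
next
  case (Suc k)
  have d: "((\<lambda>x. h (f x)) has_derivative (\<lambda>v. h (frechet_derivative f (at x) v))) (at x)"
    if "x \<in> S" for x
    using Suc.prems that
    by (auto intro!: bounded_linear.has_derivative[OF assms(2)] simp: frechet_derivative_worksI)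
  have "Ck_on k S (\<lambda>x. frechet_derivative (\<lambda>x. h (f x)) (at x) v)" for v
    by (rule Ck_on_cong[OF assms(1) _ Suc.IH[of "\<lambda>x. frechet_derivative f (at x) v"]])
     (use Suc.prems has_derivative_imp_frechet[OF d] in auto)
  then show ?case using d by (auto simp: differentiable_def)
qed

lemma linear_eq_sum_Basis:
  fixes h :: "'b::euclidean_space \<Rightarrow> 'c::real_vector"
  assumes "linear h"
  shows "h v = (\<Sum>b\<in>Basis. (v \<bullet> b) *\<^sub>R h b)"
proof -
  have "h v = h (\<Sum>b\<in>Basis. (v \<bullet> b) *\<^sub>R b)" by (simp add: euclidean_representation)
  also have "\<dots> = (\<Sum>b\<in>Basis. (v \<bullet> b) *\<^sub>R h b)"
    using assms by (simp add: linear_sum linear_scale)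
  finally show ?thesis .
qed

text \<open>The chain rule differentiates \<open>f\<close> in a direction that moves with
  \<open>x\<close>, whereas \<open>Ck_on\<close> speaks of fixed directions. Expanding the moving
  direction in \<open>Basis\<close> leaves derivatives of \<open>f\<close> in fixed directions, to
  which the induction hypothesis applies.\<close>

lemma Ck_on_compose:
  fixes f :: "'b::euclidean_space \<Rightarrow> 'c::real_normed_vector"
  assumes "open S" "open T" "g ` S \<subseteq> T" "Ck_on k T f" "Ck_on k S g"
  shows "Ck_on k S (\<lambda>x. f (g x))"
  using assms(4,5)
proof (induction k arbitrary: f)
  case 0
  then show ?case using assms(3) by (auto intro: continuous_on_compose2)
next
  case (Suc k)
  have d: "((\<lambda>x. f (g x)) has_derivative
      (\<lambda>v. frechet_derivative f (at (g x)) (frechet_derivative g (at x) v))) (at x)" if "x \<in> S" for x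
    using Suc.prems that assms(3)
    by (intro has_derivative_compose[of g _ x UNIV f])
      (auto simp: image_subset_iff intro: frechet_derivative_worksI)
  have eq: "frechet_derivative (\<lambda>x. f (g x)) (at x) v =
    (\<Sum>b\<in>Basis. (frechet_derivative g (at x) v \<bullet> b) *\<^sub>R frechet_derivative f (at (g x)) b)" if "x \<in> S" for x v
    using has_derivative_imp_frechet[OF d[OF that], of v] Suc.prems(1) assms(3) that
     linear_eq_sum_Basis[OF linear_frechet_derivative, of f "at (g x)"] by auto
  have "Ck_on k S (\<lambda>x. frechet_derivative g (at x) v \<bullet> b)" for v b
    by (rule Ck_on_linear_comp[OF assms(1) bounded_linear_inner_left]) (use Suc.prems in auto)
  moreover have "Ck_on k S (\<lambda>x. frechet_derivative f (at (g x)) b)" for b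
    by (rule Suc.IH) (use Suc.prems Suc.prems(2)[THEN Ck_on_SucD] in auto)
  ultimately have ck: "Ck_on k S (\<lambda>x. \<Sum>b\<in>Basis. (frechet_derivative g (at x) v \<bullet> b) *\<^sub>R
      frechet_derivative f (at (g x)) b)" for v
    by (intro Ck_on_sum Ck_on_bilinear[OF _ bounded_bilinear_scaleR] assms(1))
  have "Ck_on k S (\<lambda>x. frechet_derivative (\<lambda>x. f (g x)) (at x) v)" for v
    by (rule Ck_on_cong[OF assms(1) _ ck[of v]]) (simp add: eq)
  then show ?case using d by (auto simp: differentiable_def)
qed

lemma smooth_on_subset: "smooth_on S f \<Longrightarrow> T \<subseteq> S \<Longrightarrow> smooth_on T f"
  unfolding smooth_on_def using Ck_on_subset by blast

lemma smooth_on_cong: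
  "open S \<Longrightarrow> (\<And>x. x \<in> S \<Longrightarrow> f x = g x) \<Longrightarrow> smooth_on S f \<Longrightarrow> smooth_on S g"
  unfolding smooth_on_def using Ck_on_cong by blast

lemma smooth_on_local:
  "(\<And>x. x \<in> S \<Longrightarrow> \<exists>T. open T \<and> x \<in> T \<and> smooth_on T f) \<Longrightarrow> smooth_on S f"
  unfolding smooth_on_def using Ck_on_local by metis

lemma smooth_on_const [simp]: "smooth_on S (\<lambda>x. c)"
  by (simp add: smooth_on_def)

lemma smooth_on_bounded_linear: "bounded_linear h \<Longrightarrow> smooth_on S h"
  by (simp add: smooth_on_def Ck_on_bounded_linear)

lemma smooth_on_add: "open S \<Longrightarrow> smooth_on S f \<Longrightarrow> smooth_on S g \<Longrightarrow> smooth_on S (\<lambda>x. f x + g x)"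
  by (simp add: smooth_on_def Ck_on_add)

lemma smooth_on_sum:
  "open S \<Longrightarrow> (\<And>i. i \<in> I \<Longrightarrow> smooth_on S (f i)) \<Longrightarrow> smooth_on S (\<lambda>x. \<Sum>i\<in>I. f i x)"
  by (simp add: smooth_on_def Ck_on_sum)

lemma smooth_on_bilinear:
  "open S \<Longrightarrow> bounded_bilinear p \<Longrightarrow> smooth_on S f \<Longrightarrow> smooth_on S g \<Longrightarrow> smooth_on S (\<lambda>x. p (f x) (g x))"
  by (simp add: smooth_on_def Ck_on_bilinear)

lemmas smooth_on_scaleR = smooth_on_bilinear[OF _ bounded_bilinear_scaleR]
lemmas smooth_on_mult = smooth_on_bilinear[OF _ bounded_bilinear_mult]
lemmas smooth_on_inner = smooth_on_bilinear[OF _ bounded_bilinear_inner]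

lemma smooth_on_linear_comp:
  "open S \<Longrightarrow> bounded_linear h \<Longrightarrow> smooth_on S f \<Longrightarrow> smooth_on S (\<lambda>x. h (f x))"
  by (simp add: smooth_on_def Ck_on_linear_comp)

lemma smooth_on_diff:
  assumes "open S" "smooth_on S f" "smooth_on S g" shows "smooth_on S (\<lambda>x. f x - g x)"
  using smooth_on_add[OF assms(1,2) smooth_on_linear_comp[OF assms(1) bounded_linear_minus[OF bounded_linear_ident] assms(3)]]
  by simp

lemma smooth_on_compose:
  fixes f :: "'b::euclidean_space \<Rightarrow> 'c::real_normed_vector"
  shows "open S \<Longrightarrow> open T \<Longrightarrow> g ` S \<subseteq> T \<Longrightarrow> smooth_on T f \<Longrightarrow> smooth_on S g \<Longrightarrow> smooth_on S (\<lambda>x. f (g x))"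
  by (simp add: smooth_on_def Ck_on_compose)

lemma smooth_on_Pair:
  fixes f :: "'a::real_normed_vector \<Rightarrow> 'b::real_normed_vector" and g :: "'a \<Rightarrow> 'c::real_normed_vector"
  assumes "open S" "smooth_on S f" "smooth_on S g" shows "smooth_on S (\<lambda>x. (f x, g x))"
proof -
  have "bounded_linear (\<lambda>x. (x::'b, 0::'c))" "bounded_linear (\<lambda>x. (0::'b, x::'c))"
    by (auto intro!: bounded_linear_Pair bounded_linear_ident bounded_linear_zero)
  from smooth_on_add[OF assms(1) smooth_on_linear_comp[OF assms(1) this(1) assms(2)]
    smooth_on_linear_comp[OF assms(1) this(2) assms(3)]]
  show ?thesis by simp
qed

lemma smooth_on_frechet: "smooth_on S f \<Longrightarrow> smooth_on S (\<lambda>x. frechet_derivative f (at x) v)"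
  unfolding smooth_on_def using Ck_on.simps(2) by blast

lemma smooth_on_differentiable: "smooth_on S f \<Longrightarrow> x \<in> S \<Longrightarrow> f differentiable (at x)"
  unfolding smooth_on_def using Ck_on.simps(2) by blast

lemma smooth_on_has_derivative:
  "smooth_on S f \<Longrightarrow> x \<in> S \<Longrightarrow> (f has_derivative frechet_derivative f (at x)) (at x)"
  using smooth_on_differentiable frechet_derivative_worksI by blast

lemma smooth_on_continuous: "smooth_on S f \<Longrightarrow> continuous_on S f"
  unfolding smooth_on_def using Ck_on.simps(1) by blast

text \<open>The derivative is a polynomial in \<open>inverse\<close> itself, so order
  \<open>k\<close> gives order \<open>Suc k\<close>.\<close>

lemma smooth_on_inverse: "smooth_on {x. x \<noteq> 0} (inverse :: real \<Rightarrow> real)"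
  unfolding smooth_on_def
proof
  have op: "open {x::real. x \<noteq> 0}" by (simp add: open_Collect_neq)
  fix k show "Ck_on k {x. x \<noteq> 0} (inverse :: real \<Rightarrow> real)"
  proof (induction k)
    case 0 then show ?case by (auto intro!: continuous_intros)
  next
    case (Suc k)
    have d: "(inverse has_derivative (\<lambda>v. - (inverse x * v * inverse x))) (at x)" if "x \<noteq> 0" for x :: real
      using that by (rule has_derivative_inverse')
    have "Ck_on k {x. x \<noteq> 0} (\<lambda>x. (-v) * (inverse x * inverse x))" for v :: real
      by (intro Ck_on_bilinear[OF op bounded_bilinear_mult] Suc) auto
    then have "Ck_on k {x. x \<noteq> 0} (\<lambda>x. frechet_derivative inverse (at x) v)" for v :: real
      by (rule Ck_on_cong[OF op, rotated]) (simp add: has_derivative_imp_frechet[OF d])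
    then show ?case using d by (auto simp: differentiable_def)
  qed
qed

text \<open>The class of functions \<open>p(1/t) exp(-1/t)\<close> on the positive half-line is closed under
  differentiation.\<close>

definition flat_poly :: "real poly \<Rightarrow> real \<Rightarrow> real" where
  "flat_poly p t = (if t > 0 then poly p (1/t) * exp (- (1/t)) else 0)"

lemma flat_poly_tendsto: "((\<lambda>t. poly p (1/t) * exp (- (1/t))) \<longlongrightarrow> 0) (at_right (0::real))"
proof -
  have "((\<lambda>s. \<Sum>i\<le>degree p. coeff p i * (s ^ i / exp s)) \<longlongrightarrow> (\<Sum>i\<le>degree p. coeff p i * 0)) (at_top :: real filter)"
    by (intro tendsto_intros tendsto_power_div_exp_0)
  moreover have "(\<lambda>s. \<Sum>i\<le>degree p. coeff p i * (s ^ i / exp s)) = (\<lambda>s. poly p s * exp (- s))"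
    by (auto simp: poly_altdef sum_divide_distrib exp_minus divide_inverse sum_distrib_right mult.assoc)
  ultimately have "((\<lambda>s. poly p s * exp (- s)) \<longlongrightarrow> 0) (at_top :: real filter)"
    by simp
  from filterlim_compose[OF this filterlim_inverse_at_top_right] show ?thesis
    by (simp add: divide_inverse)
qed

text \<open>With s = 1/t, differentiation in t is multiplication by -s^2 after differentiation in s;
  applied to p(s) exp(-s) this gives s^2 (p - p')(s) exp(-s).\<close>

lemma flat_poly_has_derivative:
  "(flat_poly p has_real_derivative flat_poly (monom 1 2 * (p - pderiv p)) t) (at t)"
proof -
  consider "t > 0" | "t < 0" | "t = 0" by linarith
  then show ?thesis
  proof cases
    case 1
    have "((\<lambda>t. poly p (1/t) * exp (- (1/t))) has_real_derivative
        (poly (pderiv p) (1/t) * (- 1 / t\<^sup>2)) * exp (- (1/t)) + exp (- (1/t)) * (1 / t\<^sup>2) * poly p (1/t)) (at t)"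
      using 1 by (auto intro!: derivative_eq_intros DERIV_chain2[OF poly_DERIV] simp: power2_eq_square)
    moreover have "(poly (pderiv p) (1/t) * (- 1 / t\<^sup>2)) * exp (- (1/t)) + exp (- (1/t)) * (1 / t\<^sup>2) * poly p (1/t)
        = flat_poly (monom 1 2 * (p - pderiv p)) t"
      using 1 by (simp add: flat_poly_def poly_monom power_one_over algebra_simps)
    ultimately have "((\<lambda>t. poly p (1/t) * exp (- (1/t))) has_real_derivative
        flat_poly (monom 1 2 * (p - pderiv p)) t) (at t)" by simp
    then show ?thesis
      by (rule has_field_derivative_transform_within_open[where S="{0<..}"]) (use 1 in \<open>auto simp: flat_poly_def\<close>)
  next
    case 2
    have "((\<lambda>t. 0) has_real_derivative flat_poly (monom 1 2 * (p - pderiv p)) t) (at t)"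
      using 2 by (simp add: flat_poly_def)
    then show ?thesis
      by (rule has_field_derivative_transform_within_open[where S="{..<0}"]) (use 2 in \<open>auto simp: flat_poly_def\<close>)
  next
    case 3
    \<comment> \<open>Dividing by h multiplies the polynomial by its variable, so the difference
      quotient at 0 is again of the form covered by \<open>flat_poly_tendsto\<close>, with
      \<open>pCons 0 p\<close>.\<close>
    have "((\<lambda>h. flat_poly p h / h) \<longlongrightarrow> 0) (at_right 0)"
    proof (rule Lim_transform_eventually[OF flat_poly_tendsto[of "pCons 0 p"]])
      show "\<forall>\<^sub>F t in at_right 0. poly (pCons 0 p) (1 / t) * exp (- (1 / t)) = flat_poly p t / t"
        by (rule eventually_at_rightI[of 0 1]) (auto simp: flat_poly_def)
    qed
    moreover have "((\<lambda>h. flat_poly p h / h) \<longlongrightarrow> 0) (at_left 0)"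
      by (rule Lim_transform_eventually[OF tendsto_const[of 0]], rule eventually_at_leftI[of "-1" 0])
        (auto simp: flat_poly_def)
    ultimately have "((\<lambda>h. flat_poly p h / h) \<longlongrightarrow> 0) (at 0)"
      using filterlim_at_split by blast
    then show ?thesis using 3
      by (simp add: has_field_derivative_iff flat_poly_def)
  qed
qed

lemma smooth_on_flat_poly: "smooth_on S (flat_poly p)"
proof -
  have d: "(flat_poly p has_derivative (\<lambda>v. v * flat_poly (monom 1 2 * (p - pderiv p)) t)) (at t)" for p t
    using flat_poly_has_derivative[of p t] by (simp add: has_field_derivative_def mult.commute[of _ "flat_poly _ _"])
  have "Ck_on k UNIV (flat_poly p)" for k
  proof (induction k arbitrary: p)
    case 0
    then show ?case using d
      by (auto intro!: continuous_at_imp_continuous_on has_derivative_continuous)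
  next
    case (Suc k)
    have "Ck_on k UNIV (\<lambda>t. v * flat_poly (monom 1 2 * (p - pderiv p)) t)" for v :: real
      by (intro Ck_on_bilinear[OF _ bounded_bilinear_mult] Suc) auto
    then show ?case using d by (auto simp: has_derivative_imp_frechet[OF d] differentiable_def)
  qed
  then show ?thesis by (metis smooth_on_def smooth_on_subset subset_UNIV)
qed

text \<open>\<open>flat_poly 1\<close> is exp(-1/t) on the positive half-line. The denominator never
  vanishes, because 2 - t and t - 1 cannot both be nonpositive.\<close>

definition smooth_step :: "real \<Rightarrow> real" where
  "smooth_step t = flat_poly 1 (2 - t) * inverse (flat_poly 1 (2 - t) + flat_poly 1 (t - 1))"

lemma smooth_step_eq: "t \<le> 1 \<Longrightarrow> smooth_step t = 1" "2 \<le> t \<Longrightarrow> smooth_step t = 0"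
  by (auto simp: smooth_step_def flat_poly_def)

lemma smooth_on_smooth_step: "smooth_on UNIV smooth_step"
proof -
  have 1: "smooth_on UNIV (\<lambda>t. flat_poly 1 (2 - t))" "smooth_on UNIV (\<lambda>t. flat_poly 1 (t - 1))"
    by (rule smooth_on_compose[where T=UNIV, OF _ _ _ smooth_on_flat_poly];
        simp add: smooth_on_diff smooth_on_bounded_linear)+
  have pos: "flat_poly 1 (2 - t) + flat_poly 1 (t - 1) \<noteq> 0" for t
    by (cases "t > 1"; cases "t < 2") (auto simp: flat_poly_def add_pos_pos less_imp_neq[symmetric])
  have "smooth_on UNIV (\<lambda>t. inverse (flat_poly 1 (2 - t) + flat_poly 1 (t - 1)))"
    by (rule smooth_on_compose[where T="{x. x \<noteq> 0}", OF _ _ _ smooth_on_inverse])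
      (use pos 1 in \<open>auto intro: smooth_on_add open_Collect_neq\<close>)
  then show ?thesis unfolding smooth_step_def[abs_def] using 1 by (intro smooth_on_mult) auto
qed

section \<open>Symmetry of second derivatives\<close>

lemma second_difference_mvt:
  fixes f :: "'a::real_normed_vector \<Rightarrow> real"
  assumes f: "Ck_on 2 S f" and r: "r > 0"
    and S: "\<And>s t. 0 \<le> s \<Longrightarrow> s \<le> r \<Longrightarrow> 0 \<le> t \<Longrightarrow> t \<le> r \<Longrightarrow> x + s *\<^sub>R v + t *\<^sub>R w \<in> S"
  shows "\<exists>s t. 0 < s \<and> s < r \<and> 0 < t \<and> t < r \<and>
    f (x + r *\<^sub>R v + r *\<^sub>R w) - f (x + r *\<^sub>R v) - f (x + r *\<^sub>R w) + f x =
    r * r * frechet_derivative (\<lambda>y. frechet_derivative f (at y) v) (at (x + s *\<^sub>R v + t *\<^sub>R w)) w"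
proof -
  have f1: "(f has_derivative frechet_derivative f (at y)) (at y)" if "y \<in> S" for y
    using f that by (auto simp: numeral_2_eq_2 intro: frechet_derivative_worksI)
  let ?g = "\<lambda>y. frechet_derivative f (at y) v"
  have f2: "(?g has_derivative frechet_derivative ?g (at y)) (at y)" if "y \<in> S" for y
    using f that by (auto simp: numeral_2_eq_2 intro: frechet_derivative_worksI)
  have lin: "frechet_derivative f (at y) (c *\<^sub>R z) = c * frechet_derivative f (at y) z" if "y \<in> S" for y z c
    using has_derivative_bounded_linear[OF f1[OF that]] by (simp add: linear_simps)
  have lin2: "frechet_derivative ?g (at y) (c *\<^sub>R z) = c * frechet_derivative ?g (at y) z" if "y \<in> S" for y z c
    using has_derivative_bounded_linear[OF f2[OF that]] by (simp add: linear_simps)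
  have d1: "((\<lambda>s. f (x + s *\<^sub>R v + t *\<^sub>R w)) has_real_derivative ?g (x + s *\<^sub>R v + t *\<^sub>R w)) (at s)"
    if "0 \<le> s" "s \<le> r" "0 \<le> t" "t \<le> r" for s t
  proof -
    have "((\<lambda>s. f (x + s *\<^sub>R v + t *\<^sub>R w)) has_derivative
        (\<lambda>c. frechet_derivative f (at (x + s *\<^sub>R v + t *\<^sub>R w)) (c *\<^sub>R v))) (at s)"
      by (rule has_derivative_compose[OF _ f1]) (use S that in \<open>auto intro!: derivative_eq_intros\<close>)
    then show ?thesis using S that by (simp add: has_field_derivative_def lin mult.commute[of _ "_ v"])
  qed
  have d2: "((\<lambda>t. ?g (x + s *\<^sub>R v + t *\<^sub>R w)) has_real_derivative
      frechet_derivative ?g (at (x + s *\<^sub>R v + t *\<^sub>R w)) w) (at t)"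
    if "0 \<le> s" "s \<le> r" "0 \<le> t" "t \<le> r" for s t
  proof -
    have "((\<lambda>t. ?g (x + s *\<^sub>R v + t *\<^sub>R w)) has_derivative
        (\<lambda>c. frechet_derivative ?g (at (x + s *\<^sub>R v + t *\<^sub>R w)) (c *\<^sub>R w))) (at t)"
      by (rule has_derivative_compose[OF _ f2]) (use S that in \<open>auto intro!: derivative_eq_intros\<close>)
    then show ?thesis using S that by (simp add: has_field_derivative_def lin2 mult.commute[of _ "_ w"])
  qed
  \<comment> \<open>The second difference is a first difference in \<open>s\<close> of the first
    difference in \<open>w\<close>; the mean value theorem is applied in \<open>s\<close> here and
    in \<open>t\<close> afterwards.\<close>
  have "\<exists>s. 0 < s \<and> s < r \<and>
     (f (x + r *\<^sub>R v + r *\<^sub>R w) - f (x + r *\<^sub>R v + 0 *\<^sub>R w)) - (f (x + 0 *\<^sub>R v + r *\<^sub>R w) - f (x + 0 *\<^sub>R v + 0 *\<^sub>R w))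
     = (r - 0) * (?g (x + s *\<^sub>R v + r *\<^sub>R w) - ?g (x + s *\<^sub>R v + 0 *\<^sub>R w))"
    using r by (intro MVT2 DERIV_diff d1) auto
  then obtain s where s: "0 < s" "s < r" and
    1: "f (x + r *\<^sub>R v + r *\<^sub>R w) - f (x + r *\<^sub>R v) - f (x + r *\<^sub>R w) + f x
     = r * (?g (x + s *\<^sub>R v + r *\<^sub>R w) - ?g (x + s *\<^sub>R v + 0 *\<^sub>R w))" by auto
  have "\<exists>t. 0 < t \<and> t < r \<and> ?g (x + s *\<^sub>R v + r *\<^sub>R w) - ?g (x + s *\<^sub>R v + 0 *\<^sub>R w) =
     (r - 0) * frechet_derivative ?g (at (x + s *\<^sub>R v + t *\<^sub>R w)) w"
    using r s by (intro MVT2 d2) auto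
  then obtain t where t: "0 < t" "t < r" "?g (x + s *\<^sub>R v + r *\<^sub>R w) - ?g (x + s *\<^sub>R v + 0 *\<^sub>R w) =
     r * frechet_derivative ?g (at (x + s *\<^sub>R v + t *\<^sub>R w)) w" by auto
  show ?thesis
    by (intro exI[of _ s] exI[of _ t]) (simp only: 1 t s mult.assoc)
qed

text \<open>The second difference over a small parallelogram does not see the order of
  \<open>v\<close> and \<open>w\<close>, and it equals either mixed derivative at some point nearby.
  If the two derivatives differed at \<open>x\<close>, continuity would keep them apart on a small
  enough parallelogram.\<close>

lemma second_derivative_symmetric_real:
  fixes f :: "'a::real_normed_vector \<Rightarrow> real"
  assumes S: "open S" "x \<in> S" and f: "Ck_on 2 S f"
  shows "frechet_derivative (\<lambda>y. frechet_derivative f (at y) v) (at x) w =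
         frechet_derivative (\<lambda>y. frechet_derivative f (at y) w) (at x) v" (is "?h x = ?k x")
proof (rule ccontr)
  assume "?h x \<noteq> ?k x"
  then have e: "\<bar>?h x - ?k x\<bar> / 2 > 0" (is "?e > 0") by auto
  have tri: "False" if "X = Y" "\<bar>X - p\<bar> < \<bar>p - q\<bar> / 2" "\<bar>Y - q\<bar> < \<bar>p - q\<bar> / 2" for X Y p q :: real
    using that abs_triangle_ineq4[of "X - q" "X - p"] by simp
  have "continuous_on S ?h" "continuous_on S ?k"
    using f by (auto simp: numeral_2_eq_2)
  then have "isCont ?h x" "isCont ?k x" using S continuous_on_eq_continuous_at by blast+
  then have "\<exists>d>0. \<forall>y. dist y x < d \<longrightarrow> \<bar>?h y - ?h x\<bar> < ?e"
    "\<exists>d>0. \<forall>y. dist y x < d \<longrightarrow> \<bar>?k y - ?k x\<bar> < ?e"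
    using e by (auto simp only: continuous_at_eps_delta dist_real_def)
  then obtain d1 d2 where d: "d1 > 0" "d2 > 0"
    "\<And>y. dist y x < d1 \<Longrightarrow> \<bar>?h y - ?h x\<bar> < ?e" "\<And>y. dist y x < d2 \<Longrightarrow> \<bar>?k y - ?k x\<bar> < ?e"
    by auto
  obtain d3 where d3: "d3 > 0" "ball x d3 \<subseteq> S" using S open_contains_ball by blast
  define m where "m = min d1 (min d2 d3)"
  \<comment> \<open>Small enough for the whole parallelogram to lie within distance m/2 of
    \<open>x\<close>; the summand 1 covers the case that \<open>v\<close> and \<open>w\<close> both
    vanish.\<close>
  define r where "r = m / (2 * (norm v + norm w + 1))"
  have m: "m > 0" using d d3 by (simp add: m_def)
  have pos: "norm v + norm w + 1 > 0" by (smt (verit) norm_ge_zero)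
  have r: "r > 0" unfolding r_def using m pos by simp
  have near: "dist (x + s *\<^sub>R v + t *\<^sub>R w) x < m" if "0 \<le> s" "s \<le> r" "0 \<le> t" "t \<le> r" for s t
  proof -
    have "dist (x + s *\<^sub>R v + t *\<^sub>R w) x \<le> s * norm v + t * norm w"
      using that norm_triangle_ineq[of "s *\<^sub>R v" "t *\<^sub>R w"] by (simp add: dist_norm algebra_simps)
    also have "\<dots> \<le> r * norm v + r * norm w"
      using that by (intro add_mono mult_right_mono) auto
    also have "\<dots> \<le> r * (norm v + norm w + 1)" using r by (simp add: algebra_simps)
    also have "\<dots> = m / 2" unfolding r_def using pos by (simp add: field_simps)
    also have "\<dots> < m" using m by simp
    finally show ?thesis .
  qed
  then have inS: "x + s *\<^sub>R v + t *\<^sub>R w \<in> S" if "0 \<le> s" "s \<le> r" "0 \<le> t" "t \<le> r" for s t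
    using d3(2) that by (force simp: m_def dist_commute)
  have inS': "x + s *\<^sub>R w + t *\<^sub>R v \<in> S" if "0 \<le> s" "s \<le> r" "0 \<le> t" "t \<le> r" for s t
    using inS[of t s] that by (simp add: add_ac)
  obtain s t where st: "0 < s" "s < r" "0 < t" "t < r"
    "f (x + r *\<^sub>R v + r *\<^sub>R w) - f (x + r *\<^sub>R v) - f (x + r *\<^sub>R w) + f x = r * r * ?h (x + s *\<^sub>R v + t *\<^sub>R w)"
    using second_difference_mvt[OF f r, of x v w] inS by blast
  obtain s' t' where st': "0 < s'" "s' < r" "0 < t'" "t' < r"
    "f (x + r *\<^sub>R w + r *\<^sub>R v) - f (x + r *\<^sub>R w) - f (x + r *\<^sub>R v) + f x = r * r * ?k (x + s' *\<^sub>R w + t' *\<^sub>R v)"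
    using second_difference_mvt[OF f r, of x w v] inS inS' by blast
  have "r * r * ?h (x + s *\<^sub>R v + t *\<^sub>R w) = r * r * ?k (x + s' *\<^sub>R w + t' *\<^sub>R v)"
  proof -
    have "x + r *\<^sub>R w + r *\<^sub>R v = x + r *\<^sub>R v + r *\<^sub>R w" by (simp add: add_ac)
    from st'(5)[unfolded this] st(5) show ?thesis by linarith
  qed
  then have "?h (x + s *\<^sub>R v + t *\<^sub>R w) = ?k (x + s' *\<^sub>R w + t' *\<^sub>R v)" using r by simp
  moreover have "\<bar>?h (x + s *\<^sub>R v + t *\<^sub>R w) - ?h x\<bar> < ?e"
    using near[of s t] st by (intro d(3)) (auto simp: m_def)
  moreover have "\<bar>?k (x + s' *\<^sub>R w + t' *\<^sub>R v) - ?k x\<bar> < ?e"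
    using near[of t' s'] st' by (intro d(4)) (auto simp: m_def add_ac)
  ultimately show False using tri by blast
qed

lemma second_derivative_symmetric:
  fixes f :: "'a::real_normed_vector \<Rightarrow> 'b::euclidean_space"
  assumes S: "open S" "x \<in> S" and f: "smooth_on S f"
  shows "frechet_derivative (\<lambda>y. frechet_derivative f (at y) v) (at x) w =
         frechet_derivative (\<lambda>y. frechet_derivative f (at y) w) (at x) v"
proof (rule euclidean_eqI)
  fix b :: 'b assume "b \<in> Basis"
  have fb: "smooth_on S (\<lambda>y. f y \<bullet> b)"
    by (rule smooth_on_linear_comp[OF S(1) bounded_linear_inner_left f])
  have 1: "frechet_derivative (\<lambda>y. g y \<bullet> b) (at y) u = frechet_derivative g (at y) u \<bullet> b"
    if "smooth_on S g" "y \<in> S" for g :: "'a \<Rightarrow> 'b" and y u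
    by (rule has_derivative_imp_frechet)
      (intro bounded_linear.has_derivative[OF bounded_linear_inner_left] smooth_on_has_derivative[OF that])
  have 2: "frechet_derivative (\<lambda>y. frechet_derivative (\<lambda>y. f y \<bullet> b) (at y) u) (at x) u' =
      frechet_derivative (\<lambda>y. frechet_derivative f (at y) u) (at x) u' \<bullet> b" for u u'
    using frechet_derivative_cong_open[OF S, of "\<lambda>y. frechet_derivative (\<lambda>y. f y \<bullet> b) (at y) u"
        "\<lambda>y. frechet_derivative f (at y) u \<bullet> b"] 1[OF f] 1[OF smooth_on_frechet[OF f] S(2)] by auto
  show "frechet_derivative (\<lambda>y. frechet_derivative f (at y) v) (at x) w \<bullet> b =
         frechet_derivative (\<lambda>y. frechet_derivative f (at y) w) (at x) v \<bullet> b"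
    using second_derivative_symmetric_real[OF S, of "\<lambda>y. f y \<bullet> b" v w] fb 2
    by (simp add: smooth_on_def)
qed

text \<open>Expanding the second argument in \<open>Basis\<close> reduces this to finitely many
  products of a scalar with a vector, so it suffices that \<open>F\<close> is differentiable for
  each fixed second argument.\<close>

lemma has_derivative_linear_family:
  fixes F :: "'a::real_normed_vector \<Rightarrow> 'b::euclidean_space \<Rightarrow> 'c::real_normed_vector"
  assumes T: "open T" "x \<in> T" and lin: "\<And>y. y \<in> T \<Longrightarrow> linear (F y)"
    and F: "\<And>\<xi>. ((\<lambda>y. F y \<xi>) has_derivative F' \<xi>) (at x)" and h: "(h has_derivative h') (at x)"
  shows "((\<lambda>y. F y (h y)) has_derivative (\<lambda>v. F' (h x) v + F x (h' v))) (at x)"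
proof -
  have rep: "F y \<xi> = (\<Sum>b\<in>Basis. (\<xi> \<bullet> b) *\<^sub>R F y b)" if "y \<in> T" for y \<xi>
    using lin[OF that] by (rule linear_eq_sum_Basis)
  have "((\<lambda>y. \<Sum>b\<in>Basis. (\<xi> \<bullet> b) *\<^sub>R F y b) has_derivative (\<lambda>v. \<Sum>b\<in>Basis. (\<xi> \<bullet> b) *\<^sub>R F' b v)) (at x)" for \<xi>
    by (intro has_derivative_sum has_derivative_scaleR_right F)
  then have "((\<lambda>y. F y \<xi>) has_derivative (\<lambda>v. \<Sum>b\<in>Basis. (\<xi> \<bullet> b) *\<^sub>R F' b v)) (at x)" for \<xi>
    by (rule has_derivative_transform_within_open[OF _ T]) (simp add: rep[symmetric])
  \<comment> \<open>Linearity of \<open>F'\<close> in \<xi> is not among the assumptions; uniqueness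
    of derivatives forces it.\<close>
  then have F': "F' \<xi> = (\<lambda>v. \<Sum>b\<in>Basis. (\<xi> \<bullet> b) *\<^sub>R F' b v)" for \<xi>
    using F[of \<xi>] has_derivative_unique by blast
  have "((\<lambda>y. \<Sum>b\<in>Basis. (h y \<bullet> b) *\<^sub>R F y b) has_derivative
      (\<lambda>v. \<Sum>b\<in>Basis. (h x \<bullet> b) *\<^sub>R F' b v + (h' v \<bullet> b) *\<^sub>R F x b)) (at x)"
    by (intro has_derivative_sum has_derivative_scaleR F has_derivative_inner_left h)
  then have "((\<lambda>y. F y (h y)) has_derivative
      (\<lambda>v. \<Sum>b\<in>Basis. (h x \<bullet> b) *\<^sub>R F' b v + (h' v \<bullet> b) *\<^sub>R F x b)) (at x)"
    by (rule has_derivative_transform_within_open[OF _ T]) (simp add: rep[symmetric])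
  moreover have "F' (h x) v + F x (h' v) = (\<Sum>b\<in>Basis. (h x \<bullet> b) *\<^sub>R F' b v + (h' v \<bullet> b) *\<^sub>R F x b)" for v
    by (subst F', subst rep[OF T(2)], simp add: sum.distrib)
  ultimately show ?thesis by simp
qed

lemma smooth_on_linear_family:
  fixes F :: "'a::real_normed_vector \<Rightarrow> 'b::euclidean_space \<Rightarrow> 'c::real_normed_vector"
  assumes T: "open T" and lin: "\<And>y. y \<in> T \<Longrightarrow> linear (F y)"
    and F: "\<And>\<xi>. smooth_on T (\<lambda>y. F y \<xi>)" and h: "smooth_on T h"
  shows "smooth_on T (\<lambda>y. F y (h y))"
proof -
  have "smooth_on T (\<lambda>y. \<Sum>b\<in>Basis. (h y \<bullet> b) *\<^sub>R F y b)"
    by (intro smooth_on_sum smooth_on_scaleR smooth_on_linear_comp[OF _ bounded_linear_inner_left] F h T)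
  then show ?thesis
    by (rule smooth_on_cong[OF T, rotated]) (simp add: linear_eq_sum_Basis[OF lin, symmetric])
qed

text \<open>Since \<open>q\<close> vanishes at \<open>w\<close>, it is O(|y - w|), and the factor f
  y - f w is o(1) by continuity alone. This is the product rule for a factor \<open>f\<close> whose
  differentiability is still to be proved.\<close>

lemma has_derivative_scaleR_vanishing:
  fixes q :: "'a::real_normed_vector \<Rightarrow> 'b::real_normed_vector" and f :: "'a \<Rightarrow> real"
  assumes f: "isCont f w" and q: "(q has_derivative q') (at w)" and q0: "q w = 0"
  shows "((\<lambda>y. f y *\<^sub>R q y) has_derivative (\<lambda>v. f w *\<^sub>R q' v)) (at w)"
proof -
  obtain K where K: "\<And>v. norm (q' v) \<le> norm v * K"
    using bounded_linear.bounded[OF has_derivative_bounded_linear[OF q]] by blast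
  have e: "((\<lambda>y. norm (q y - q w - q' (y - w)) / norm (y - w)) \<longlongrightarrow> 0) (at w)"
    using q by (simp add: has_derivative_iff_norm)
  have "((\<lambda>y. norm (f y - f w) * (1 + K)) \<longlongrightarrow> norm (f w - f w) * (1 + K)) (at w)"
    using f unfolding isCont_def by (intro tendsto_intros)
  then have u: "((\<lambda>y. norm (f y - f w) * (1 + K)) \<longlongrightarrow> 0) (at w)" by simp
  have "((\<lambda>y. norm ((f y - f w) *\<^sub>R q y) / norm (y - w)) \<longlongrightarrow> 0) (at w)"
  proof (rule tendsto_sandwich[OF _ _ tendsto_const u])
    show "\<forall>\<^sub>F y in at w. norm ((f y - f w) *\<^sub>R q y) / norm (y - w) \<le> norm (f y - f w) * (1 + K)"
      using order_tendstoD(2)[OF e zero_less_one] eventually_at_ball'[OF zero_less_one, of w UNIV]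
    proof eventually_elim
      case (elim y)
      then have y: "norm (y - w) > 0" "norm (q y - q' (y - w)) \<le> norm (y - w)" using q0 by (auto simp: field_simps)
      have "norm (q y) \<le> norm (q y - q' (y - w)) + norm (q' (y - w))"
        using norm_triangle_ineq[of "q y - q' (y - w)" "q' (y - w)"] by simp
      also have "\<dots> \<le> norm (y - w) * (1 + K)" using y K[of "y - w"] by (simp add: algebra_simps)
      finally have "norm (q y) / norm (y - w) \<le> 1 + K" using y by (simp add: field_simps)
      then have "norm (f y - f w) * (norm (q y) / norm (y - w)) \<le> norm (f y - f w) * (1 + K)"
        by (intro mult_left_mono) auto
      then show ?case by simp
    qed
  qed auto
  then have "((\<lambda>y. (f y - f w) *\<^sub>R q y) has_derivative (\<lambda>v. 0)) (at w)"
    using q0 by (simp add: has_derivative_iff_norm)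
  from has_derivative_add[OF this has_derivative_scaleR_right[OF q, of "f w"]]
  show ?thesis by (simp add: algebra_simps)
qed

text \<open>The solution of a differentiable family of linear equations is differentiable: first bound it
  by a Neumann-type estimate, then read off continuity and differentiability from the equation.\<close>

lemma linear_equation_solution_differentiable:
  fixes B :: "'a::real_normed_vector \<Rightarrow> 'b::euclidean_space \<Rightarrow> 'b"
  assumes T: "open T" "w \<in> T" and lin: "\<And>y. y \<in> T \<Longrightarrow> linear (B y)"
    and inj: "\<And>z. B w z = 0 \<Longrightarrow> z = 0"
    and B: "\<And>b. (\<lambda>y. B y b) differentiable (at w)" and k: "k differentiable (at w)"
    and sol: "\<And>y. y \<in> T \<Longrightarrow> B y (n y) = k y"
  shows "n differentiable (at w)"
proof -
  obtain G where G: "linear G" "\<And>z. G (B w z) = z"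
    using linear_injective_left_inverse[OF lin[OF T(2)]] inj linear_injective_0[OF lin[OF T(2)]]
    by (metis comp_apply id_apply)
  have Gb: "bounded_linear G" using G(1) linear_conv_bounded_linear by blast
  define h where "h y = G (k y)" for y
  define e where "e b y = G (B y b - B w b)" for b y
  have dh: "h differentiable (at w)"
    unfolding h_def using k bounded_linear.has_derivative[OF Gb] unfolding differentiable_def by blast
  have de: "e b differentiable (at w)" for b
  proof -
    obtain B' where "((\<lambda>y. B y b) has_derivative B') (at w)" using B unfolding differentiable_def by blast
    from bounded_linear.has_derivative[OF Gb has_derivative_diff[OF this has_derivative_const[of "B w b"]]]
    show ?thesis unfolding e_def[abs_def] by (rule differentiableI)
  qed
  have e0: "e b w = 0" for b using G(1) by (simp add: e_def linear_0)
  \<comment> \<open>Applying \<open>G\<close> to B y (n y) = k y and writing B y = B w + (B y - B w)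
    gives a fixed-point form of the equation; its coefficients \<open>e b\<close> vanish at
    \<open>w\<close>.\<close>
  have n: "n y = h y - (\<Sum>b\<in>Basis. (n y \<bullet> b) *\<^sub>R e b y)" if y: "y \<in> T" for y
  proof -
    have "(\<Sum>b\<in>Basis. (n y \<bullet> b) *\<^sub>R e b y) = G (\<Sum>b\<in>Basis. (n y \<bullet> b) *\<^sub>R (B y b - B w b))"
      using G(1) by (simp add: e_def linear_sum linear_scale)
    also have "(\<Sum>b\<in>Basis. (n y \<bullet> b) *\<^sub>R (B y b - B w b)) = B y (n y) - B w (n y)"
      using linear_eq_sum_Basis[OF lin[OF y], of "n y"] linear_eq_sum_Basis[OF lin[OF T(2)], of "n y"]
      by (simp add: scaleR_diff_right sum_subtractf)
    also have "G \<dots> = h y - n y" using G sol[OF y] by (simp add: h_def linear_diff)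
    finally show ?thesis by simp
  qed
  define M where "M y = (\<Sum>b\<in>Basis. norm (e b y))" for y
  have M: "isCont M w" "M w = 0"
    unfolding M_def using differentiable_imp_continuous_within[OF de] e0 by (auto intro!: continuous_intros)
  have bd: "norm (\<Sum>b\<in>Basis. (n y \<bullet> b) *\<^sub>R e b y) \<le> norm (n y) * M y" for y
    unfolding M_def sum_distrib_left
    by (rule order_trans[OF norm_sum]) (auto intro!: sum_mono mult_right_mono simp: Basis_le_norm)
  have ev: "\<forall>\<^sub>F y in at w. y \<in> T" using T by (rule eventually_at_in_open')
  have "(M \<longlongrightarrow> 0) (at w)" using M by (simp add: isCont_def)
  then have ev2: "\<forall>\<^sub>F y in at w. M y < 1/2" by (rule order_tendstoD) simp
  have h: "(h \<longlongrightarrow> h w) (at w)" using differentiable_imp_continuous_within[OF dh] by (simp add: continuous_within)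
  have "((\<lambda>y. norm (h y - h w) + 2 * norm (h y) * M y) \<longlongrightarrow> norm (h w - h w) + 2 * norm (h w) * 0) (at w)"
    by (intro tendsto_intros h \<open>(M \<longlongrightarrow> 0) (at w)\<close>)
  then have lim: "((\<lambda>y. norm (h y - h w) + 2 * norm (h y) * M y) \<longlongrightarrow> 0) (at w)" by simp
  have "((\<lambda>y. norm (n y - n w)) \<longlongrightarrow> 0) (at w)"
  proof (rule tendsto_sandwich[OF _ _ tendsto_const lim])
    show "\<forall>\<^sub>F y in at w. norm (n y - n w) \<le> norm (h y - h w) + 2 * norm (h y) * M y"
      using ev ev2
    proof eventually_elim
      case (elim y)
      let ?s = "\<Sum>b\<in>Basis. (n y \<bullet> b) *\<^sub>R e b y"
      have M0: "0 \<le> M y" by (simp add: M_def sum_nonneg)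
      \<comment> \<open>While \<open>M y\<close> is below 1/2, the perturbation is at most half of
        \<open>norm (n y)\<close> and can be absorbed into the left side.\<close>
      have "norm (n y) \<le> norm (h y) + norm ?s"
        by (subst n[OF elim(1)]) (rule norm_triangle_ineq4)
      moreover have "norm (n y) * M y \<le> norm (n y) * (1/2)"
        using elim by (intro mult_left_mono) auto
      ultimately have "norm (n y) \<le> 2 * norm (h y)" using bd[of y] by linarith
      then have "norm (n y) * M y \<le> 2 * norm (h y) * M y" using M0 by (rule mult_right_mono)
      then have s: "norm ?s \<le> 2 * norm (h y) * M y" using bd[of y] by linarith
      have "n w = h w" using n[OF T(2)] by (simp add: e0)
      then have "n y - n w = (h y - h w) - ?s" using n[OF elim(1)] by (simp add: algebra_simps)
      then have "norm (n y - n w) \<le> norm (h y - h w) + norm ?s" using norm_triangle_ineq4 by metis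
      then show ?case using s by linarith
    qed
  qed auto
  then have cn: "isCont n w" unfolding isCont_def by (simp add: LIM_zero_iff tendsto_norm_zero_iff)
  have "(\<lambda>y. h y - (\<Sum>b\<in>Basis. (n y \<bullet> b) *\<^sub>R e b y)) differentiable (at w)"
  proof (intro differentiable_diff dh differentiable_sum ballI)
    fix b :: 'b
    obtain e' where "(e b has_derivative e') (at w)" using de unfolding differentiable_def by blast
    from has_derivative_scaleR_vanishing[OF _ this e0, of "\<lambda>y. n y \<bullet> b"]
    show "(\<lambda>y. (n y \<bullet> b) *\<^sub>R e b y) differentiable (at w)"
      using cn by (auto intro: differentiableI continuous_intros)
  qed simp
  then show ?thesis
    using differentiable_cong_open[OF T, of n "\<lambda>y. h y - (\<Sum>b\<in>Basis. (n y \<bullet> b) *\<^sub>R e b y)"] n by blast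
qed

lemma has_derivative_line:
  fixes f :: "'a::real_normed_vector \<Rightarrow> real"
  assumes "(f has_derivative f') (at z)"
  shows "((\<lambda>t. f (z + t *\<^sub>R v)) has_real_derivative f' v) (at 0)"
proof -
  have "((\<lambda>t. f (z + t *\<^sub>R v)) has_derivative (\<lambda>t. f' (t *\<^sub>R v))) (at 0)"
    by (rule has_derivative_compose[of _ _ 0 UNIV f]) (use assms in \<open>auto intro!: derivative_eq_intros\<close>)
  then show ?thesis
    using linear_scale[OF has_derivative_linear[OF assms]]
    by (simp add: has_field_derivative_def mult.commute[of _ "f' v"])
qed

section \<open>Bianchi identities in coordinates\<close>

text \<open>The order of the arguments lets derivatives be iterated as operators on functions. A
  direction such as \<open>(0, snd w)\<close> inside an iterated derivative is frozen at
  \<open>w\<close> and is not differentiated; moving directions are handled by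
  \<open>dird_family\<close>.\<close>

definition dird :: "'a::real_normed_vector \<Rightarrow> ('a \<Rightarrow> 'b::real_normed_vector) \<Rightarrow> 'a \<Rightarrow> 'b" where
  "dird v f = (\<lambda>w. frechet_derivative f (at w) v)"

lemma dird_eq: "(f has_derivative D) (at w) \<Longrightarrow> dird v f w = D v"
  by (simp add: dird_def has_derivative_imp_frechet)

lemma dird_has_derivative: "smooth_on W f \<Longrightarrow> w \<in> W \<Longrightarrow> (f has_derivative (\<lambda>v. dird v f w)) (at w)"
  using smooth_on_has_derivative unfolding dird_def by blast

lemma smooth_on_dird: "smooth_on W f \<Longrightarrow> smooth_on W (dird v f)"
  unfolding dird_def by (rule smooth_on_frechet)

lemma dird_linear: "smooth_on W f \<Longrightarrow> w \<in> W \<Longrightarrow> linear (\<lambda>v. dird v f w)"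
  using dird_has_derivative has_derivative_linear by blast

lemma dird_cong: "open W \<Longrightarrow> w \<in> W \<Longrightarrow> (\<And>y. y \<in> W \<Longrightarrow> f y = g y) \<Longrightarrow> dird v f w = dird v g w"
  unfolding dird_def using frechet_derivative_cong_open by metis

lemma dird_sym:
  fixes f :: "'a::real_normed_vector \<Rightarrow> 'b::euclidean_space"
  shows "open W \<Longrightarrow> smooth_on W f \<Longrightarrow> w \<in> W \<Longrightarrow> dird u (dird v f) w = dird v (dird u f) w"
  unfolding dird_def using second_derivative_symmetric by blast

lemma dird_family:
  fixes f :: "'a::euclidean_space \<Rightarrow> 'b::real_normed_vector"
  assumes "open W" "smooth_on W f" "w \<in> W" "(h has_derivative h') (at w)"
  shows "((\<lambda>y. dird (h y) f y) has_derivative (\<lambda>v. dird v (dird (h w) f) w + dird (h' v) f w)) (at w)"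
  using has_derivative_linear_family[OF assms(1,3), of "\<lambda>y v. dird v f y" "\<lambda>u v. dird v (dird u f) w" h h']
    dird_linear[OF assms(2)] dird_has_derivative[OF smooth_on_dird[OF assms(2)] assms(3)] assms(4) by blast

text \<open>Differentiating Euler's relation along \<open>v\<close> hits both \<open>f\<close> and
  the Euler field, and the order of the two derivatives of \<open>f\<close> can be exchanged. Along
  vertical \<open>v\<close> the degree of homogeneity drops by one, along horizontal coordinate
  directions it is kept.\<close>

lemma euler_derivative:
  fixes f :: "'a::euclidean_space \<times> 'a \<Rightarrow> 'b::euclidean_space"
  assumes "open W" "smooth_on W f" "w \<in> W" "\<And>w. w \<in> W \<Longrightarrow> dird (0, snd w) f w = k *\<^sub>R f w"
  shows "dird (0, snd w) (dird v f) w = k *\<^sub>R dird v f w - dird (0, snd v) f w"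
proof -
  have "((\<lambda>y. dird (0, snd y) f y) has_derivative
      (\<lambda>v. dird v (dird (0, snd w) f) w + dird (0, snd v) f w)) (at w)"
    by (rule dird_family[OF assms(1-3)]) (auto intro!: derivative_eq_intros)
  then have "dird v (\<lambda>y. dird (0, snd y) f y) w = dird v (dird (0, snd w) f) w + dird (0, snd v) f w"
    by (rule dird_eq)
  moreover have "dird v (\<lambda>y. dird (0, snd y) f y) w = dird v (\<lambda>y. k *\<^sub>R f y) w"
    using assms(4) by (intro dird_cong[OF assms(1,3)])
  moreover have "dird v (\<lambda>y. k *\<^sub>R f y) w = k *\<^sub>R dird v f w"
    by (rule dird_eq) (intro has_derivative_scaleR_right dird_has_derivative[OF assms(2,3)])
  ultimately show ?thesis using dird_sym[OF assms(1-3), of v "(0, snd w)"] by (simp add: algebra_simps)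
qed

section \<open>Linear algebra in dimension at least three\<close>

lemma orthogonal_vector_exists:
  fixes a b :: "'e::euclidean_space"
  assumes "DIM('e) \<ge> 3"
  obtains c where "c \<noteq> 0" "c \<bullet> a = 0" "c \<bullet> b = 0"
proof -
  have "dim {a, b} < DIM('e)"
    using dim_le_card'[of "{a,b}"] card_insert_le_m1[of 2 "{b}" a] assms by auto
  then obtain c where "c \<noteq> 0" "\<And>y. y \<in> span {a, b} \<Longrightarrow> orthogonal c y"
    using orthogonal_to_subspace_exists by metis
  then show ?thesis using that[of c] by (auto simp: orthogonal_def span_base)
qed

text \<open>Pairing the identity with a third vector \<open>c\<close> orthogonal to \<open>a\<close>
  and \<open>b\<close> removes every term except those that are multiples of \<open>c\<close>, and
  their coefficient is the claimed difference.\<close>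

lemma cyclic_identity_imp_proportional:
  fixes \<alpha> \<theta> :: "'e::euclidean_space \<Rightarrow> real"
  assumes "DIM('e) \<ge> 3"
    and "\<And>a b c. \<alpha> c *\<^sub>R (\<theta> a *\<^sub>R b - \<theta> b *\<^sub>R a) + \<alpha> a *\<^sub>R (\<theta> b *\<^sub>R c - \<theta> c *\<^sub>R b)
       + \<alpha> b *\<^sub>R (\<theta> c *\<^sub>R a - \<theta> a *\<^sub>R c) = 0"
  shows "\<alpha> a * \<theta> b = \<alpha> b * \<theta> a"
proof -
  obtain c where c: "c \<noteq> 0" "c \<bullet> a = 0" "c \<bullet> b = 0"
    using orthogonal_vector_exists[OF assms(1)] .
  have "c \<bullet> (\<alpha> c *\<^sub>R (\<theta> a *\<^sub>R b - \<theta> b *\<^sub>R a) + \<alpha> a *\<^sub>R (\<theta> b *\<^sub>R c - \<theta> c *\<^sub>R b)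
       + \<alpha> b *\<^sub>R (\<theta> c *\<^sub>R a - \<theta> a *\<^sub>R c)) = 0"
    by (simp only: assms(2) inner_zero_right)
  then have "(\<alpha> a * \<theta> b - \<alpha> b * \<theta> a) * (c \<bullet> c) = 0"
    using c by (simp add: inner_add_right inner_diff_right algebra_simps)
  then show ?thesis using c by simp
qed

text \<open>The energy \<open>En\<close> stands for \<open>L\<^sup>2/2\<close> in the coordinates \<open>(x, y)\<close>.\<close>

locale local_energy =
  fixes U :: "'e::euclidean_space set" and En :: "'e \<times> 'e \<Rightarrow> real"
  assumes open_U: "open U"
    and En_smooth: "smooth_on (U \<times> (- {0})) En"
    and En_hom: "\<And>x y t. x \<in> U \<Longrightarrow> y \<noteq> 0 \<Longrightarrow> t > 0 \<Longrightarrow> En (x, t *\<^sub>R y) = t\<^sup>2 * En (x, y)"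
    and g_pos: "\<And>w v. w \<in> U \<times> (- {0}) \<Longrightarrow> v \<noteq> 0 \<Longrightarrow> 0 < dird (0, v) (dird (0, v) En) w"
begin

definition "W = U \<times> (- {0::'e})"
text \<open>By Euler's relation (\<open>euler_\<theta>\<close>) this is g(y, c) with y the
  supporting element, that is, L times the form \<ell>.\<close>

definition "\<theta> c = dird (0, c) En"
definition "g a c = dird (0, a) (\<theta> c)"

lemma open_W: "open W"
  unfolding W_def using open_U by (intro open_Times) auto

lemma smooth_\<theta>: "smooth_on W (\<theta> c)"
  unfolding \<theta>_def W_def by (intro smooth_on_dird En_smooth)

lemma smooth_g: "smooth_on W (g a c)"
  unfolding g_def by (intro smooth_on_dird smooth_\<theta>)

lemmas lin\<theta> = dird_linear[OF smooth_\<theta>]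

lemma g_sym: "w \<in> W \<Longrightarrow> g a c w = g c a w"
  unfolding g_def \<theta>_def using dird_sym[OF open_W] En_smooth unfolding W_def by blast

lemma euler_En: "w \<in> W \<Longrightarrow> dird (0, snd w) En w = 2 *\<^sub>R En w"
proof -
  assume w: "w \<in> W"
  obtain x y where xy: "w = (x, y)" "x \<in> U" "y \<noteq> 0" using w unfolding W_def by auto
  have "(En has_derivative (\<lambda>v. dird v En w)) (at (x, 1 *\<^sub>R y))"
    using dird_has_derivative[OF En_smooth, of w] w xy unfolding W_def by simp
  then have 1: "((\<lambda>t. En (x, t *\<^sub>R y)) has_derivative (\<lambda>c. dird (0, c *\<^sub>R y) En w)) (at 1)"
    by (rule has_derivative_compose[rotated]) (auto intro!: derivative_eq_intros)
  have "((\<lambda>t::real. t\<^sup>2 * En (x, y)) has_derivative (\<lambda>c. 2 * c * En (x, y))) (at 1)"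
    by (auto intro!: derivative_eq_intros)
  then have "((\<lambda>t. En (x, t *\<^sub>R y)) has_derivative (\<lambda>c. 2 * c * En (x, y))) (at 1)"
    by (rule has_derivative_transform_within_open[OF _ open_greaterThan[of 0]]) (use En_hom xy in auto)
  from has_derivative_unique[OF 1 this] have "dird (0, 1 *\<^sub>R y) En w = 2 * 1 * En (x, y)"
    by (rule fun_cong)
  then show ?thesis using xy by simp
qed

lemma euler_\<theta>: "w \<in> W \<Longrightarrow> dird (0, snd w) (\<theta> c) w = \<theta> c w"
  using euler_derivative[OF open_W _ _ euler_En, of w "(0, c)"] En_smooth
  by (simp add: \<theta>_def W_def)

lemma euler_dEn: "w \<in> W \<Longrightarrow> dird (0, snd w) (dird (a, 0) En) w = 2 * dird (a, 0) En w"
  using euler_derivative[OF open_W _ _ euler_En, of w "(a, 0)"] En_smooth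
    linear_0[OF dird_linear[OF En_smooth], of w]
  by (simp add: W_def zero_prod_def)

lemma euler_d\<theta>: "w \<in> W \<Longrightarrow> dird (0, snd w) (dird v (\<theta> c)) w = dird v (\<theta> c) w - dird (0, snd v) (\<theta> c) w"
  using euler_derivative[OF open_W smooth_\<theta>, of w c 1 v] euler_\<theta> by simp

lemma dird_horizontal_\<theta>:
  assumes "w \<in> W" shows "dird (a, 0) (\<theta> c) w = dird (a, z) (\<theta> c) w - dird (0, z) (\<theta> c) w"
  using linear_diff[OF lin\<theta>[OF assms], of "(a, z)" "(0, z)" c] by simp

text \<open>Exchanging derivatives reduces this to Euler's relation for a derivative of \<theta>.
  The vertical direction \<open>z\<close> drops out: the Cartan tensor, which is the vertical
  derivative of g up to a factor, vanishes on the supporting element.\<close>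

lemma dird_g_supporting:
  assumes w: "w \<in> W" shows "dird (a, z) (g (snd w) c) w = dird (a, 0) (\<theta> c) w"
  using dird_sym[OF open_W smooth_\<theta> w, of "(a, z)" "(0, snd w)" c] euler_d\<theta>[OF w, of "(a, z)" c]
    dird_horizontal_\<theta>[OF w, of a c z] unfolding g_def by simp

lemma dird_g_supporting_vertical:
  assumes w: "w \<in> W" shows "dird (0, z) (g (snd w) c) w = 0"
  using dird_g_supporting[OF w, of 0 z c] linear_0[OF lin\<theta>[OF w]] by (simp add: zero_prod_def)

lemma g_nondegenerate:
  assumes w: "w \<in> W" and "\<And>c. dird (0, z) (\<theta> c) w = dird (0, z') (\<theta> c) w"
  shows "z = z'"
proof (rule ccontr)
  assume "z \<noteq> z'"
  then have "0 < dird (0, z - z') (\<theta> (z - z')) w"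
    using g_pos[of w "z - z'"] w unfolding W_def \<theta>_def by simp
  moreover have "dird (0, z - z') (\<theta> (z - z')) w = 0"
    using linear_diff[OF lin\<theta>[OF w], of "(0, z)" "(0, z')"] assms(2) by simp
  ultimately show False by simp
qed

lemma \<theta>_supporting_pos: "w \<in> W \<Longrightarrow> \<theta> (snd w) w > 0"
proof -
  assume w: "w \<in> W"
  then have "0 < dird (0, snd w) (dird (0, snd w) En) w" by (intro g_pos) (auto simp: W_def)
  then show ?thesis using euler_\<theta>[OF w, of "snd w"] by (simp add: \<theta>_def)
qed

end

text \<open>\<open>N\<close> is the nonlinear connection, the horizontal lift of \<open>a\<close> at \<open>w\<close> being \<open>(a, - N w a)\<close>. The last
  axiom is the Christoffel formula for the Cartan connection, contracted once with the supporting
  element \<open>snd w\<close>.\<close>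

locale local_finsler = local_energy U En for U :: "'e::euclidean_space set" and En :: "'e \<times> 'e \<Rightarrow> real" +
  fixes N :: "'e \<times> 'e \<Rightarrow> 'e \<Rightarrow> 'e"
  assumes N_linear: "\<And>w. w \<in> U \<times> (- {0}) \<Longrightarrow> linear (N w)"
    and N_smooth: "\<And>a. smooth_on (U \<times> (- {0})) (\<lambda>w. N w a)"
    and christoffel: "\<And>w a c. w \<in> U \<times> (- {0}) \<Longrightarrow>
       dird (a, - N w a) (dird (0, snd w) (dird (0, c) En)) w
       + dird (snd w, - N w (snd w)) (dird (0, a) (dird (0, c) En)) w
       - dird (c, - N w c) (dird (0, a) (dird (0, snd w) En)) w
       = 2 * dird (0, N w a) (dird (0, c) En) w"
begin

definition "Nn a = (\<lambda>w. N w a)"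
definition "hor a w = (a, - N w a)"

lemma smooth_Nn: "smooth_on W (Nn a)"
  unfolding Nn_def W_def by (rule N_smooth)

lemmas linN = dird_linear[OF smooth_Nn]

lemma christoffel':
  assumes w: "w \<in> W"
  shows "dird (a, 0) (\<theta> c) w + dird (snd w, - N w (snd w)) (g a c) w - dird (c, 0) (\<theta> a) w
       = 2 * g (N w a) c w"
proof -
  have "dird (a, - N w a) (g (snd w) c) w + dird (snd w, - N w (snd w)) (g a c) w
      - dird (c, - N w c) (g a (snd w)) w = 2 * g (N w a) c w"
    using christoffel[of w a c] w unfolding g_def \<theta>_def W_def by simp
  moreover have "dird (c, - N w c) (g a (snd w)) w = dird (c, - N w c) (g (snd w) a) w"
    by (rule dird_cong[OF open_W w]) (rule g_sym)
  ultimately show ?thesis using dird_g_supporting[OF w] by simp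
qed

text \<open>The spray coefficients, classically written 2G.\<close>

definition "S w = N w (snd w)"

lemma smooth_S: "smooth_on W S"
  unfolding S_def by (rule smooth_on_linear_family[OF open_W])
   (use N_linear N_smooth in \<open>auto simp: W_def intro: smooth_on_bounded_linear bounded_linear_snd\<close>)

text \<open>The Christoffel formula with the supporting element in place of \<open>a\<close>:
  homogeneity collapses it to the Euler-Lagrange equation of the energy.\<close>

lemma spray_equation:
  assumes w: "w \<in> W"
  shows "dird (0, S w) (\<theta> c) w = dird (snd w, 0) (\<theta> c) w - dird (c, 0) En w"
proof -
  have "dird (c, 0) (\<theta> (snd w)) w = 2 * dird (c, 0) En w"
    using dird_sym[OF open_W _ w, of En "(c, 0)" "(0, snd w)"] En_smooth euler_dEn[OF w]
    unfolding \<theta>_def W_def by simp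
  then show ?thesis using christoffel'[OF w, of "snd w" c] dird_g_supporting[OF w]
    unfolding g_def S_def by simp
qed

text \<open>The vertical derivative of the spray equation along \<open>a\<close> has the same right
  side as the Christoffel formula for \<open>a\<close>. Hence both sides have the same g-product
  with every \<open>c\<close>, and g is nondegenerate.\<close>

lemma dird_S:
  assumes w: "w \<in> W" shows "dird (0, a) S w = 2 *\<^sub>R N w a"
proof (rule g_nondegenerate[OF w])
  fix c
  have "((\<lambda>y. dird (0, S y) (\<theta> c) y) has_derivative
      (\<lambda>v. dird v (dird (0, S w) (\<theta> c)) w + dird (0, dird v S w) (\<theta> c) w)) (at w)"
    by (rule dird_family[OF open_W smooth_\<theta> w])
      (intro has_derivative_Pair has_derivative_const dird_has_derivative[OF smooth_S w])
  then have 1: "dird (0, a) (\<lambda>y. dird (0, S y) (\<theta> c) y) w =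
      dird (0, a) (dird (0, S w) (\<theta> c)) w + dird (0, dird (0, a) S w) (\<theta> c) w"
    by (rule dird_eq)
  have "((\<lambda>y. dird (snd y, 0) (\<theta> c) y) has_derivative
      (\<lambda>v. dird v (dird (snd w, 0) (\<theta> c)) w + dird (snd v, 0) (\<theta> c) w)) (at w)"
    by (rule dird_family[OF open_W smooth_\<theta> w]) (auto intro!: derivative_eq_intros)
  moreover have "(dird (c, 0) En has_derivative (\<lambda>v. dird v (dird (c, 0) En) w)) (at w)"
    using w En_smooth unfolding W_def by (intro dird_has_derivative smooth_on_dird)
  ultimately have "((\<lambda>y. dird (snd y, 0) (\<theta> c) y - dird (c, 0) En y) has_derivative
     (\<lambda>v. dird v (dird (snd w, 0) (\<theta> c)) w + dird (snd v, 0) (\<theta> c) w - dird v (dird (c, 0) En) w)) (at w)"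
    by (rule has_derivative_diff)
  then have 2: "dird (0, a) (\<lambda>y. dird (snd y, 0) (\<theta> c) y - dird (c, 0) En y) w =
     dird (0, a) (dird (snd w, 0) (\<theta> c)) w + dird (a, 0) (\<theta> c) w - dird (0, a) (dird (c, 0) En) w"
    using dird_eq[of _ _ _ "(0, a)"] by fastforce
  have 3: "dird (0, a) (\<lambda>y. dird (0, S y) (\<theta> c) y) w =
      dird (0, a) (\<lambda>y. dird (snd y, 0) (\<theta> c) y - dird (c, 0) En y) w"
    by (rule dird_cong[OF open_W w]) (rule spray_equation)
  have 4: "dird (0, a) (dird v (\<theta> c)) w = dird v (g a c) w" for v
    unfolding g_def by (rule dird_sym[OF open_W smooth_\<theta> w])
  have 5: "dird (0, a) (dird (c, 0) En) w = dird (c, 0) (\<theta> a) w"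
    unfolding \<theta>_def using dird_sym[OF open_W _ w] En_smooth unfolding W_def by blast
  have 6: "dird (snd w, - S w) (g a c) w = dird (snd w, 0) (g a c) w - dird (0, S w) (g a c) w"
    using linear_diff[OF dird_linear[OF smooth_g w], of "(snd w, 0)" "(0, S w)"] by simp
  have 7: "dird (0, 2 *\<^sub>R N w a) (\<theta> c) w = 2 * g (N w a) c w"
    using linear_scale[OF lin\<theta>[OF w], of 2 "(0, N w a)"] by (simp add: g_def)
  show "dird (0, dird (0, a) S w) (\<theta> c) w = dird (0, 2 *\<^sub>R N w a) (\<theta> c) w"
    using 1 2 3 4[of "(0, S w)"] 4[of "(snd w, 0)"] 5 6 7 christoffel'[OF w, of a c] unfolding S_def by linarith
qed

text \<open>Since \<open>N\<close> is half the vertical derivative of \<open>S\<close>, this is the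
  symmetry of the second vertical derivatives of \<open>S\<close>.\<close>

lemma dird_Nn_sym:
  assumes w: "w \<in> W" shows "dird (0, c) (Nn a) w = dird (0, a) (Nn c) w"
proof -
  have 1: "dird (0, c) (dird (0, a) S) w = 2 *\<^sub>R dird (0, c) (Nn a) w" for a c
  proof -
    have "dird (0, c) (dird (0, a) S) w = dird (0, c) (\<lambda>y. 2 *\<^sub>R Nn a y) w"
      by (rule dird_cong[OF open_W w]) (simp add: dird_S Nn_def)
    also have "\<dots> = 2 *\<^sub>R dird (0, c) (Nn a) w"
      by (rule dird_eq) (intro has_derivative_scaleR_right dird_has_derivative[OF smooth_Nn w])
    finally show ?thesis .
  qed
  show ?thesis using dird_sym[OF open_W smooth_S w, of "(0, c)" "(0, a)"] unfolding 1 by simp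
qed

text \<open>Homogeneity of \<open>N\<close> is not among the axioms. The product rule for
  \<open>S w = N w (snd w)\<close> gives 2 N a as N a plus the derivative of N(y) along
  \<open>a\<close>; by \<open>dird_Nn_sym\<close> the latter is the derivative of N(a) along
  y.\<close>

lemma euler_Nn:
  assumes w: "w \<in> W" shows "dird (0, snd w) (Nn a) w = Nn a w"
proof -
  have "((\<lambda>y. N y (snd y)) has_derivative (\<lambda>v. dird v (Nn (snd w)) w + N w (snd v))) (at w)"
    by (rule has_derivative_linear_family[OF open_W w])
     (use N_linear dird_has_derivative[OF smooth_Nn w] in \<open>auto simp: W_def Nn_def intro!: derivative_eq_intros\<close>)
  then have "dird (0, a) S w = dird (0, a) (Nn (snd w)) w + N w a"
    unfolding S_def[abs_def] using dird_eq[of _ _ _ "(0, a)"] by fastforce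
  then show ?thesis using dird_Nn_sym[OF w, of "snd w" a] unfolding dird_S[OF w]
    by (simp add: scaleR_2 Nn_def)
qed

text \<open>The vertical component of the Lie bracket of the horizontal fields \<open>hor a\<close>
  and \<open>hor b\<close>; their bracket has no other component.\<close>

definition "Rc a b w = dird (hor b w) (Nn a) w - dird (hor a w) (Nn b) w"

lemma hor_has_derivative:
  assumes w: "w \<in> W"
  shows "(hor a has_derivative (\<lambda>v. (0, - dird v (Nn a) w))) (at w)"
proof -
  have "((\<lambda>w. (a, - Nn a w)) has_derivative (\<lambda>v. (0, - dird v (Nn a) w))) (at w)"
    by (intro has_derivative_Pair has_derivative_const has_derivative_minus dird_has_derivative[OF smooth_Nn w])
  then show ?thesis by (simp add: hor_def[abs_def] Nn_def)
qed

lemma Rc_has_derivative: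
  assumes w: "w \<in> W"
  shows "(Rc a b has_derivative (\<lambda>v.
     dird v (dird (hor b w) (Nn a)) w - dird (0, dird v (Nn b) w) (Nn a) w -
     (dird v (dird (hor a w) (Nn b)) w - dird (0, dird v (Nn a) w) (Nn b) w))) (at w)"
proof -
  have 1: "((\<lambda>y. dird (hor b y) (Nn a) y) has_derivative (\<lambda>v.
     dird v (dird (hor b w) (Nn a)) w - dird (0, dird v (Nn b) w) (Nn a) w)) (at w)" for a b
    using dird_family[OF open_W smooth_Nn w hor_has_derivative[OF w], of b a]
      linear_neg[OF linN[OF w], of "(0, z)" for z] by simp
  show ?thesis unfolding Rc_def[abs_def] by (intro has_derivative_diff 1)
qed

text \<open>The derivative of \<open>Rc\<close> consists of second derivatives of \<open>N\<close>
  and of products of two vertical derivatives of \<open>N\<close>. Both kinds inherit the symmetry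
  \<open>dird_Nn_sym\<close>, so the antisymmetric combinations cancel in the cyclic sum.\<close>

lemma bianchi_vertical:
  assumes w: "w \<in> W"
  shows "dird (0, c) (Rc a b) w + dird (0, a) (Rc b c) w + dird (0, b) (Rc c a) w = 0"
proof -
  define q where "q b a c = dird (hor b w) (dird (0, c) (Nn a)) w" for a b c
  have q: "dird (0, c) (dird (hor b w) (Nn a)) w = q b a c" for a b c
    unfolding q_def by (rule dird_sym[OF open_W smooth_Nn w])
  have qs: "q b a c = q b c a" for a b c
    unfolding q_def by (rule dird_cong[OF open_W w]) (rule dird_Nn_sym)
  define B where "B a c = dird (0, c) (Nn a) w" for a c
  have Bs: "B a c = B c a" for a c unfolding B_def by (rule dird_Nn_sym[OF w])
  have d: "dird (0, c) (Rc a b) w = q b a c - B a (B b c) - (q a b c - B b (B a c))" for a b c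
    unfolding dird_eq[OF Rc_has_derivative[OF w]] q B_def ..
  show ?thesis
    unfolding d by (simp add: qs[of _ c] qs[of _ b a] Bs[of c] Bs[of b a])
qed

text \<open>The Jacobi identity for \<open>hor a\<close>, \<open>hor b\<close>,
  \<open>hor c\<close>, written out. The second derivatives along frozen horizontal directions
  commute; the derivatives of the directions themselves cancel against the terms in which
  \<open>Rc\<close> is the direction.\<close>

lemma bianchi_horizontal:
  assumes w: "w \<in> W"
  shows "dird (hor c w) (Rc a b) w + dird (0, Rc a b w) (Nn c) w
     + (dird (hor a w) (Rc b c) w + dird (0, Rc b c w) (Nn a) w)
     + (dird (hor b w) (Rc c a) w + dird (0, Rc c a w) (Nn b) w) = 0"
proof -
  define q where "q a b c = dird (hor c w) (dird (hor b w) (Nn a)) w" for a b c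
  have qs: "q a b c = q a c b" for a b c
    unfolding q_def by (rule dird_sym[OF open_W smooth_Nn w])
  define B where "B a z = dird (0, z) (Nn a) w" for a z
  have Bd: "B a (z - z') = B a z - B a z'" for a z z'
    using linear_diff[OF linN[OF w], of "(0, z)" "(0, z')" a] by (simp add: B_def)
  define \<delta> where "\<delta> c b = dird (hor c w) (Nn b) w" for b c
  have d: "dird (hor c w) (Rc a b) w = q a b c - B a (\<delta> c b) - (q b a c - B b (\<delta> c a))" for a b c
    unfolding dird_eq[OF Rc_has_derivative[OF w]] q_def B_def \<delta>_def ..
  have R: "dird (0, Rc a b w) (Nn c) w = B c (\<delta> b a) - B c (\<delta> a b)" for a b c
    unfolding Bd[symmetric] by (simp add: B_def Rc_def \<delta>_def)
  show ?thesis unfolding d R by (simp add: qs[of _ c] qs[of _ b a])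
qed

lemma euler_Rc:
  assumes w: "w \<in> W" shows "dird (0, snd w) (Rc a b) w = Rc a b w"
proof -
  have 1: "dird (0, snd w) (dird (hor b w) (Nn a)) w = dird (hor b w) (Nn a) w + dird (0, N w b) (Nn a) w" for a b
    using euler_derivative[OF open_W smooth_Nn w, of a 1 "hor b w"] euler_Nn
      linear_neg[OF linN[OF w], of "(0, N w b)"] by (simp add: hor_def)
  show ?thesis
    unfolding dird_eq[OF Rc_has_derivative[OF w]] 1 euler_Nn[OF w] by (simp add: Nn_def Rc_def)
qed

text \<open>Eliminating \<open>g (N w a) c\<close> by the Christoffel formula leaves half of
  \<open>dird (a, 0) (\<theta> c) w + dird (c, 0) (\<theta> a) w\<close> minus the derivative of
  \<open>g a c\<close> along the spray direction, which is symmetric in \<open>a\<close> and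
  \<open>c\<close>.\<close>

lemma dird_hor_\<theta>_sym:
  assumes w: "w \<in> W" shows "dird (hor a w) (\<theta> c) w = dird (hor c w) (\<theta> a) w"
proof -
  have 1: "dird (hor a w) (\<theta> c) w = dird (a, 0) (\<theta> c) w - g (N w a) c w" for a c
    using linear_diff[OF lin\<theta>[OF w], of "(a, 0)" "(0, N w a)"] by (simp add: hor_def g_def)
  have sym: "dird v (g a c) w = dird v (g c a) w" for v
    by (rule dird_cong[OF open_W w]) (rule g_sym)
  show ?thesis unfolding 1
    using christoffel'[OF w, of a c] christoffel'[OF w, of c a] sym[of "(snd w, - N w (snd w))"] by linarith
qed

section \<open>Isotropic curvature and the constancy of its factor\<close>

context
  fixes lam :: "'e \<times> 'e \<Rightarrow> real"
  assumes dim: "DIM('e) \<ge> 3"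
    and isotropic: "\<And>a b w. w \<in> W \<Longrightarrow> Rc a b w = lam w *\<^sub>R (\<theta> a w *\<^sub>R b - \<theta> b w *\<^sub>R a)"
begin

text \<open>Nothing is assumed about \<open>lam\<close> as a function, but pairing the isotropy
  equation with a vector \<open>b\<close> orthogonal to \<open>a\<close> solves it for
  \<open>lam\<close> as a quotient of differentiable functions.\<close>

lemma lam_differentiable:
  assumes w: "w \<in> W" shows "lam differentiable (at w)"
proof -
  obtain b where b: "b \<noteq> 0" "b \<bullet> snd w = 0" using orthogonal_vector_exists[OF dim, of "snd w" 0] by blast
  define a where "a = snd w"
  \<comment> \<open>The vector \<open>a\<close> stays fixed while the point moves, so \<theta>(a) is
    positive only near \<open>w\<close>; this set keeps the denominator away from zero.\<close>
  define T where "T = W \<inter> \<theta> a -` {0<..}"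
  have T: "open T" "w \<in> T"
    unfolding T_def using continuous_open_preimage[OF smooth_on_continuous[OF smooth_\<theta>] open_W]
      \<theta>_supporting_pos[OF w] w by (auto simp: a_def)
  have "(\<lambda>y. (Rc a b y \<bullet> b) / (\<theta> a y * (b \<bullet> b))) differentiable (at w)"
    using b T(2) unfolding T_def
    by (intro differentiable_divide differentiable_mult differentiable_inner differentiable_const
      differentiableI[OF Rc_has_derivative[OF w]] differentiableI[OF dird_has_derivative[OF smooth_\<theta> w]]) auto
  moreover have "(Rc a b y \<bullet> b) / (\<theta> a y * (b \<bullet> b)) = lam y" if "y \<in> T" for y
  proof -
    have y: "y \<in> W" "\<theta> a y > 0" using that by (auto simp: T_def)
    have "a \<bullet> b = 0" using b by (simp add: a_def inner_commute)
    then show ?thesis using b y by (simp add: isotropic inner_diff_left)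
  qed
  ultimately show ?thesis
    using differentiable_cong_open[OF T, of "\<lambda>y. (Rc a b y \<bullet> b) / (\<theta> a y * (b \<bullet> b))" lam] by blast
qed

lemma dird_isotropic:
  assumes w: "w \<in> W"
  shows "dird v (Rc a b) w = dird v lam w *\<^sub>R (\<theta> a w *\<^sub>R b - \<theta> b w *\<^sub>R a)
    + lam w *\<^sub>R (dird v (\<theta> a) w *\<^sub>R b - dird v (\<theta> b) w *\<^sub>R a)"
proof -
  have l: "(lam has_derivative (\<lambda>v. dird v lam w)) (at w)"
    using lam_differentiable[OF w] unfolding dird_def by (rule frechet_derivative_worksI)
  have "((\<lambda>y. lam y *\<^sub>R (\<theta> a y *\<^sub>R b - \<theta> b y *\<^sub>R a)) has_derivative
     (\<lambda>v. lam w *\<^sub>R (dird v (\<theta> a) w *\<^sub>R b - dird v (\<theta> b) w *\<^sub>R a)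
       + dird v lam w *\<^sub>R (\<theta> a w *\<^sub>R b - \<theta> b w *\<^sub>R a))) (at w)"
    by (intro has_derivative_scaleR has_derivative_diff has_derivative_scaleR_left l
      dird_has_derivative[OF smooth_\<theta> w])
  from dird_eq[OF this] have "dird v (\<lambda>y. lam y *\<^sub>R (\<theta> a y *\<^sub>R b - \<theta> b y *\<^sub>R a)) w =
     lam w *\<^sub>R (dird v (\<theta> a) w *\<^sub>R b - dird v (\<theta> b) w *\<^sub>R a)
       + dird v lam w *\<^sub>R (\<theta> a w *\<^sub>R b - \<theta> b w *\<^sub>R a)" .
  moreover have "dird v (\<lambda>y. lam y *\<^sub>R (\<theta> a y *\<^sub>R b - \<theta> b y *\<^sub>R a)) w = dird v (Rc a b) w"
    by (rule dird_cong[OF open_W w]) (simp add: isotropic)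
  ultimately show ?thesis by (simp add: add.commute)
qed

lemma lam_linear: "w \<in> W \<Longrightarrow> linear (\<lambda>v. dird v lam w)"
  using lam_differentiable[THEN frechet_derivative_worksI] has_derivative_linear unfolding dird_def by blast

text \<open>In the vertical Bianchi identity the derivatives of \<theta> are values of the symmetric
  g and cancel; the cyclic sum in the derivative of \<open>lam\<close> remains.\<close>

lemma lam_vertical_proportional:
  assumes w: "w \<in> W" shows "dird (0, a) lam w * \<theta> b w = dird (0, b) lam w * \<theta> a w"
proof (rule cyclic_identity_imp_proportional[OF dim, where \<alpha> = "\<lambda>a. dird (0, a) lam w" and \<theta> = "\<lambda>a. \<theta> a w"])
  fix a b c
  have gs: "dird (0, a) (\<theta> b) w = dird (0, b) (\<theta> a) w" for a b
    using g_sym[OF w] unfolding g_def .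
  show "dird (0, c) lam w *\<^sub>R (\<theta> a w *\<^sub>R b - \<theta> b w *\<^sub>R a) + dird (0, a) lam w *\<^sub>R (\<theta> b w *\<^sub>R c - \<theta> c w *\<^sub>R b)
       + dird (0, b) lam w *\<^sub>R (\<theta> c w *\<^sub>R a - \<theta> a w *\<^sub>R c) = 0"
    using bianchi_vertical[OF w, of c a b] unfolding dird_isotropic[OF w]
    by (simp add: gs[of c] gs[of b a] algebra_simps)
qed

text \<open>Both \<open>Rc\<close> and \<theta> have degree 1, so \<open>lam\<close> has degree 0
  and its derivative along the supporting element y vanishes. As \<theta>(y) is positive,
  proportionality to \<theta> carries this to all vertical directions.\<close>

lemma lam_vertical:
  assumes w: "w \<in> W" shows "dird (0, a) lam w = 0"
proof -
  let ?y = "snd w"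
  obtain b where b: "b \<noteq> 0" "b \<bullet> ?y = 0" using orthogonal_vector_exists[OF dim, of ?y 0] by blast
  have "dird (0, ?y) lam w *\<^sub>R (\<theta> ?y w *\<^sub>R b - \<theta> b w *\<^sub>R ?y) = 0"
    using euler_Rc[OF w, of ?y b] unfolding dird_isotropic[OF w] euler_\<theta>[OF w] isotropic[OF w] by simp
  then have "b \<bullet> (dird (0, ?y) lam w *\<^sub>R (\<theta> ?y w *\<^sub>R b - \<theta> b w *\<^sub>R ?y)) = 0" by (simp only: inner_zero_right)
  then have "dird (0, ?y) lam w = 0"
    using b \<theta>_supporting_pos[OF w] by (simp add: inner_diff_right)
  then show ?thesis using lam_vertical_proportional[OF w, of a ?y] \<theta>_supporting_pos[OF w] by simp
qed

text \<open>By \<open>lam_vertical\<close>, horizontal and coordinate derivatives of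
  \<open>lam\<close> agree. In the horizontal Bianchi identity the derivatives of \<theta> cancel by
  \<open>dird_hor_\<theta>_sym\<close> and those of \<open>N\<close> by \<open>dird_Nn_sym\<close>,
  which again leaves the cyclic sum.\<close>

lemma lam_horizontal_proportional:
  assumes w: "w \<in> W" shows "dird (a, 0) lam w * \<theta> b w = dird (b, 0) lam w * \<theta> a w"
proof (rule cyclic_identity_imp_proportional[OF dim, where \<alpha> = "\<lambda>a. dird (a, 0) lam w" and \<theta> = "\<lambda>a. \<theta> a w"])
  fix a b c
  have l: "dird (hor a w) lam w = dird (a, 0) lam w" for a
    using linear_diff[OF lam_linear[OF w], of "(a, 0)" "(0, N w a)"] lam_vertical[OF w]
    by (simp add: hor_def)
  have B: "dird (0, Rc a b w) (Nn c) w = lam w *\<^sub>R (\<theta> a w *\<^sub>R dird (0, b) (Nn c) w - \<theta> b w *\<^sub>R dird (0, a) (Nn c) w)" for a b c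
  proof -
    have "(0 :: 'e, Rc a b w) = lam w *\<^sub>R (\<theta> a w *\<^sub>R (0, b) - \<theta> b w *\<^sub>R (0, a))"
      by (simp add: isotropic[OF w])
    moreover have "dird (t *\<^sub>R v) (Nn c) w = t *\<^sub>R dird v (Nn c) w"
      "dird (u - v) (Nn c) w = dird u (Nn c) w - dird v (Nn c) w" for t u v
      using linear_scale[OF linN[OF w]] linear_diff[OF linN[OF w]] by blast+
    ultimately show ?thesis by (simp only:)
  qed
  show "dird (c, 0) lam w *\<^sub>R (\<theta> a w *\<^sub>R b - \<theta> b w *\<^sub>R a) + dird (a, 0) lam w *\<^sub>R (\<theta> b w *\<^sub>R c - \<theta> c w *\<^sub>R b)
       + dird (b, 0) lam w *\<^sub>R (\<theta> c w *\<^sub>R a - \<theta> a w *\<^sub>R c) = 0"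
    using bianchi_horizontal[OF w, of c a b] unfolding dird_isotropic[OF w] l B
    by (simp add: dird_hor_\<theta>_sym[OF w, of c] dird_hor_\<theta>_sym[OF w, of b a]
      dird_Nn_sym[OF w, of _ c] dird_Nn_sym[OF w, of b a] algebra_simps)
qed

lemma lam_vertical_constant:
  assumes "x \<in> U" "y \<noteq> 0" "y' \<noteq> 0" shows "lam (x, y) = lam (x, y')"
proof -
  have c: "connected (- {0::'e})" by (rule connected_punctured_universe) (use dim in simp)
  have "((\<lambda>y. lam (x, y)) has_derivative (\<lambda>h. 0)) (at z)" if "z \<in> - {0}" for z
  proof -
    have w: "(x, z) \<in> W" using that assms(1) by (simp add: W_def)
    have "(lam has_derivative (\<lambda>v. dird v lam (x, z))) (at (x, z))"
      using lam_differentiable[OF w] unfolding dird_def by (rule frechet_derivative_worksI)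
    then have "((\<lambda>y. lam (x, y)) has_derivative (\<lambda>h. dird (0, h) lam (x, z))) (at z)"
      by (rule has_derivative_compose[rotated]) (auto intro!: derivative_eq_intros)
    then show ?thesis using lam_vertical[OF w] by simp
  qed
  then show ?thesis
    by (intro has_derivative_zero_unique_connected[OF _ c, of "\<lambda>y. lam (x, y)" y y']) (use assms in auto)
qed

lemma lam_horizontal:
  assumes w: "w \<in> W" shows "dird (b, 0) lam w = 0"
proof -
  obtain x y where xy: "w = (x, y)" "x \<in> U" "y \<noteq> 0" using w unfolding W_def by auto
  have indep: "dird (c, 0) lam (x, z) = dird (c, 0) lam (x, y)" if "z \<noteq> 0" for c z
  proof -
    have d: "((\<lambda>x. lam (x, z)) has_derivative (\<lambda>h. dird (h, 0) lam (x, z))) (at x)" if "z \<noteq> 0" for z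
    proof -
      have w: "(x, z) \<in> W" using that xy by (simp add: W_def)
      have "(lam has_derivative (\<lambda>v. dird v lam (x, z))) (at (x, z))"
        using lam_differentiable[OF w] unfolding dird_def by (rule frechet_derivative_worksI)
      then show ?thesis
        by (rule has_derivative_compose[rotated]) (auto intro!: derivative_eq_intros)
    qed
    have "((\<lambda>x. lam (x, z)) has_derivative (\<lambda>h. dird (h, 0) lam (x, y))) (at x)"
      by (rule has_derivative_transform_within_open[OF d[OF xy(3)] open_U xy(2)])
        (rule lam_vertical_constant, use xy that in auto)
    from has_derivative_unique[OF d[OF that] this] show ?thesis by metis
  qed
  \<comment> \<open>A nonzero vector in the kernel of the base differential of \<open>lam\<close>,
    found as a vector orthogonal to its gradient.\<close>
  obtain a where a: "a \<noteq> 0" "dird (a, 0) lam w = 0"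
  proof -
    obtain p where p: "p \<noteq> 0" "p \<bullet> (\<Sum>e\<in>Basis. dird (e, 0) lam w *\<^sub>R e) = 0"
      using orthogonal_vector_exists[OF dim, of "\<Sum>e\<in>Basis. dird (e, 0) lam w *\<^sub>R e" 0] by blast
    have "linear (\<lambda>a. dird (a, 0) lam w)"
      using linear_compose[OF _ lam_linear[OF w], of "\<lambda>a. (a, 0)"] bounded_linear.linear[OF bounded_linear_Pair[OF bounded_linear_ident bounded_linear_zero]]
      by (simp add: o_def)
    from linear_eq_sum_Basis[OF this, of p] p(2) have "dird (p, 0) lam w = 0"
      by (simp add: inner_sum_right mult.commute)
    then show ?thesis using p(1) that by blast
  qed
  \<comment> \<open>Proportionality is evaluated at \<open>(x, a)\<close>, where the kernel vector
    is itself the supporting element and so \<theta>(a) is positive; \<open>indep\<close> transports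
    the differential of \<open>lam\<close> to that point.\<close>
  have wa: "(x, a) \<in> W" using a xy by (simp add: W_def)
  show ?thesis
    using lam_horizontal_proportional[OF wa, of b a] \<theta>_supporting_pos[OF wa] a indep[OF a(1)] xy by simp
qed

lemma lam_locally_constant:
  assumes w: "w \<in> W" shows "(lam has_derivative (\<lambda>h. 0)) (at w)"
proof -
  have "dird v lam w = 0" for v
    using linear_add[OF lam_linear[OF w], of "(fst v, 0)" "(0, snd v)"] lam_horizontal[OF w] lam_vertical[OF w] by simp
  moreover have "(lam has_derivative (\<lambda>v. dird v lam w)) (at w)"
    using lam_differentiable[OF w] unfolding dird_def by (rule frechet_derivative_worksI)
  ultimately show ?thesis by simp
qed

end

end

section \<open>Smooth atlases\<close>

lemma has_derivative_chain_dird: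
  assumes "(f has_derivative f') (at x)" "g differentiable (at (f x))"
  shows "((\<lambda>x. g (f x)) has_derivative (\<lambda>v. dird (f' v) g (f x))) (at x)"
  using has_derivative_compose[OF assms(1), of g "frechet_derivative g (at (f x))"]
    frechet_derivative_worksI[OF assms(2)] unfolding dird_def by simp

lemma scaleR_fun_apply [simp]: "(r *\<^sub>R f) x = r *\<^sub>R f x"
  by (simp add: scaleR_fun_def)

locale atlas =
  fixes A :: "('a, 'e::euclidean_space) chart set"
  assumes atlas: "smooth_atlas A"
begin

definition "cdom c = snd c ` fst c" for c :: "('a, 'e) chart"
definition "ov c d = snd c ` (fst c \<inter> fst d)" for c d :: "('a, 'e) chart"
definition "tr c d = snd d \<circ> chart_inv c" for c d :: "('a, 'e) chart"

lemma inj_chart: "c \<in> A \<Longrightarrow> inj_on (snd c) (fst c)"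
  using atlas by (simp add: smooth_atlas_def)

lemma open_cdom: "c \<in> A \<Longrightarrow> open (cdom c)"
  using atlas by (simp add: smooth_atlas_def cdom_def)

lemma open_ov: "c \<in> A \<Longrightarrow> d \<in> A \<Longrightarrow> open (ov c d)"
  using atlas by (simp add: smooth_atlas_def ov_def)

lemma smooth_tr: "c \<in> A \<Longrightarrow> d \<in> A \<Longrightarrow> smooth_on (ov c d) (tr c d)"
  using atlas by (simp add: smooth_atlas_def ov_def tr_def)

lemma chart_inv_chart [simp]: "c \<in> A \<Longrightarrow> p \<in> fst c \<Longrightarrow> chart_inv c (snd c p) = p"
  using inj_chart by (simp add: inv_into_f_f)

lemma chart_chart_inv [simp]: "x \<in> cdom c \<Longrightarrow> snd c (chart_inv c x) = x"
  by (simp add: f_inv_into_f cdom_def)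

lemma chart_inv_in: "x \<in> cdom c \<Longrightarrow> chart_inv c x \<in> fst c"
  by (simp add: inv_into_into cdom_def)

lemma chart_in_cdom: "p \<in> fst c \<Longrightarrow> snd c p \<in> cdom c"
  by (simp add: cdom_def)

lemma ov_subset: "ov c d \<subseteq> cdom c"
  by (auto simp: ov_def cdom_def)

lemma ov_self: "ov c c = cdom c"
  by (auto simp: ov_def cdom_def)

lemma chart_in_ov: "p \<in> fst c \<Longrightarrow> p \<in> fst d \<Longrightarrow> snd c p \<in> ov c d"
  by (simp add: ov_def)

lemma ov_inv: "c \<in> A \<Longrightarrow> x \<in> ov c d \<Longrightarrow> chart_inv c x \<in> fst c \<and> chart_inv c x \<in> fst d"
  by (auto simp: ov_def)

lemma tr_apply: "tr c d x = snd d (chart_inv c x)"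
  by (simp add: tr_def)

lemma tr_in: "c \<in> A \<Longrightarrow> x \<in> ov c d \<Longrightarrow> tr c d x \<in> ov d c"
  using ov_inv[of c x d] by (auto simp: tr_apply intro!: chart_in_ov)

lemma tr_inv: "c \<in> A \<Longrightarrow> d \<in> A \<Longrightarrow> x \<in> ov c d \<Longrightarrow> chart_inv d (tr c d x) = chart_inv c x"
  using ov_inv by (simp add: tr_apply)

lemma tr_tr: "c \<in> A \<Longrightarrow> d \<in> A \<Longrightarrow> x \<in> ov c d \<Longrightarrow> tr d e (tr c d x) = tr c e x"
  using tr_inv by (simp add: tr_apply)

lemma tr_self: "x \<in> cdom c \<Longrightarrow> tr c c x = x"
  by (simp add: tr_apply)

lemma dird_tr_linear: "c \<in> A \<Longrightarrow> d \<in> A \<Longrightarrow> x \<in> ov c d \<Longrightarrow> linear (\<lambda>v. dird v (tr c d) x)"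
  by (rule dird_linear[OF smooth_tr])

lemma dird_tr_self: "c \<in> A \<Longrightarrow> x \<in> cdom c \<Longrightarrow> dird v (tr c c) x = v"
  using dird_cong[OF open_cdom, of c x "tr c c" "\<lambda>x. x" v] tr_self dird_eq[OF has_derivative_ident]
  by metis

lemma dird_tr_tr:
  assumes "c \<in> A" "d \<in> A" "e \<in> A" "x \<in> ov c d" "x \<in> ov c e"
  shows "dird (dird v (tr c d) x) (tr d e) (tr c d x) = dird v (tr c e) x"
proof -
  have y: "tr c d x \<in> ov d e"
    using assms tr_inv ov_inv by (metis chart_in_ov tr_apply)
  have "((\<lambda>x. tr d e (tr c d x)) has_derivative (\<lambda>v. dird (dird v (tr c d) x) (tr d e) (tr c d x))) (at x)"
    by (intro has_derivative_chain_dird dird_has_derivative[OF smooth_tr] smooth_on_differentiable[OF smooth_tr])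
      (use assms y in auto)
  then have "dird v (\<lambda>x. tr d e (tr c d x)) x = dird (dird v (tr c d) x) (tr d e) (tr c d x)"
    by (rule dird_eq)
  moreover have "dird v (\<lambda>x. tr d e (tr c d x)) x = dird v (tr c e) x"
    by (rule dird_cong[OF open_ov[of c d]]) (use assms tr_tr in auto)
  ultimately show ?thesis by simp
qed

text \<open>Inverse of the coordinate map that sends a tangent vector at \<open>p\<close> to its
  component in the chart \<open>c\<close>. Most later identities between tangent vectors are checked
  on this one component.\<close>

definition tvec :: "('a, 'e) chart \<Rightarrow> 'a \<Rightarrow> 'e \<Rightarrow> ('a, 'e) tvec" where
  "tvec c p \<xi> = (\<lambda>d. if d \<in> A \<and> p \<in> fst d then dird \<xi> (tr c d) (snd c p) else 0)"

lemma tangent_space_iff: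
  "v \<in> tangent_space A p \<longleftrightarrow> (\<forall>c. c \<notin> A \<or> p \<notin> fst c \<longrightarrow> v c = 0) \<and>
    (\<forall>c\<in>A. \<forall>d\<in>A. p \<in> fst c \<inter> fst d \<longrightarrow> v d = dird (v c) (tr c d) (snd c p))"
  by (simp add: tangent_space_def dird_def tr_def)

lemma tvec_self [simp]: "c \<in> A \<Longrightarrow> p \<in> fst c \<Longrightarrow> tvec c p \<xi> c = \<xi>"
  by (simp add: tvec_def dird_tr_self chart_in_cdom)

lemma tvec_tangent:
  assumes "c \<in> A" "p \<in> fst c" shows "tvec c p \<xi> \<in> tangent_space A p"
  unfolding tangent_space_iff
proof (intro conjI allI ballI impI)
  fix d e assume "d \<in> A" "e \<in> A" "p \<in> fst d \<inter> fst e"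
  then show "tvec c p \<xi> e = dird (tvec c p \<xi> d) (tr d e) (snd d p)"
    using dird_tr_tr[of c d e "snd c p" \<xi>] assms by (simp add: tvec_def chart_in_ov tr_apply)
qed (auto simp: tvec_def)

lemma tangent_component: "v \<in> tangent_space A p \<Longrightarrow> c \<in> A \<Longrightarrow> d \<in> A \<Longrightarrow> p \<in> fst c \<Longrightarrow> p \<in> fst d \<Longrightarrow>
    v d = dird (v c) (tr c d) (snd c p)"
  unfolding tangent_space_iff by blast

lemma tangent_outside: "v \<in> tangent_space A p \<Longrightarrow> c \<notin> A \<or> p \<notin> fst c \<Longrightarrow> v c = 0"
  unfolding tangent_space_iff by blast

lemma tangent_spaceI:
  assumes "\<And>c. c \<notin> A \<or> p \<notin> fst c \<Longrightarrow> v c = 0"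
    and "\<And>c d. c \<in> A \<Longrightarrow> d \<in> A \<Longrightarrow> p \<in> fst c \<Longrightarrow> p \<in> fst d \<Longrightarrow> v d = dird (v c) (tr c d) (snd c p)"
  shows "v \<in> tangent_space A p"
  unfolding tangent_space_iff by (intro conjI allI ballI impI; (elim IntE)?; (rule assms)) assumption+

lemma tangent_eq_tvec:
  assumes v: "v \<in> tangent_space A p" and c: "c \<in> A" "p \<in> fst c" shows "v = tvec c p (v c)"
proof
  fix d
  show "v d = tvec c p (v c) d"
  proof (cases "d \<in> A \<and> p \<in> fst d")
    case True
    then show ?thesis unfolding tvec_def using tangent_component[OF v c(1) _ c(2)] by (simp only: if_True simp_thms)
  next
    case False
    then show ?thesis unfolding tvec_def using tangent_outside[OF v] by (simp only: if_False) blast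
  qed
qed

lemma tangent_eqI:
  assumes "v \<in> tangent_space A p" "w \<in> tangent_space A p" "c \<in> A" "p \<in> fst c" "v c = w c"
  shows "v = w"
proof -
  have "v = tvec c p (v c)" by (rule tangent_eq_tvec[OF assms(1,3,4)])
  also have "\<dots> = tvec c p (w c)" by (simp only: assms(5))
  also have "\<dots> = w" by (rule tangent_eq_tvec[OF assms(2,3,4), symmetric])
  finally show ?thesis .
qed

lemma tangent_add:
  assumes v: "v \<in> tangent_space A p" and w: "w \<in> tangent_space A p"
  shows "v + w \<in> tangent_space A p"
proof (rule tangent_spaceI)
  fix c d assume c: "c \<in> A" "d \<in> A" "p \<in> fst c" "p \<in> fst d"
  show "(v + w) d = dird ((v + w) c) (tr c d) (snd c p)"
    unfolding plus_fun_def linear_add[OF dird_tr_linear[OF c(1,2) chart_in_ov[OF c(3,4)]]]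
      tangent_component[OF v c] tangent_component[OF w c] ..
qed (simp add: plus_fun_def tangent_outside[OF v] tangent_outside[OF w])

lemma tangent_scale:
  assumes v: "v \<in> tangent_space A p" shows "r *\<^sub>R v \<in> tangent_space A p"
proof (rule tangent_spaceI)
  fix c d assume c: "c \<in> A" "d \<in> A" "p \<in> fst c" "p \<in> fst d"
  show "(r *\<^sub>R v) d = dird ((r *\<^sub>R v) c) (tr c d) (snd c p)"
    unfolding scaleR_fun_def linear_scale[OF dird_tr_linear[OF c(1,2) chart_in_ov[OF c(3,4)]]]
      tangent_component[OF v c] ..
qed (simp add: scaleR_fun_def tangent_outside[OF v])

lemma tangent_zero: "0 \<in> tangent_space A p"
proof (rule tangent_spaceI)
  fix c d assume c: "c \<in> A" "d \<in> A" "p \<in> fst c" "p \<in> fst d"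
  show "0 d = dird (0 c) (tr c d) (snd c p)"
    using linear_0[OF dird_tr_linear[OF c(1,2) chart_in_ov[OF c(3,4)]]] by (simp add: zero_fun_def)
qed (simp add: zero_fun_def)

lemma tangent_diff: "v \<in> tangent_space A p \<Longrightarrow> w \<in> tangent_space A p \<Longrightarrow> v - w \<in> tangent_space A p"
  using tangent_add[of v p "(-1) *\<^sub>R w"] tangent_scale[of w p "-1"] by simp

lemma tvec_add: "c \<in> A \<Longrightarrow> p \<in> fst c \<Longrightarrow> tvec c p (\<xi> + \<eta>) = tvec c p \<xi> + tvec c p \<eta>"
  by (rule tangent_eqI[of _ p _ c]) (simp_all add: tvec_tangent tangent_add)

lemma tvec_scale: "c \<in> A \<Longrightarrow> p \<in> fst c \<Longrightarrow> tvec c p (r *\<^sub>R \<xi>) = r *\<^sub>R tvec c p \<xi>"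
  by (rule tangent_eqI[of _ p _ c]) (simp_all add: tvec_tangent tangent_scale)

lemma tvec_zero: "c \<in> A \<Longrightarrow> p \<in> fst c \<Longrightarrow> tvec c p 0 = 0"
  using tvec_scale[of c p 0 0] by simp

lemma tangent_eq_zero_iff: "v \<in> tangent_space A p \<Longrightarrow> c \<in> A \<Longrightarrow> p \<in> fst c \<Longrightarrow> v = 0 \<longleftrightarrow> v c = 0"
  using tangent_eq_tvec[of v p c] tvec_zero[of c p] by (auto simp: zero_fun_def)

lemma mcarrierE: assumes "p \<in> mcarrier A" obtains c where "c \<in> A" "p \<in> fst c"
  using assms by (auto simp: mcarrier_def)

lemma mcarrierI: "c \<in> A \<Longrightarrow> p \<in> fst c \<Longrightarrow> p \<in> mcarrier A"
  by (auto simp: mcarrier_def)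

lemma topspace_manifold: "topspace (manifold_topology A) = mcarrier A"
proof -
  have "openin (manifold_topology A) (mcarrier A)"
    unfolding openin_manifold_topology[OF atlas]
  proof (intro conjI ballI)
    fix d assume d: "d \<in> A"
    have "mcarrier A \<inter> fst d = fst d" using d by (auto simp: mcarrier_def)
    then show "open (snd d ` (mcarrier A \<inter> fst d))" using open_cdom[OF d] by (simp add: cdom_def)
  qed simp
  moreover have "topspace (manifold_topology A) \<subseteq> mcarrier A"
    using openin_topspace[of "manifold_topology A"] unfolding openin_manifold_topology[OF atlas] by blast
  ultimately show ?thesis using openin_subset by blast
qed

lemma openin_chart_preimage:
  assumes c: "c \<in> A" and B: "open B"
  shows "openin (manifold_topology A) {p \<in> fst c. snd c p \<in> B}"
  unfolding openin_manifold_topology[OF atlas]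
proof (intro conjI ballI)
  fix d assume d: "d \<in> A"
  have "snd d ` ({p \<in> fst c. snd c p \<in> B} \<inter> fst d) = ov d c \<inter> tr d c -` B"
    using d by (auto simp: ov_def tr_apply)
  then show "open (snd d ` ({p \<in> fst c. snd c p \<in> B} \<inter> fst d))"
    using continuous_open_preimage[OF smooth_on_continuous[OF smooth_tr[OF d c]] open_ov[OF d c] B] by simp
qed (use mcarrierI[OF c] in auto)

section \<open>Derivatives and Lie brackets under change of chart\<close>

lemma chart_change_has_derivative:
  assumes c: "c \<in> A" "p \<in> fst c" and d: "d \<in> A" "p \<in> fst d"
    and f: "((f \<circ> chart_inv c) has_derivative f') (at (snd c p))"
  shows "((f \<circ> chart_inv d) has_derivative (\<lambda>v. f' (dird v (tr d c) (snd d p)))) (at (snd d p))"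
proof -
  have x: "snd d p \<in> ov d c" by (simp add: chart_in_ov c d)
  have "((\<lambda>x. f (chart_inv c x)) has_derivative f') (at (tr d c (snd d p)))"
    using f c d by (simp add: o_def tr_apply)
  then have "((\<lambda>x. f (chart_inv c (tr d c x))) has_derivative (\<lambda>v. f' (dird v (tr d c) (snd d p)))) (at (snd d p))"
    by (rule has_derivative_compose[OF dird_has_derivative[OF smooth_tr[OF d(1) c(1)] x]])
  then show ?thesis
    by (rule has_derivative_transform_within_open[OF _ open_ov[OF d(1) c(1)] x])
      (simp add: tr_inv c d)
qed

text \<open>\<open>dir_deriv\<close> picks an unknown chart; the chain rule for \<open>f\<close> and
  the transformation rule for the components of \<open>v\<close> compensate each other, so any chart
  may be used.\<close>

lemma dir_deriv_chart:
  assumes c: "c \<in> A" "p \<in> fst c" and v: "v \<in> tangent_space A p"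
    and f: "((f \<circ> chart_inv c) has_derivative f') (at (snd c p))"
  shows "dir_deriv A p v f = f' (v c)"
proof -
  define d where "d = (SOME c. c \<in> A \<and> p \<in> fst c)"
  have d: "d \<in> A" "p \<in> fst d"
    unfolding d_def using someI[of "\<lambda>c. c \<in> A \<and> p \<in> fst c", OF conjI[OF c]] by auto
  have "dir_deriv A p v f = f' (dird (v d) (tr d c) (snd d p))"
    unfolding dir_deriv_def d_def[symmetric] Let_def
    by (rule has_derivative_imp_frechet[OF chart_change_has_derivative[OF c d f]])
  then show ?thesis using tangent_component[OF v d(1) c(1) d(2) c(2)] by simp
qed

lemma smooth_chart_change:
  assumes c: "c \<in> A" and d: "d \<in> A" and f: "smooth_on (ov c d) (f \<circ> chart_inv c)"
  shows "smooth_on (ov d c) (f \<circ> chart_inv d)"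
proof -
  have "smooth_on (ov d c) (\<lambda>x. (f \<circ> chart_inv c) (tr d c x))"
    by (rule smooth_on_compose[OF open_ov open_ov _ f smooth_tr]) (use c d tr_in[OF d, of _ c] in \<open>blast+\<close>)
  then show ?thesis
    by (rule smooth_on_cong[OF open_ov[OF d c], rotated]) (simp add: tr_inv c d)
qed

text \<open>The component in \<open>d\<close> is the derivative of the transition map applied to the
  component in \<open>c\<close>. The product rule therefore adds a second derivative of the
  transition map, the term that has to cancel in the Lie bracket.\<close>

lemma vector_component_has_derivative:
  assumes c: "c \<in> A" "p \<in> fst c" and d: "d \<in> A" "p \<in> fst d"
    and X: "\<And>q. q \<in> mcarrier A \<Longrightarrow> X q \<in> tangent_space A q"
    and X': "((\<lambda>x. X (chart_inv c x) c) has_derivative X') (at (snd c p))"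
  shows "(\<lambda>x. X (chart_inv d x) d) differentiable (at (snd d p))"
    and "dird (dird v (tr c d) (snd c p)) (\<lambda>x. X (chart_inv d x) d) (snd d p) =
      dird v (dird (X p c) (tr c d)) (snd c p) + dird (X' v) (tr c d) (snd c p)"
proof -
  let ?x = "snd c p"
  have x: "?x \<in> ov c d" by (simp add: chart_in_ov c d)
  have 0: "((\<lambda>x. dird (X (chart_inv c x) c) (tr c d) x) has_derivative
     (\<lambda>v. dird v (dird (X (chart_inv c ?x) c) (tr c d)) ?x + dird (X' v) (tr c d) ?x)) (at ?x)"
    by (rule dird_family[OF open_ov smooth_tr x X']) (use c d in auto)
  have 1: "((\<lambda>x. X (chart_inv c x) d) has_derivative
     (\<lambda>v. dird v (dird (X p c) (tr c d)) ?x + dird (X' v) (tr c d) ?x)) (at ?x)"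
  proof (rule has_derivative_transform_within_open[OF 0[unfolded chart_inv_chart[OF c]] open_ov[OF c(1) d(1)] x])
    fix y assume y: "y \<in> ov c d"
    have q: "chart_inv c y \<in> fst c" "chart_inv c y \<in> fst d" using ov_inv[OF c(1) y] by auto
    show "dird (X (chart_inv c y) c) (tr c d) y = X (chart_inv c y) d"
      using tangent_component[OF X[OF mcarrierI[OF c(1) q(1)]] c(1) d(1) q] chart_chart_inv[OF subsetD[OF ov_subset y]] by simp
  qed
  have 2: "((\<lambda>x. X (chart_inv d x) d) has_derivative
     (\<lambda>u. dird (dird u (tr d c) (snd d p)) (dird (X p c) (tr c d)) ?x
        + dird (X' (dird u (tr d c) (snd d p))) (tr c d) ?x)) (at (snd d p))"
    using chart_change_has_derivative[OF c d, of "\<lambda>q. X q d"] 1 by (simp add: o_def)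
  then show "(\<lambda>x. X (chart_inv d x) d) differentiable (at (snd d p))"
    by (rule differentiableI)
  have "dird (dird v (tr c d) ?x) (tr d c) (snd d p) = v"
    using dird_tr_tr[OF c(1) d(1) c(1) x, of v] x dird_tr_self[OF c(1), of ?x v] c ov_subset
    by (auto simp: tr_apply ov_self chart_in_cdom)
  then show "dird (dird v (tr c d) (snd c p)) (\<lambda>x. X (chart_inv d x) d) (snd d p) =
      dird v (dird (X p c) (tr c d)) (snd c p) + dird (X' v) (tr c d) (snd c p)"
    unfolding dird_eq[OF 2] by simp
qed

text \<open>In every other chart the second derivatives of the transition map cancel by symmetry.
  Only differentiability at \<open>p\<close> is assumed, because the lemma is applied to horizontal
  lifts before these are known to be smooth.\<close>

lemma lie_bracket_eq_tvec:
  assumes c: "c \<in> A" "p \<in> fst c"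
    and X: "\<And>q. q \<in> mcarrier A \<Longrightarrow> X q \<in> tangent_space A q"
    and Y: "\<And>q. q \<in> mcarrier A \<Longrightarrow> Y q \<in> tangent_space A q"
    and X': "((\<lambda>x. X (chart_inv c x) c) has_derivative X') (at (snd c p))"
    and Y': "((\<lambda>x. Y (chart_inv c x) c) has_derivative Y') (at (snd c p))"
  shows "lie_bracket A X Y p = tvec c p (Y' (X p c) - X' (Y p c))"
proof
  fix d
  have p: "p \<in> mcarrier A" using c by (rule mcarrierI)
  show "lie_bracket A X Y p d = tvec c p (Y' (X p c) - X' (Y p c)) d"
  proof (cases "d \<in> A \<and> p \<in> fst d")
    case True
    then have d: "d \<in> A" "p \<in> fst d" by auto
    have x: "snd c p \<in> ov c d" by (simp add: chart_in_ov c d)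
    have comp: "X p d = dird (X p c) (tr c d) (snd c p)" "Y p d = dird (Y p c) (tr c d) (snd c p)"
      using tangent_component[OF X[OF p] c(1) d(1) c(2) d(2)]
        tangent_component[OF Y[OF p] c(1) d(1) c(2) d(2)] by auto
    have dX: "dird (dird v (tr c d) (snd c p)) (\<lambda>x. X (chart_inv d x) d) (snd d p) =
        dird v (dird (X p c) (tr c d)) (snd c p) + dird (X' v) (tr c d) (snd c p)" for v
      using vector_component_has_derivative(2)[of c p d X X'] c d X X' by blast
    have dY: "dird (dird v (tr c d) (snd c p)) (\<lambda>x. Y (chart_inv d x) d) (snd d p) =
        dird v (dird (Y p c) (tr c d)) (snd c p) + dird (Y' v) (tr c d) (snd c p)" for v
      using vector_component_has_derivative(2)[of c p d Y Y'] c d Y Y' by blast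
    have "lie_bracket A X Y p d = dird (X p d) (\<lambda>x. Y (chart_inv d x) d) (snd d p)
       - dird (Y p d) (\<lambda>x. X (chart_inv d x) d) (snd d p)"
      using p d by (simp add: lie_bracket_def dird_def o_def)
    also have "\<dots> = dird (Y' (X p c)) (tr c d) (snd c p) - dird (X' (Y p c)) (tr c d) (snd c p)"
      unfolding comp dX dY
      using dird_sym[OF open_ov smooth_tr x, of "Y p c" "X p c"] c d by simp
    also have "\<dots> = dird (Y' (X p c) - X' (Y p c)) (tr c d) (snd c p)"
      using linear_diff[OF dird_tr_linear[OF c(1) d(1) x]] by simp
    finally show ?thesis using d by (simp add: tvec_def)
  next
    case False
    then show ?thesis using p by (auto simp: lie_bracket_def tvec_def)
  qed
qed

text \<open>Products with \<open>\<psi>\<close> of functions on the domain of \<open>c\<close> extend smoothly by zero.\<close>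

definition cutoff :: "('a, 'e) chart \<Rightarrow> ('a \<Rightarrow> real) \<Rightarrow> bool" where
  "cutoff c \<psi> \<longleftrightarrow> \<psi> \<in> Cinf A \<and>
     (\<forall>d\<in>A. \<exists>T. open T \<and> cdom d \<subseteq> T \<union> ov d c \<and> (\<forall>p\<in>fst d. snd d p \<in> T \<longrightarrow> \<psi> p = 0))"

text \<open>The two open sets in the definition of \<open>cutoff\<close> cover the domain of
  \<open>d\<close>: on the overlap \<open>h\<close> is a product of smooth functions, on the other
  set it vanishes.\<close>

lemma smooth_fun_cutoff:
  assumes \<psi>: "cutoff c \<psi>" and c: "c \<in> A" and d: "d \<in> A"
    and f: "smooth_on (ov d c) (f \<circ> chart_inv d)"
    and h: "\<And>p. p \<in> fst d \<Longrightarrow> p \<in> fst c \<Longrightarrow> h p = \<psi> p *\<^sub>R f p"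
    and h0: "\<And>p. p \<in> fst d \<Longrightarrow> \<psi> p = 0 \<Longrightarrow> h p = 0"
  shows "smooth_fun d h"
  unfolding smooth_fun_def cdom_def[symmetric]
proof (rule smooth_on_local)
  fix x assume x: "x \<in> cdom d"
  obtain T where T: "open T" "cdom d \<subseteq> T \<union> ov d c" "\<And>p. p \<in> fst d \<Longrightarrow> snd d p \<in> T \<Longrightarrow> \<psi> p = 0"
    using \<psi> d unfolding cutoff_def by blast
  have "smooth_on (cdom d) (\<psi> \<circ> chart_inv d)"
    using \<psi> d unfolding cutoff_def Cinf_def smooth_fun_def cdom_def by blast
  then have "smooth_on (ov d c) (\<lambda>x. (\<psi> \<circ> chart_inv d) x *\<^sub>R (f \<circ> chart_inv d) x)"
    by (intro smooth_on_scaleR open_ov c d f) (rule smooth_on_subset[OF _ ov_subset])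
  then have 1: "smooth_on (ov d c) (h \<circ> chart_inv d)"
    by (rule smooth_on_cong[OF open_ov[OF d c], rotated]) (use ov_inv[OF d] h in auto)
  have 2: "smooth_on (T \<inter> cdom d) (h \<circ> chart_inv d)"
    by (rule smooth_on_cong[of _ "\<lambda>x. 0"]) (use T open_cdom[OF d] h0 chart_inv_in in \<open>auto\<close>)
  show "\<exists>T. open T \<and> x \<in> T \<and> smooth_on T (h \<circ> chart_inv d)"
  proof (cases "x \<in> ov d c")
    case True
    then show ?thesis using 1 open_ov[OF d c] by blast
  next
    case False
    then show ?thesis using 2 T x open_cdom[OF d] by (intro exI[of _ "T \<inter> cdom d"]) auto
  qed
qed

end

text \<open>A radial step function in the chart, extended by zero. The extension is smooth because
  the closed coordinate ball outside of which it vanishes is compact, hence closed in a Hausdorff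
  space, so its complement is open in every chart.\<close>

lemma cutoff_exists:
  fixes A :: "('a, 'e::euclidean_space) chart set"
  assumes m: "smooth_manifold A" and c: "c \<in> A" "p \<in> fst c"
  obtains \<psi> r where "atlas.cutoff A c \<psi>" "r > 0" "ball (snd c p) r \<subseteq> snd c ` fst c"
    "\<And>q. q \<in> fst c \<Longrightarrow> snd c q \<in> ball (snd c p) r \<Longrightarrow> \<psi> q = 1"
proof -
  interpret atlas A using m by unfold_locales (simp add: smooth_manifold_def)
  let ?x = "snd c p"
  obtain R where R: "R > 0" "cball ?x R \<subseteq> cdom c"
    using open_cdom[OF c(1)] chart_in_cdom[OF c(2)] open_contains_cball by blast
  \<comment> \<open>Scaled to be at least 2 from radius R on, where \<open>smooth_step\<close>
    vanishes, and at most 1 up to radius R/2, where it equals 1.\<close>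
  define s where "s x = (2 / R\<^sup>2) * ((x - ?x) \<bullet> (x - ?x))" for x
  define \<psi> where "\<psi> q = (if q \<in> fst c then smooth_step (s (snd c q)) else 0)" for q
  have s: "smooth_on T s" if "open T" for T
    unfolding s_def[abs_def]
    by (intro smooth_on_mult smooth_on_inner smooth_on_diff smooth_on_const smooth_on_bounded_linear bounded_linear_ident that)
  have sm: "smooth_on (ov d c) (\<psi> \<circ> chart_inv d)" if d: "d \<in> A" for d
  proof -
    have "smooth_on (ov d c) (\<lambda>x. smooth_step (s (tr d c x)))"
      by (rule smooth_on_compose[OF _ _ _ smooth_on_smooth_step], simp_all add: open_ov d c)
        (rule smooth_on_compose[where T=UNIV, OF _ _ _ s smooth_tr], auto simp: open_ov d c)
    then show ?thesis
      by (rule smooth_on_cong[OF open_ov[OF d c(1)], rotated]) (use ov_inv[OF d] in \<open>auto simp: \<psi>_def tr_apply\<close>)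
  qed
  define K where "K = chart_inv c ` cball ?x R"
  have "compactin (manifold_topology A) K"
    unfolding K_def
  proof (rule image_compactin)
    show "compactin (subtopology euclidean (cdom c)) (cball ?x R)"
      using R by (simp add: compactin_subtopology)
    show "continuous_map (subtopology euclidean (cdom c)) (manifold_topology A) (chart_inv c)"
      unfolding continuous_map_def
    proof (intro conjI allI impI)
      show "chart_inv c \<in> topspace (subtopology euclidean (cdom c)) \<rightarrow> topspace (manifold_topology A)"
        unfolding topspace_manifold using mcarrierI[OF c(1)] chart_inv_in by auto
      fix W assume "openin (manifold_topology A) W"
      then have W: "open (snd c ` (W \<inter> fst c))" unfolding openin_manifold_topology[OF atlas] using c by blast
      have "{x \<in> topspace (subtopology euclidean (cdom c)). chart_inv c x \<in> W} = snd c ` (W \<inter> fst c)"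
        using c by (auto simp: cdom_def image_iff)
      then show "openin (subtopology euclidean (cdom c)) {x \<in> topspace (subtopology euclidean (cdom c)). chart_inv c x \<in> W}"
        using W by (auto simp: openin_open cdom_def intro!: exI[of _ "snd c ` (W \<inter> fst c)"])
    qed
  qed
  then have "closedin (manifold_topology A) K"
    using m by (intro compactin_imp_closedin) (auto simp: smooth_manifold_def)
  then have K: "openin (manifold_topology A) (topspace (manifold_topology A) - K)"
    by (rule openin_diff[OF openin_topspace])
  have \<psi>0: "\<psi> q = 0" if "q \<notin> K" for q
  proof (cases "q \<in> fst c")
    case True
    then have "snd c q \<notin> cball ?x R" using that c unfolding K_def by (metis chart_inv_chart image_eqI)
    then have "R < norm (snd c q - ?x)" by (simp add: dist_norm norm_minus_commute)
    then have "R\<^sup>2 \<le> (snd c q - ?x) \<bullet> (snd c q - ?x)"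
      using R by (simp add: power2_norm_eq_inner[symmetric] power_mono)
    then have "2 \<le> s (snd c q)" using R by (simp add: s_def field_simps)
    then show ?thesis by (simp add: \<psi>_def smooth_step_eq)
  qed (simp add: \<psi>_def)
  have Kc: "K \<subseteq> fst c" unfolding K_def using R chart_inv_in by blast
  have cov: "\<exists>T. open T \<and> cdom d \<subseteq> T \<union> ov d c \<and> (\<forall>p\<in>fst d. snd d p \<in> T \<longrightarrow> \<psi> p = 0)" if d: "d \<in> A" for d
  proof (intro exI conjI ballI impI)
    let ?T = "snd d ` ((topspace (manifold_topology A) - K) \<inter> fst d)"
    show "open ?T" using K d unfolding openin_manifold_topology[OF atlas] by blast
    have top: "fst d \<subseteq> topspace (manifold_topology A)"
      unfolding topspace_manifold using mcarrierI[OF d] by blast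
    show "cdom d \<subseteq> ?T \<union> ov d c"
      using top Kc by (auto simp: cdom_def ov_def)
    fix q assume "q \<in> fst d" "snd d q \<in> ?T"
    then show "\<psi> q = 0" using \<psi>0 inj_chart[OF d] by (auto dest: inj_onD)
  qed
  have "\<psi> \<in> Cinf A" unfolding Cinf_def smooth_fun_def cdom_def[symmetric]
  proof (intro CollectI ballI smooth_on_local)
    fix d x assume d: "d \<in> A" and x: "x \<in> cdom d"
    obtain T where T: "open T" "cdom d \<subseteq> T \<union> ov d c" "\<And>p. p \<in> fst d \<Longrightarrow> snd d p \<in> T \<Longrightarrow> \<psi> p = 0"
      using cov[OF d] by blast
    show "\<exists>T. open T \<and> x \<in> T \<and> smooth_on T (\<psi> \<circ> chart_inv d)"
    proof (cases "x \<in> ov d c")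
      case True
      then show ?thesis using sm[OF d] open_ov[OF d c(1)] by blast
    next
      case False
      have "smooth_on (T \<inter> cdom d) (\<psi> \<circ> chart_inv d)"
        by (rule smooth_on_cong[of _ "\<lambda>x. 0"]) (use T open_cdom[OF d] chart_inv_in in auto)
      then show ?thesis using False T x open_cdom[OF d] by (intro exI[of _ "T \<inter> cdom d"]) auto
    qed
  qed
  then have cut: "cutoff c \<psi>" using cov by (simp add: cutoff_def)
  have one: "\<psi> q = 1" if "q \<in> fst c" "snd c q \<in> ball ?x (R / 2)" for q
  proof -
    have "norm (snd c q - ?x) \<le> R / 2" using that by (simp add: dist_norm norm_minus_commute)
    then have "(norm (snd c q - ?x))\<^sup>2 \<le> (R / 2)\<^sup>2" by (rule power_mono) simp
    then have "2 * (norm (snd c q - ?x))\<^sup>2 \<le> R\<^sup>2"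
    proof -
      have "(norm (snd c q - ?x))\<^sup>2 \<le> R\<^sup>2 / 4" using \<open>_ \<le> (R / 2)\<^sup>2\<close> by (simp add: power_divide)
      moreover have "0 \<le> (norm (snd c q - ?x))\<^sup>2" by simp
      ultimately show ?thesis by linarith
    qed
    then have "s (snd c q) \<le> 1"
      using R by (simp add: s_def power2_norm_eq_inner[symmetric] field_simps power_divide)
    then show ?thesis using that by (simp add: \<psi>_def smooth_step_eq)
  qed
  have "ball ?x (R / 2) \<subseteq> snd c ` fst c"
    using R subset_ball[of "R/2" R ?x] ball_subset_cball[of ?x R] unfolding cdom_def by fastforce
  then show thesis using that[of \<psi> "R / 2"] cut one R by simp
qed

section \<open>The slit tangent bundle\<close>

context atlas
begin

lemma slit_fst: "u \<in> fst (slit_chart A c) \<longleftrightarrow> fst u \<in> fst c \<and> snd u \<in> tangent_space A (fst u) \<and> snd u \<noteq> 0"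
  by (cases u) (simp add: slit_chart_def)

lemma slit_snd: "snd (slit_chart A c) u = (snd c (fst u), snd u c)"
  by (cases u) (simp add: slit_chart_def)

lemma slit_inj:
  assumes "c \<in> A" shows "inj_on (snd (slit_chart A c)) (fst (slit_chart A c))"
proof (rule inj_onI)
  fix u v assume "u \<in> fst (slit_chart A c)" "v \<in> fst (slit_chart A c)"
    and eq: "snd (slit_chart A c) u = snd (slit_chart A c) v"
  then have u: "fst u \<in> fst c" "snd u \<in> tangent_space A (fst u)" and v: "fst v \<in> fst c" "snd v \<in> tangent_space A (fst v)"
    by (simp_all add: slit_fst)
  have "fst u = fst v" using eq inj_chart[OF assms] u v by (auto simp: slit_snd dest: inj_onD)
  moreover have "snd u = snd v"
    by (rule tangent_eqI[OF _ _ assms u(1)]) (use eq u v calculation in \<open>auto simp: slit_snd\<close>)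
  ultimately show "u = v" by (simp add: prod_eq_iff)
qed

text \<open>A closed formula for the inverse of the slit chart. It also makes sense on the zero
  section, where it yields the zero vector.\<close>

definition slit_point :: "('a, 'e) chart \<Rightarrow> 'e \<times> 'e \<Rightarrow> ('a, 'e) tm" where
  "slit_point c w = (chart_inv c (fst w), tvec c (chart_inv c (fst w)) (snd w))"

lemma slit_point_in:
  assumes "c \<in> A" "w \<in> cdom c \<times> (- {0})" shows "slit_point c w \<in> fst (slit_chart A c)"
proof -
  have p: "chart_inv c (fst w) \<in> fst c" using assms by (auto intro: chart_inv_in)
  have "tvec c (chart_inv c (fst w)) (snd w) \<noteq> 0"
    using tangent_eq_zero_iff[OF tvec_tangent[OF assms(1) p] assms(1) p, of "snd w"] assms p by auto
  then show ?thesis unfolding slit_fst slit_point_def using p by (simp add: tvec_tangent assms(1))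
qed

lemma snd_slit_point:
  assumes "c \<in> A" "fst w \<in> cdom c" shows "snd (slit_chart A c) (slit_point c w) = w"
  using assms by (auto simp: slit_snd slit_point_def chart_inv_in)

lemma slit_chart_inv:
  assumes "c \<in> A" "w \<in> cdom c \<times> (- {0})" shows "chart_inv (slit_chart A c) w = slit_point c w"
  by (rule inv_into_f_eq[OF slit_inj slit_point_in snd_slit_point]) (use assms in auto)

lemma slit_component_nonzero:
  assumes "c \<in> A" "u \<in> fst (slit_chart A c)" shows "snd u c \<noteq> 0"
  using assms tangent_eq_zero_iff[of "snd u" "fst u" c] by (auto simp: slit_fst)

lemma slit_image:
  assumes c: "c \<in> A"
  shows "snd (slit_chart A c) ` fst (slit_chart A c) = cdom c \<times> (- {0 :: 'e})"
proof (intro equalityI subsetI)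
  fix w assume "w \<in> snd (slit_chart A c) ` fst (slit_chart A c)"
  then show "w \<in> cdom c \<times> (- {0})"
  proof
    fix u assume u: "w = snd (slit_chart A c) u" "u \<in> fst (slit_chart A c)"
    then show ?thesis using slit_component_nonzero[OF c u(2)] by (simp add: slit_snd slit_fst cdom_def)
  qed
next
  fix w :: "'e \<times> 'e" assume w: "w \<in> cdom c \<times> (- {0})"
  then have "snd (slit_chart A c) (slit_point c w) = w" by (intro snd_slit_point c) auto
  then show "w \<in> snd (slit_chart A c) ` fst (slit_chart A c)"
    using slit_point_in[OF c w] by (rule image_eqI[OF sym])
qed

lemma slit_overlap:
  assumes c: "c \<in> A" and d: "d \<in> A"
  shows "snd (slit_chart A c) ` (fst (slit_chart A c) \<inter> fst (slit_chart A d)) = ov c d \<times> (- {0 :: 'e})"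
proof (intro equalityI subsetI)
  fix w assume "w \<in> snd (slit_chart A c) ` (fst (slit_chart A c) \<inter> fst (slit_chart A d))"
  then obtain u where u: "w = snd (slit_chart A c) u" "u \<in> fst (slit_chart A c)" "fst u \<in> fst c" "fst u \<in> fst d"
    by (auto simp: slit_fst)
  then show "w \<in> ov c d \<times> (- {0})"
    using slit_component_nonzero[OF c u(2)] by (simp add: slit_snd ov_def)
next
  fix w :: "'e \<times> 'e" assume w: "w \<in> ov c d \<times> (- {0})"
  then have w': "w \<in> cdom c \<times> (- {0})" "fst w \<in> cdom c" using ov_subset[of c d] by auto
  have "fst (slit_point c w) \<in> fst d" using w ov_inv[OF c, of "fst w" d] by (auto simp: slit_point_def)
  then have "slit_point c w \<in> fst (slit_chart A d)" using slit_point_in[OF c w'(1)] by (simp add: slit_fst)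
  then show "w \<in> snd (slit_chart A c) ` (fst (slit_chart A c) \<inter> fst (slit_chart A d))"
    using snd_slit_point[OF c w'(2)] slit_point_in[OF c w'(1)] by (metis IntI image_eqI)
qed

text \<open>The tangent map of the transition map of the base; \<open>slit_transition\<close>
  identifies it with the transition map of the slit bundle.\<close>

definition slit_tr :: "('a, 'e) chart \<Rightarrow> ('a, 'e) chart \<Rightarrow> 'e \<times> 'e \<Rightarrow> 'e \<times> 'e" where
  "slit_tr c d w = (tr c d (fst w), dird (snd w) (tr c d) (fst w))"

lemma slit_transition:
  assumes c: "c \<in> A" and d: "d \<in> A" and w: "w \<in> ov c d \<times> (- {0})"
  shows "(snd (slit_chart A d) \<circ> chart_inv (slit_chart A c)) w = slit_tr c d w"
proof -
  have w': "w \<in> cdom c \<times> (- {0})" using w ov_subset by blast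
  have x: "fst w \<in> ov c d" "fst w \<in> cdom c" using w w' by auto
  then show ?thesis
    using d ov_inv[OF c x(1)] by (simp add: slit_chart_inv[OF c w'] slit_snd slit_point_def tvec_def slit_tr_def tr_apply)
qed

lemma slit_tr_has_derivative:
  assumes c: "c \<in> A" and d: "d \<in> A" and w: "fst w \<in> ov c d"
  shows "(slit_tr c d has_derivative (\<lambda>v. (dird (fst v) (tr c d) (fst w),
     dird (fst v) (dird (snd w) (tr c d)) (fst w) + dird (snd v) (tr c d) (fst w)))) (at w)"
proof -
  have fst: "(fst has_derivative fst) (at w)" "(snd has_derivative snd) (at w)"
    by (auto intro!: derivative_eq_intros)
  have op: "open (ov c d \<times> (UNIV :: 'e set))" using open_ov[OF c d] by (simp add: open_Times)
  have F: "((\<lambda>w. dird \<xi> (tr c d) (fst w)) has_derivative (\<lambda>v. dird (fst v) (dird \<xi> (tr c d)) (fst w))) (at w)" for \<xi>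
    by (rule has_derivative_compose[OF fst(1) dird_has_derivative[OF smooth_on_dird[OF smooth_tr[OF c d]] w]])
  have "((\<lambda>w. dird (snd w) (tr c d) (fst w)) has_derivative
      (\<lambda>v. dird (fst v) (dird (snd w) (tr c d)) (fst w) + dird (snd v) (tr c d) (fst w))) (at w)"
    by (rule has_derivative_linear_family[where F = "\<lambda>w \<xi>. dird \<xi> (tr c d) (fst w)", OF op _ _ F fst(2)])
      (use w dird_tr_linear[OF c d] in \<open>simp_all add: mem_Times_iff\<close>)
  then show ?thesis unfolding slit_tr_def[abs_def]
    by (intro has_derivative_Pair has_derivative_compose[OF fst(1) dird_has_derivative[OF smooth_tr[OF c d] w]])
qed

lemma smooth_slit_tr:
  assumes c: "c \<in> A" and d: "d \<in> A" shows "smooth_on (ov c d \<times> (- {0})) (slit_tr c d)"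
proof -
  have op: "open (ov c d \<times> (- {0 :: 'e}))" using open_ov[OF c d] by (auto intro!: open_Times)
  have fst: "smooth_on (ov c d \<times> (- {0 :: 'e})) (\<lambda>w. f (fst w))" if "smooth_on (ov c d) f" for f :: "'e \<Rightarrow> 'e"
    by (rule smooth_on_compose[OF op open_ov[OF c d] _ that smooth_on_bounded_linear[OF bounded_linear_fst]]) auto
  have "smooth_on (ov c d \<times> (- {0})) (\<lambda>w. dird (snd w) (tr c d) (fst w))"
    by (rule smooth_on_linear_family[OF op, of "\<lambda>w \<xi>. dird \<xi> (tr c d) (fst w)"])
      (auto intro: fst smooth_on_dird[OF smooth_tr[OF c d]] smooth_on_bounded_linear[OF bounded_linear_snd] dird_tr_linear[OF c d])
  then show ?thesis unfolding slit_tr_def[abs_def]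
    by (intro smooth_on_Pair op fst smooth_tr c d)
qed

lemma slit_atlas: "smooth_atlas (slit_atlas A)"
proof -
  have 1: "inj_on (snd (slit_chart A c)) (fst (slit_chart A c)) \<and> open (snd (slit_chart A c) ` fst (slit_chart A c))" if c: "c \<in> A" for c
    using slit_inj[OF c] open_cdom[OF c] by (simp add: slit_image[OF c] open_Times open_Compl)
  have 2: "open (snd (slit_chart A c) ` (fst (slit_chart A c) \<inter> fst (slit_chart A d))) \<and>
        smooth_on (snd (slit_chart A c) ` (fst (slit_chart A c) \<inter> fst (slit_chart A d)))
          (snd (slit_chart A d) \<circ> chart_inv (slit_chart A c))" if c: "c \<in> A" and d: "d \<in> A" for c d
  proof -
    have op: "open (ov c d \<times> (- {0 :: 'e}))" using open_ov[OF c d] by (auto intro!: open_Times)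
    have "smooth_on (ov c d \<times> (- {0})) (snd (slit_chart A d) \<circ> chart_inv (slit_chart A c))"
      by (rule smooth_on_cong[OF op _ smooth_slit_tr[OF c d]]) (rule slit_transition[OF c d, symmetric])
    then show ?thesis unfolding slit_overlap[OF c d] using op by simp
  qed
  show ?thesis unfolding smooth_atlas_def slit_atlas_def using 1 2 by blast
qed

lemma smooth_tvec_component:
  assumes c: "c \<in> A" and d: "d \<in> A"
  shows "smooth_on (ov d c) ((\<lambda>p. tvec c p \<xi> d) \<circ> chart_inv d)"
proof -
  have "smooth_on (ov d c) (\<lambda>x. dird \<xi> (tr c d) (tr d c x))"
    by (rule smooth_on_compose[OF open_ov open_ov _ smooth_on_dird[OF smooth_tr] smooth_tr])
      (use c d tr_in[OF d, of _ c] in \<open>blast+\<close>)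
  then show ?thesis
    by (rule smooth_on_cong[OF open_ov[OF d c], rotated]) (use ov_inv[OF d] d in \<open>auto simp: tvec_def tr_apply\<close>)
qed

end

locale slit_bundle = atlas A for A :: "('a, 'e::euclidean_space) chart set"

sublocale slit_bundle \<subseteq> slit: atlas "slit_atlas A"
  by unfold_locales (rule slit_atlas)

context slit_bundle
begin

abbreviation "sc c \<equiv> slit_chart A c"

lemma sc_in: "c \<in> A \<Longrightarrow> sc c \<in> slit_atlas A"
  by (simp add: slit_atlas_def)

lemma slit_cdom: "c \<in> A \<Longrightarrow> slit.cdom (sc c) = cdom c \<times> (- {0})"
  by (simp add: slit.cdom_def slit_image)

lemma slit_ov: "c \<in> A \<Longrightarrow> d \<in> A \<Longrightarrow> slit.ov (sc c) (sc d) = ov c d \<times> (- {0})"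
  by (simp add: slit.ov_def slit_overlap)

lemma slitTM_iff: "u \<in> slitTM A \<longleftrightarrow> (\<exists>c\<in>A. u \<in> fst (sc c))"
  by (auto simp: mcarrier_def slit_atlas_def)

lemma slitTM_D: "u \<in> slitTM A \<Longrightarrow> snd u \<in> fibre A u \<and> snd u \<noteq> 0"
  by (auto simp: slitTM_iff slit_fst)

lemma slit_in_chart: "u \<in> slitTM A \<Longrightarrow> u \<in> fst (sc c) \<longleftrightarrow> fst u \<in> fst c"
  using slitTM_D by (auto simp: slit_fst)

lemma dird_slit_tr:
  assumes c: "c \<in> A" and d: "d \<in> A" and u: "u \<in> fst (sc c)" "u \<in> fst (sc d)"
  shows "dird v (slit.tr (sc c) (sc d)) (snd (sc c) u) = (dird (fst v) (tr c d) (snd c (fst u)),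
     dird (fst v) (dird (snd u c) (tr c d)) (snd c (fst u)) + dird (snd v) (tr c d) (snd c (fst u)))"
proof -
  have w: "snd (sc c) u \<in> slit.ov (sc c) (sc d)" by (rule slit.chart_in_ov[OF u])
  have "dird v (slit.tr (sc c) (sc d)) (snd (sc c) u) = dird v (slit_tr c d) (snd (sc c) u)"
    by (rule dird_cong[OF slit.open_ov[OF sc_in[OF c] sc_in[OF d]] w])
      (use slit_transition[OF c d] in \<open>auto simp: slit_ov[OF c d] slit.tr_def\<close>)
  also have "\<dots> = (dird (fst v) (tr c d) (snd c (fst u)),
     dird (fst v) (dird (snd u c) (tr c d)) (snd c (fst u)) + dird (snd v) (tr c d) (snd c (fst u)))"
    using dird_eq[OF slit_tr_has_derivative[OF c d, of "snd (sc c) u"]] u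
    by (simp add: slit_snd slit_fst chart_in_ov)
  finally show ?thesis .
qed

lemma rho_eq_tvec:
  assumes c: "c \<in> A" and u: "u \<in> fst (sc c)" and x: "x \<in> tangent_space (slit_atlas A) u"
  shows "rho A u x = tvec c (fst u) (fst (x (sc c)))"
proof
  fix d
  show "rho A u x d = tvec c (fst u) (fst (x (sc c))) d"
  proof (cases "d \<in> A \<and> fst u \<in> fst d")
    case True
    then have d: "d \<in> A" "u \<in> fst (sc d)" using u by (auto simp: slit_fst)
    have w: "snd (sc d) u \<in> slit.cdom (sc d)" using d(2) by (rule slit.chart_in_cdom)
    have f: "(fst has_derivative fst) (at (snd (sc d) u))" by (auto intro!: derivative_eq_intros)
    have "(((snd d \<circ> fst) \<circ> chart_inv (sc d)) has_derivative fst) (at (snd (sc d) u))"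
      by (rule has_derivative_transform_within_open[OF f slit.open_cdom[OF sc_in[OF d(1)]] w])
        (auto simp: slit_cdom[OF d(1)] slit_chart_inv[OF d(1)] slit_point_def)
    from slit.dir_deriv_chart[OF sc_in[OF d(1)] d(2) x this]
    have "rho A u x d = fst (x (sc d))" using True by (simp add: rho_def)
    also have "\<dots> = dird (fst (x (sc c))) (tr c d) (snd c (fst u))"
      using slit.tangent_component[OF x sc_in[OF c] sc_in[OF d(1)] u d(2)] dird_slit_tr[OF c d(1) u d(2)] by simp
    finally show ?thesis using True by (simp add: tvec_def)
  qed (auto simp: rho_def tvec_def)
qed

lemma vlift_eq_tvec:
  assumes c: "c \<in> A" and u: "u \<in> fst (sc c)" and v: "v \<in> fibre A u"
  shows "vlift A u v = slit.tvec (sc c) u (0, v c)"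
proof
  fix d'
  show "vlift A u v d' = slit.tvec (sc c) u (0, v c) d'"
  proof (cases "d' \<in> slit_atlas A \<and> u \<in> fst d'")
    case True
    then obtain d where d: "d \<in> A" "d' = sc d" "u \<in> fst (sc d)" by (auto simp: slit_atlas_def)
    have fd: "fst u \<in> fst d" "fst u \<in> fst c" using d u by (auto simp: slit_fst)
    have "((\<lambda>t. snd (sc d) (fst u, snd u + t *\<^sub>R v)) has_vector_derivative (0, v d)) (at 0)"
      by (auto simp: slit_snd has_vector_derivative_def intro!: derivative_eq_intros)
    then have "vlift A u v d' = (0, v d)"
      using True d by (simp add: vlift_def velocity_def vector_derivative_at)
    also have "v d = dird (v c) (tr c d) (snd c (fst u))"
      by (rule tangent_component[OF v c d(1) fd(2,1)])
    also have "(0, \<dots>) = slit.tvec (sc c) u (0, v c) d'"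
      using True d dird_slit_tr[OF c d(1) u d(3), of "(0, v c)"]
        linear_0[OF dird_tr_linear[OF c d(1) chart_in_ov[OF fd(2,1)]]]
        linear_0[OF dird_linear[OF smooth_on_dird[OF smooth_tr[OF c d(1)]] chart_in_ov[OF fd(2,1)]]]
      by (simp add: slit.tvec_def)
    finally show ?thesis .
  next
    case False
    then show ?thesis by (auto simp: vlift_def velocity_def slit.tvec_def)
  qed
qed

lemma eta_pifield: "eta A \<in> pifields A"
  unfolding pifields_def smooth_fun_def
proof (intro CollectI conjI ballI)
  fix c assume c: "c \<in> A"
  have "smooth_on (cdom c \<times> (- {0})) ((\<lambda>u. eta A u c) \<circ> chart_inv (sc c))"
  proof (rule smooth_on_cong[of _ snd])
    show "open (cdom c \<times> (- {0 :: 'e}))" using open_cdom[OF c] by (auto intro!: open_Times)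
    fix w :: "'e \<times> 'e" assume w: "w \<in> cdom c \<times> (- {0})"
    then show "snd w = ((\<lambda>u. eta A u c) \<circ> chart_inv (sc c)) w"
      using slit_point_in[OF c w] c snd_slit_point[OF c, of w]
      by (auto simp: slit_chart_inv eta_def slitTM_iff slit_snd)
  qed (simp add: smooth_on_bounded_linear bounded_linear_snd)
  then show "smooth_on (snd (sc c) ` fst (sc c)) ((\<lambda>u. eta A u c) \<circ> chart_inv (sc c))"
    unfolding slit_image[OF c] .
qed (use slitTM_D in \<open>auto simp: eta_def\<close>)

text \<open>The open sets \<open>T\<close> pull back to \<open>T \<times> UNIV\<close>, so cut-offs
  on the base, made constant along the fibres, serve the slit bundle as well.\<close>

lemma cutoff_lift:
  assumes c: "c \<in> A" and \<psi>: "cutoff c \<psi>"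
  shows "slit.cutoff (sc c) (\<psi> \<circ> fst)"
  unfolding slit.cutoff_def
proof (intro conjI ballI)
  have sm: "smooth_on (cdom d \<times> (- {0 :: 'e})) ((\<psi> \<circ> fst) \<circ> chart_inv (sc d))" if d: "d \<in> A" for d
  proof -
    have op: "open (cdom d \<times> (- {0 :: 'e}))" using open_cdom[OF d] by (auto intro!: open_Times)
    have "smooth_on (cdom d) (\<psi> \<circ> chart_inv d)"
      using \<psi> d by (simp add: cutoff_def Cinf_def smooth_fun_def cdom_def)
    then have "smooth_on (cdom d \<times> (- {0 :: 'e})) (\<lambda>w. (\<psi> \<circ> chart_inv d) (fst w))"
      by (rule smooth_on_compose[OF op open_cdom[OF d] _ _ smooth_on_bounded_linear[OF bounded_linear_fst], rotated]) auto
    then show ?thesis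
      by (rule smooth_on_cong[OF op, rotated]) (auto simp: slit_chart_inv[OF d] slit_point_def)
  qed
  then show "\<psi> \<circ> fst \<in> Cinf (slit_atlas A)"
    by (auto simp: Cinf_def smooth_fun_def slit_atlas_def slit_image)
  fix d' assume "d' \<in> slit_atlas A"
  then obtain d where d: "d \<in> A" "d' = sc d" by (auto simp: slit_atlas_def)
  obtain T where T: "open T" "cdom d \<subseteq> T \<union> ov d c" "\<And>p. p \<in> fst d \<Longrightarrow> snd d p \<in> T \<Longrightarrow> \<psi> p = 0"
    using \<psi> d unfolding cutoff_def by blast
  show "\<exists>T. open T \<and> slit.cdom d' \<subseteq> T \<union> slit.ov d' (sc c) \<and> (\<forall>p\<in>fst d'. snd d' p \<in> T \<longrightarrow> (\<psi> \<circ> fst) p = 0)"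
    unfolding d(2) slit_cdom[OF d(1)] slit_ov[OF d(1) c]
    by (rule exI[of _ "T \<times> UNIV"]) (use T in \<open>auto simp: open_Times slit_fst slit_snd\<close>)
qed

end

section \<open>Sections of the pullback bundle and linear connections\<close>

context atlas
begin

lemma tvec_sum: "c \<in> A \<Longrightarrow> p \<in> fst c \<Longrightarrow> (\<Sum>k\<in>Basis. (y \<bullet> k) *\<^sub>R tvec c p k) = tvec c p y"
  by (rule linear_eq_sum_Basis[symmetric]) (auto intro!: linearI simp: tvec_add tvec_scale)

lemma cutoff_zero:
  assumes "cutoff c \<psi>" "p \<in> mcarrier A" "p \<notin> fst c" shows "\<psi> p = 0"
proof -
  obtain d where d: "d \<in> A" "p \<in> fst d" using assms(2) by (rule mcarrierE)
  obtain T where T: "cdom d \<subseteq> T \<union> ov d c" "\<And>p. p \<in> fst d \<Longrightarrow> snd d p \<in> T \<Longrightarrow> \<psi> p = 0"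
    using assms(1) d unfolding cutoff_def by blast
  have "snd d p \<notin> ov d c" using assms(3) ov_inv[OF d(1), of "snd d p" c] d by auto
  then show ?thesis using T chart_in_cdom[OF d(2)] d(2) by blast
qed

end

context slit_bundle
begin

lemma slit_point_slitTM: "c \<in> A \<Longrightarrow> w \<in> cdom c \<times> (- {0}) \<Longrightarrow> slit_point c w \<in> slitTM A"
  using slit_point_in slitTM_iff by blast

lemma open_slit_dom: "c \<in> A \<Longrightarrow> open (cdom c \<times> (- {0 :: 'e}))"
  using open_cdom[of c] by (auto intro!: open_Times)

lemma smooth_fun_slit_iff:
  assumes c: "c \<in> A"
  shows "smooth_fun (sc c) h \<longleftrightarrow> smooth_on (cdom c \<times> (- {0})) (\<lambda>w. h (slit_point c w))"
  unfolding smooth_fun_def slit_image[OF c]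
  using smooth_on_cong[OF open_slit_dom[OF c], of "h \<circ> chart_inv (sc c)" "\<lambda>w. h (slit_point c w)"]
    smooth_on_cong[OF open_slit_dom[OF c], of "\<lambda>w. h (slit_point c w)" "h \<circ> chart_inv (sc c)"]
    slit_chart_inv[OF c] by auto

lemma pifieldsI:
  assumes "\<And>u. u \<in> slitTM A \<Longrightarrow> X u \<in> fibre A u"
    and "\<And>c. c \<in> A \<Longrightarrow> smooth_on (cdom c \<times> (- {0})) (\<lambda>w. X (slit_point c w) c)"
  shows "(\<lambda>u\<in>slitTM A. X u) \<in> pifields A"
  unfolding pifields_def
proof (intro CollectI conjI ballI)
  fix c assume c: "c \<in> A"
  show "smooth_fun (sc c) (\<lambda>u. (\<lambda>u\<in>slitTM A. X u) u c)"
    unfolding smooth_fun_slit_iff[OF c]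
    by (rule smooth_on_cong[OF open_slit_dom[OF c] _ assms(2)[OF c]]) (simp add: slit_point_slitTM c)
qed (use assms in auto)

lemma pifieldsD:
  assumes "X \<in> pifields A"
  shows "u \<in> slitTM A \<Longrightarrow> X u \<in> fibre A u" "X \<in> extensional (slitTM A)"
    "c \<in> A \<Longrightarrow> smooth_on (cdom c \<times> (- {0})) (\<lambda>w. X (slit_point c w) c)"
  using assms smooth_fun_slit_iff[of c "\<lambda>u. X u c"] by (auto simp: pifields_def)

lemma CinfD: "f \<in> Cinf (slit_atlas A) \<Longrightarrow> c \<in> A \<Longrightarrow> smooth_on (cdom c \<times> (- {0})) (\<lambda>w. f (slit_point c w))"
  using smooth_fun_slit_iff[of c f] sc_in[of c] by (simp add: Cinf_def)

lemma CinfI: "(\<And>c. c \<in> A \<Longrightarrow> smooth_fun (sc c) f) \<Longrightarrow> f \<in> Cinf (slit_atlas A)"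
  by (auto simp: Cinf_def slit_atlas_def)

lemma Cinf_const: "(\<lambda>u. r) \<in> Cinf (slit_atlas A)"
  by (rule CinfI) (simp add: smooth_fun_slit_iff)

lemma pifields_add:
  assumes "Y \<in> pifields A" "Z \<in> pifields A" shows "(\<lambda>u\<in>slitTM A. Y u + Z u) \<in> pifields A"
  using assms by (intro pifieldsI) (auto intro: tangent_add pifieldsD smooth_on_add open_slit_dom)

lemma pifields_scale:
  assumes "f \<in> Cinf (slit_atlas A)" "Y \<in> pifields A" shows "(\<lambda>u\<in>slitTM A. f u *\<^sub>R Y u) \<in> pifields A"
  using assms by (intro pifieldsI) (auto intro!: tangent_scale smooth_on_scaleR open_slit_dom CinfD intro: pifieldsD)

lemma pifields_zero: "(\<lambda>u\<in>slitTM A. 0) \<in> pifields A"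
  by (rule pifieldsI) (auto intro: tangent_zero)

lemma pifields_sum:
  assumes "finite I" "\<And>i. i \<in> I \<Longrightarrow> f i \<in> Cinf (slit_atlas A)" "\<And>i. i \<in> I \<Longrightarrow> Y i \<in> pifields A"
  shows "(\<lambda>u\<in>slitTM A. \<Sum>i\<in>I. f i u *\<^sub>R Y i u) \<in> pifields A"
  using assms
proof (induction I rule: finite_induct)
  case empty
  show ?case unfolding sum.empty by (rule pifields_zero)
next
  case (insert i I)
  have "(\<lambda>u\<in>slitTM A. (\<lambda>u\<in>slitTM A. f i u *\<^sub>R Y i u) u + (\<lambda>u\<in>slitTM A. \<Sum>i\<in>I. f i u *\<^sub>R Y i u) u) \<in> pifields A"
    by (intro pifields_add pifields_scale insert.IH insert.prems insertI1 insertI2)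
  moreover have "(\<lambda>u\<in>slitTM A. (\<lambda>u\<in>slitTM A. f i u *\<^sub>R Y i u) u + (\<lambda>u\<in>slitTM A. \<Sum>i\<in>I. f i u *\<^sub>R Y i u) u)
      = (\<lambda>u\<in>slitTM A. \<Sum>i\<in>insert i I. f i u *\<^sub>R Y i u)"
    by (rule restrict_ext) (simp only: restrict_apply' sum.insert[OF insert.hyps])
  ultimately show ?case by (simp only:)
qed

text \<open>The field with constant components \<open>a\<close> in the chart, made global by the
  cut-off, since a connection acts on global sections.\<close>

definition const_field :: "('a, 'e) chart \<Rightarrow> ('a \<Rightarrow> real) \<Rightarrow> 'e \<Rightarrow> ('a, 'e) pifield" where
  "const_field c \<psi> a = (\<lambda>u\<in>slitTM A. if fst u \<in> fst c then \<psi> (fst u) *\<^sub>R tvec c (fst u) a else 0)"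

lemma const_field_pifield:
  assumes c: "c \<in> A" and \<psi>: "cutoff c \<psi>"
  shows "const_field c \<psi> a \<in> pifields A"
  unfolding pifields_def
proof (intro CollectI conjI ballI)
  fix d assume d: "d \<in> A"
  have "smooth_on (ov d c \<times> (- {0 :: 'e})) (\<lambda>w. ((\<lambda>p. tvec c p a d) \<circ> chart_inv d) (fst w))"
    by (rule smooth_on_compose[OF _ open_ov[OF d c] _ smooth_tvec_component[OF c d] smooth_on_bounded_linear[OF bounded_linear_fst]])
      (use open_ov[OF d c] in \<open>auto intro!: open_Times\<close>)
  then have "smooth_on (ov d c \<times> (- {0})) ((\<lambda>u. tvec c (fst u) a d) \<circ> chart_inv (sc d))"
  proof (rule smooth_on_cong[rotated 2])
    show "open (ov d c \<times> (- {0 :: 'e}))" using open_ov[OF d c] by (auto intro!: open_Times)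
    fix w :: "'e \<times> 'e" assume "w \<in> ov d c \<times> (- {0})"
    then have "w \<in> cdom d \<times> (- {0})" using ov_subset[of d c] by auto
    then show "((\<lambda>p. tvec c p a d) \<circ> chart_inv d) (fst w) = ((\<lambda>u. tvec c (fst u) a d) \<circ> chart_inv (sc d)) w"
      by (simp add: slit_chart_inv[OF d] slit_point_def)
  qed
  then show "smooth_fun (sc d) (\<lambda>u. const_field c \<psi> a u d)"
    by (intro slit.smooth_fun_cutoff[OF cutoff_lift[OF c \<psi>] sc_in[OF c] sc_in[OF d], where f="\<lambda>u. tvec c (fst u) a d"])
      (use c d in \<open>auto simp: slit_ov const_field_def slitTM_iff slit_fst\<close>)
qed (use c in \<open>auto simp: const_field_def intro!: tangent_scale tvec_tangent tangent_zero\<close>)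

text \<open>The smoothness axiom of a connection concerns global vector fields; these are the fields
  from which \<open>Dc_smooth\<close> extracts smoothness of the connection in a fixed coordinate
  direction.\<close>

definition const_vector_field :: "('a, 'e) chart \<Rightarrow> ('a \<Rightarrow> real) \<Rightarrow> 'e \<times> 'e \<Rightarrow> ('a, 'e) vfield" where
  "const_vector_field c \<psi> \<xi> =
    (\<lambda>u\<in>slitTM A. if fst u \<in> fst c then \<psi> (fst u) *\<^sub>R slit.tvec (sc c) u \<xi> else 0)"

lemma const_vector_field:
  assumes c: "c \<in> A" and \<psi>: "cutoff c \<psi>"
  shows "const_vector_field c \<psi> \<xi> \<in> vector_fields (slit_atlas A)"
  unfolding vector_fields_def
proof (intro CollectI conjI ballI)
  fix d' assume "d' \<in> slit_atlas A"
  then obtain d where d: "d \<in> A" "d' = sc d" by (auto simp: slit_atlas_def)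
  show "smooth_fun d' (\<lambda>u. const_vector_field c \<psi> \<xi> u d')"
    unfolding d(2)
    by (rule slit.smooth_fun_cutoff[OF cutoff_lift[OF c \<psi>] sc_in[OF c] sc_in[OF d(1)]
        slit.smooth_tvec_component[OF sc_in[OF c] sc_in[OF d(1)]]])
      (use c d in \<open>auto simp: const_vector_field_def slitTM_iff slit_fst\<close>)
next
  fix u assume u: "u \<in> slitTM A"
  then show "const_vector_field c \<psi> \<xi> u \<in> tangent_space (slit_atlas A) u"
    using slit_in_chart[OF u, of c]
    by (auto simp: const_vector_field_def intro!: slit.tangent_scale slit.tvec_tangent slit.tangent_zero sc_in[OF c])
qed (simp add: const_vector_field_def)

text \<open>The coefficients of the fundamental field \<eta> in the coordinate fields, truncated to
  global smooth functions so that the Leibniz rule applies to them.\<close>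

definition fibre_coord :: "('a, 'e) chart \<Rightarrow> ('a \<Rightarrow> real) \<Rightarrow> 'e \<Rightarrow> ('a, 'e) tm \<Rightarrow> real" where
  "fibre_coord c \<psi> k u = (if u \<in> fst (sc c) then \<psi> (fst u) * (snd u c \<bullet> k) else 0)"

lemma fibre_coord_Cinf:
  assumes c: "c \<in> A" and \<psi>: "cutoff c \<psi>"
  shows "fibre_coord c \<psi> k \<in> Cinf (slit_atlas A)"
proof (rule CinfI)
  fix d assume d: "d \<in> A"
  have op: "open (ov c d \<times> (- {0 :: 'e}))" using open_ov[OF c d] by (auto intro!: open_Times)
  have "smooth_on (ov c d \<times> (- {0 :: 'e})) (\<lambda>w. snd w \<bullet> k)"
    by (intro smooth_on_linear_comp[OF op bounded_linear_inner_left] smooth_on_bounded_linear bounded_linear_snd)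
  then have "smooth_on (slit.ov (sc c) (sc d)) ((\<lambda>u. snd u c \<bullet> k) \<circ> chart_inv (sc c))"
    unfolding slit_ov[OF c d]
  proof (rule smooth_on_cong[OF op, rotated])
    fix w :: "'e \<times> 'e" assume "w \<in> ov c d \<times> (- {0})"
    then have w: "w \<in> cdom c \<times> (- {0})" using ov_subset[of c d] by auto
    then have "chart_inv c (fst w) \<in> fst c" by (auto intro: chart_inv_in)
    then show "snd w \<bullet> k = ((\<lambda>u. snd u c \<bullet> k) \<circ> chart_inv (sc c)) w"
      by (simp add: slit_chart_inv[OF c w] slit_point_def c)
  qed
  from slit.smooth_chart_change[OF sc_in[OF c] sc_in[OF d] this]
  show "smooth_fun (sc d) (fibre_coord c \<psi> k)"
    by (rule slit.smooth_fun_cutoff[OF cutoff_lift[OF c \<psi>] sc_in[OF c] sc_in[OF d]])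
      (auto simp: fibre_coord_def)
qed

end

section \<open>The Cartan connection as an operator on sections\<close>

locale cartan_finsler = slit_bundle A for A :: "('a, 'e::euclidean_space) chart set" +
  fixes L :: "('a, 'e) tm \<Rightarrow> real" and D :: "('a, 'e) connection"
  assumes finsler: "finsler_manifold A L" and cartan: "cartan_connection A L D"
begin

abbreviation "TS u \<equiv> tangent_space (slit_atlas A) u"

lemma regular: "regular_connection A D"
  using cartan by (simp add: cartan_connection_def)

lemma connection: "linear_connection A D"
  using regular by (simp add: regular_connection_def)

lemma D_in: "u \<in> slitTM A \<Longrightarrow> x \<in> TS u \<Longrightarrow> Y \<in> pifields A \<Longrightarrow> D u x Y \<in> fibre A u"
  using connection unfolding linear_connection_def by blast

lemma D_lin: "u \<in> slitTM A \<Longrightarrow> x \<in> TS u \<Longrightarrow> y \<in> TS u \<Longrightarrow> Y \<in> pifields A \<Longrightarrow>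
    D u (a *\<^sub>R x + b *\<^sub>R y) Y = a *\<^sub>R D u x Y + b *\<^sub>R D u y Y"
  using connection unfolding linear_connection_def by blast

lemma D_plus: "u \<in> slitTM A \<Longrightarrow> x \<in> TS u \<Longrightarrow> Y \<in> pifields A \<Longrightarrow> Z \<in> pifields A \<Longrightarrow>
    D u x (\<lambda>w\<in>slitTM A. Y w + Z w) = D u x Y + D u x Z"
  using connection unfolding linear_connection_def by blast

lemma D_leibniz: "u \<in> slitTM A \<Longrightarrow> x \<in> TS u \<Longrightarrow> f \<in> Cinf (slit_atlas A) \<Longrightarrow> Y \<in> pifields A \<Longrightarrow>
    D u x (\<lambda>w\<in>slitTM A. f w *\<^sub>R Y w) = dir_deriv (slit_atlas A) u x f *\<^sub>R Y u + f u *\<^sub>R D u x Y"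
  using connection unfolding linear_connection_def by blast

lemma cov_in: "X \<in> vector_fields (slit_atlas A) \<Longrightarrow> Y \<in> pifields A \<Longrightarrow> cov A D X Y \<in> pifields A"
  using connection unfolding linear_connection_def by blast

lemma metric_compatible: "u \<in> slitTM A \<Longrightarrow> x \<in> TS u \<Longrightarrow> Y \<in> pifields A \<Longrightarrow> Z \<in> pifields A \<Longrightarrow>
    dir_deriv (slit_atlas A) u x (\<lambda>w. finsler_metric L w (Y w) (Z w)) =
      finsler_metric L u (D u x Y) (Z u) + finsler_metric L u (Y u) (D u x Z)"
  using cartan unfolding cartan_connection_def by blast

lemma dir_deriv_const:
  assumes u: "u \<in> slitTM A" and x: "x \<in> TS u"
  shows "dir_deriv (slit_atlas A) u x (\<lambda>w. r) = 0"
proof -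
  obtain c where "c \<in> A" "u \<in> fst (sc c)" using u slitTM_iff by blast
  from slit.dir_deriv_chart[OF sc_in[OF this(1)] this(2) x, of "\<lambda>w. r" "\<lambda>v. 0"]
  show ?thesis by (simp add: o_def)
qed

lemma D_zero:
  assumes "u \<in> slitTM A" "x \<in> TS u" shows "D u x (\<lambda>w\<in>slitTM A. 0) = 0"
  using D_leibniz[OF assms Cinf_const[of 0] eta_pifield] dir_deriv_const[OF assms, of "0 :: real"] by simp

lemma D_sum:
  assumes u: "u \<in> slitTM A" and x: "x \<in> TS u"
    and "finite I" "\<And>i. i \<in> I \<Longrightarrow> f i \<in> Cinf (slit_atlas A)" "\<And>i. i \<in> I \<Longrightarrow> Y i \<in> pifields A"
  shows "D u x (\<lambda>w\<in>slitTM A. \<Sum>i\<in>I. f i w *\<^sub>R Y i w) =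
    (\<Sum>i\<in>I. dir_deriv (slit_atlas A) u x (f i) *\<^sub>R Y i u + f i u *\<^sub>R D u x (Y i))"
  using assms(3-)
proof (induction I rule: finite_induct)
  case empty
  show ?case unfolding sum.empty by (rule D_zero[OF u x])
next
  case (insert i I)
  have "D u x (\<lambda>w\<in>slitTM A. \<Sum>i\<in>insert i I. f i w *\<^sub>R Y i w) =
     D u x (\<lambda>w\<in>slitTM A. (\<lambda>w\<in>slitTM A. f i w *\<^sub>R Y i w) w + (\<lambda>w\<in>slitTM A. \<Sum>i\<in>I. f i w *\<^sub>R Y i w) w)"
    by (intro arg_cong[where f = "D u x"] restrict_ext) (simp only: restrict_apply' sum.insert[OF insert.hyps])
  also have "\<dots> = D u x (\<lambda>w\<in>slitTM A. f i w *\<^sub>R Y i w) + D u x (\<lambda>w\<in>slitTM A. \<Sum>i\<in>I. f i w *\<^sub>R Y i w)"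
    by (intro D_plus u x pifields_scale pifields_sum insert.hyps insert.prems insertI1 insertI2)
  also have IH: "D u x (\<lambda>w\<in>slitTM A. \<Sum>i\<in>I. f i w *\<^sub>R Y i w) =
    (\<Sum>i\<in>I. dir_deriv (slit_atlas A) u x (f i) *\<^sub>R Y i u + f i u *\<^sub>R D u x (Y i))"
    by (intro insert.IH insert.prems insertI2)
  also have "D u x (\<lambda>w\<in>slitTM A. f i w *\<^sub>R Y i w) + \<dots> = (\<Sum>i\<in>insert i I. dir_deriv (slit_atlas A) u x (f i) *\<^sub>R Y i u + f i u *\<^sub>R D u x (Y i))"
    unfolding sum.insert[OF insert.hyps] D_leibniz[OF u x insert.prems(1)[OF insertI1] insert.prems(2)[OF insertI1]] ..
  finally show ?case .
qed

text \<open>Any tangent vector that projects to \<open>v\<close> can serve as a start: regularity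
  splits off its vertical part, which \<open>rho\<close> kills, and leaves a horizontal vector over
  \<open>v\<close>.\<close>

lemma hlift_horizontal:
  assumes u: "u \<in> slitTM A" and v: "v \<in> fibre A u"
  shows "hlift A D u v \<in> horizontal_space A D u" "rho A u (hlift A D u v) = v"
proof -
  obtain c where c: "c \<in> A" "u \<in> fst (sc c)" using u slitTM_iff by blast
  have fu: "fst u \<in> fst c" using c by (simp add: slit_fst)
  define X where "X = slit.tvec (sc c) u (v c, 0)"
  have X: "X \<in> TS u" unfolding X_def by (rule slit.tvec_tangent[OF sc_in[OF c(1)] c(2)])
  have rX: "rho A u X = v"
    using rho_eq_tvec[OF c X] tangent_eq_tvec[OF v c(1) fu] c(2) sc_in[OF c(1)] unfolding X_def by simp
  obtain y h where yh: "X = y + h" "y \<in> vertical_space A u" "h \<in> horizontal_space A D u"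
    using regular u X unfolding regular_connection_def by blast
  have y: "y \<in> TS u" "rho A u y = 0" and h: "h \<in> TS u"
    using yh by (auto simp: vertical_space_def horizontal_space_def)
  have "rho A u X = rho A u y + rho A u h"
    unfolding rho_eq_tvec[OF c X] rho_eq_tvec[OF c y(1)] rho_eq_tvec[OF c h]
    by (simp add: yh(1) tvec_add[OF c(1) fu])
  then have "v \<in> rho A u ` horizontal_space A D u" using rX y(2) yh(3) by auto
  then show "hlift A D u v \<in> horizontal_space A D u" "rho A u (hlift A D u v) = v"
    unfolding hlift_def by (rule inv_into_into, rule f_inv_into_f)
qed

lemma rho_field_hlift_field:
  assumes "X \<in> pifields A" shows "rho_field A (hlift_field A D X) = X"
proof
  fix u show "rho_field A (hlift_field A D X) u = X u"
    using hlift_horizontal(2)[of u "X u"] pifieldsD(1)[OF assms, of u] extensional_arb[OF pifieldsD(2)[OF assms]]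
    by (cases "u \<in> slitTM A") (simp_all add: rho_field_def hlift_field_def)
qed

lemma rho_field_vlift_field:
  assumes "X \<in> pifields A" shows "rho_field A (vlift_field A X) = (\<lambda>u\<in>slitTM A. 0)"
proof
  fix u show "rho_field A (vlift_field A X) u = (\<lambda>u\<in>slitTM A. 0) u"
  proof (cases "u \<in> slitTM A")
    case True
    then obtain c where c: "c \<in> A" "u \<in> fst (sc c)" using slitTM_iff by blast
    have fu: "fst u \<in> fst c" using c by (simp add: slit_fst)
    have "rho A u (vlift A u (X u)) = 0"
      unfolding vlift_eq_tvec[OF c pifieldsD(1)[OF assms True]]
      using rho_eq_tvec[OF c slit.tvec_tangent[OF sc_in[OF c(1)] c(2)]] c(2) sc_in[OF c(1)] tvec_zero[OF c(1) fu] by simp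
    then show ?thesis using True by (simp add: rho_field_def vlift_field_def)
  qed (simp add: rho_field_def)
qed

end

section \<open>The Cartan connection in a chart\<close>

context cartan_finsler
begin

definition energy :: "('a, 'e) chart \<Rightarrow> 'e \<times> 'e \<Rightarrow> real" where
  "energy c w = (1/2) * (L (slit_point c w))\<^sup>2"

lemma energy_smooth:
  assumes c: "c \<in> A" shows "smooth_on (cdom c \<times> (- {0})) (energy c)"
proof -
  have "L \<in> Cinf (slit_atlas A)" using finsler by (simp add: finsler_manifold_def)
  then show ?thesis unfolding energy_def[abs_def] power2_eq_square
    by (intro smooth_on_mult smooth_on_const CinfD open_slit_dom c)
qed

lemma slit_point_scale:
  assumes "c \<in> A" "x \<in> cdom c"
  shows "slit_point c (x, t *\<^sub>R y) = (fst (slit_point c (x, y)), t *\<^sub>R snd (slit_point c (x, y)))"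
  using assms by (simp add: slit_point_def tvec_scale chart_inv_in)

lemma energy_hom:
  assumes c: "c \<in> A" and x: "x \<in> cdom c" and t: "t > 0"
  shows "energy c (x, t *\<^sub>R y) = t\<^sup>2 * energy c (x, y)"
proof -
  have "slit_point c (x, y) \<in> TM A"
    using c x by (auto simp: slit_point_def TM_def intro!: mcarrierI chart_inv_in tvec_tangent)
  then show ?thesis using finsler t
    by (simp add: energy_def slit_point_scale[OF c x] finsler_manifold_def power_mult_distrib)
qed

lemma finsler_metric_chart:
  assumes c: "c \<in> A" and w: "w \<in> cdom c \<times> (- {0})" and p: "p = chart_inv c (fst w)"
  shows "finsler_metric L (slit_point c w) (tvec c p a) (tvec c p b) = dird (0, a) (dird (0, b) (energy c)) w"
proof -
  obtain x y where xy: "w = (x, y)" "x \<in> cdom c" "y \<noteq> 0" using w by auto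
  have pc: "p \<in> fst c" using xy p by (auto intro: chart_inv_in)
  have eq: "(fst (slit_point c w), snd (slit_point c w) + s *\<^sub>R tvec c p a + t *\<^sub>R tvec c p b)
      = slit_point c (((x, y) + s *\<^sub>R (0, a)) + t *\<^sub>R (0, b))" for s t
    using xy p pc c by (simp add: slit_point_def tvec_add tvec_scale)
  \<comment> \<open>Where y + s a = 0 the point lies on the zero section, at which L need not be
    differentiable; the outer derivative only sees \<open>s\<close> near 0.\<close>
  define S where "S = {s. y + s *\<^sub>R a \<noteq> 0}"
  have S: "open S" "0 \<in> S"
    unfolding S_def using xy by (auto intro!: open_Collect_neq continuous_intros)
  have inner: "deriv (\<lambda>t. energy c (((x, y) + s *\<^sub>R (0, a)) + t *\<^sub>R (0, b))) 0 = dird (0, b) (energy c) ((x, y) + s *\<^sub>R (0, a))"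
    if "s \<in> S" for s
    by (rule DERIV_imp_deriv, rule has_derivative_line, rule dird_has_derivative[OF energy_smooth[OF c]])
      (use xy that in \<open>auto simp: S_def\<close>)
  have "((\<lambda>s. dird (0, b) (energy c) ((x, y) + s *\<^sub>R (0, a))) has_real_derivative
      dird (0, a) (dird (0, b) (energy c)) (x, y)) (at 0)"
    by (rule has_derivative_line, rule dird_has_derivative[OF smooth_on_dird[OF energy_smooth[OF c]]])
      (use xy in auto)
  then have "((\<lambda>s. deriv (\<lambda>t. energy c (((x, y) + s *\<^sub>R (0, a)) + t *\<^sub>R (0, b))) 0) has_real_derivative
      dird (0, a) (dird (0, b) (energy c)) (x, y)) (at 0)"
    by (rule has_field_derivative_transform_within_open[OF _ S]) (rule inner[symmetric])
  from DERIV_imp_deriv[OF this] show ?thesis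
    unfolding finsler_metric_def eq energy_def[symmetric] by (simp add: xy(1))
qed

lemma finsler_metric_pos: "u \<in> slitTM A \<Longrightarrow> x \<in> fibre A u \<Longrightarrow> x \<noteq> 0 \<Longrightarrow> 0 < finsler_metric L u x x"
  using finsler by (simp add: finsler_manifold_def)

end

text \<open>Over \<open>V\<close> the cut-off equals 1, so the global fields
  \<open>const_field c \<psi> a\<close> restrict there to the coordinate fields and the abstract
  connection can be computed in coordinates.\<close>

locale chart_nbhd = cartan_finsler A L D for A :: "('a, 'e::euclidean_space) chart set" and L D +
  fixes c :: "('a, 'e) chart" and \<psi> :: "'a \<Rightarrow> real" and V :: "'e set"
  assumes c: "c \<in> A" and cut: "cutoff c \<psi>" and open_V: "open V" and V_sub: "V \<subseteq> cdom c"
    and \<psi>_one: "\<And>q. q \<in> fst c \<Longrightarrow> snd c q \<in> V \<Longrightarrow> \<psi> q = 1"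
begin

definition "WV = V \<times> (- {0 :: 'e})"

abbreviation "P \<equiv> slit_point c"
abbreviation "cf \<equiv> const_field c \<psi>"
abbreviation "En \<equiv> energy c"
abbreviation "tv w \<equiv> tvec c (fst (P w))"
abbreviation "tt w \<equiv> slit.tvec (sc c) (P w)"
abbreviation "gm w a b \<equiv> dird (0, a) (dird (0, b) En) w"

lemma open_WV: "open WV"
  unfolding WV_def using open_V by (auto intro!: open_Times)

lemma WV_D: assumes "w \<in> WV" shows "w \<in> cdom c \<times> (- {0})" "fst w \<in> cdom c" "fst w \<in> V"
  using assms V_sub by (auto simp: WV_def)

lemma P_in: "w \<in> WV \<Longrightarrow> P w \<in> fst (sc c)"
  by (rule slit_point_in[OF c WV_D(1)])

lemma P_slitTM: "w \<in> WV \<Longrightarrow> P w \<in> slitTM A"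
  by (rule slit_point_slitTM[OF c WV_D(1)])

lemma P_fst: "w \<in> WV \<Longrightarrow> fst (P w) \<in> fst c"
  using P_in by (simp add: slit_fst)

lemma P_chart: "w \<in> WV \<Longrightarrow> snd (sc c) (P w) = w"
  by (rule snd_slit_point[OF c WV_D(2)])

lemma P_base: "w \<in> WV \<Longrightarrow> snd c (fst (P w)) = fst w" and P_component: "w \<in> WV \<Longrightarrow> snd (P w) c = snd w"
  using P_chart[of w] by (auto simp: slit_snd prod_eq_iff)

lemma P_\<psi>: "w \<in> WV \<Longrightarrow> \<psi> (fst (P w)) = 1"
  using \<psi>_one[OF P_fst] P_base WV_D(3) by simp

lemma P_snd: assumes w: "w \<in> WV" shows "snd (P w) = tv w (snd w)"
  by (simp add: slit_point_def)

lemma cf_pifield: "cf a \<in> pifields A"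
  by (rule const_field_pifield[OF c cut])

lemma cf_P: "w \<in> WV \<Longrightarrow> cf a (P w) = tv w a"
  by (simp add: const_field_def P_slitTM P_fst P_\<psi>)

lemma tt_in: "w \<in> WV \<Longrightarrow> tt w \<xi> \<in> TS (P w)"
  by (rule slit.tvec_tangent[OF sc_in[OF c] P_in])

lemma tt_self: "w \<in> WV \<Longrightarrow> tt w \<xi> (sc c) = \<xi>"
  by (rule slit.tvec_self[OF sc_in[OF c] P_in])

lemma tt_eq: "w \<in> WV \<Longrightarrow> x \<in> TS (P w) \<Longrightarrow> x = tt w (x (sc c))"
  using slit.tangent_eq_tvec[OF _ sc_in[OF c] P_in] .

lemma tv_self: "w \<in> WV \<Longrightarrow> tv w a c = a"
  by (rule tvec_self[OF c P_fst])

lemma tv_eq: "w \<in> WV \<Longrightarrow> v \<in> fibre A (P w) \<Longrightarrow> v = tv w (v c)"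
  by (rule tangent_eq_tvec[OF _ c P_fst])

lemma tv_in: "w \<in> WV \<Longrightarrow> tv w a \<in> fibre A (P w)"
  by (rule tvec_tangent[OF c P_fst])

lemma chart_inv_P: "w \<in> WV \<Longrightarrow> chart_inv (sc c) w = P w"
  by (rule slit_chart_inv[OF c WV_D(1)])

lemma dir_deriv_P:
  assumes w: "w \<in> WV" and x: "x \<in> TS (P w)" and F: "(F has_derivative F') (at w)"
    and f: "\<And>y. y \<in> WV \<Longrightarrow> f (P y) = F y"
  shows "dir_deriv (slit_atlas A) (P w) x f = F' (x (sc c))"
proof (rule slit.dir_deriv_chart[OF sc_in[OF c] P_in[OF w] x])
  show "((f \<circ> chart_inv (sc c)) has_derivative F') (at (snd (sc c) (P w)))"
    unfolding P_chart[OF w]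
    by (rule has_derivative_transform_within_open[OF F open_WV w]) (simp add: f chart_inv_P)
qed

lemma En_smooth: "smooth_on WV En"
  by (rule smooth_on_subset[OF energy_smooth[OF c]]) (use V_sub in \<open>auto simp: WV_def\<close>)

lemma rho_P: "w \<in> WV \<Longrightarrow> x \<in> TS (P w) \<Longrightarrow> rho A (P w) x = tv w (fst (x (sc c)))"
  using rho_eq_tvec[OF c P_in] .

lemma gm_finsler: "w \<in> WV \<Longrightarrow> finsler_metric L (P w) (tv w a) (tv w b) = gm w a b"
  using finsler_metric_chart[OF c WV_D(1)] by (simp add: slit_point_def)

text \<open>Evaluated on the coordinate fields \<open>cf a\<close>, these are the coefficients of
  the connection in the chart.\<close>

definition "Dc w \<xi> Y = D (P w) (tt w \<xi>) Y c"

lemma D_eq: "w \<in> WV \<Longrightarrow> x \<in> TS (P w) \<Longrightarrow> Y \<in> pifields A \<Longrightarrow> D (P w) x Y = tv w (Dc w (x (sc c)) Y)"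
  unfolding Dc_def using tt_eq tv_eq D_in P_slitTM by metis

lemma Dc_linear:
  assumes w: "w \<in> WV" and Y: "Y \<in> pifields A" shows "linear (\<lambda>\<xi>. Dc w \<xi> Y)"
proof (rule linearI)
  fix x y r
  show "Dc w (x + y) Y = Dc w x Y + Dc w y Y"
    unfolding Dc_def slit.tvec_add[OF sc_in[OF c] P_in[OF w]]
    using D_lin[OF P_slitTM[OF w] tt_in[OF w] tt_in[OF w] Y, of 1 _ 1] by simp
  show "Dc w (r *\<^sub>R x) Y = r *\<^sub>R Dc w x Y"
    unfolding Dc_def slit.tvec_scale[OF sc_in[OF c] P_in[OF w]]
    using D_lin[OF P_slitTM[OF w] tt_in[OF w] tt_in[OF w] Y, of r _ 0] by simp
qed

lemma Dc_smooth:
  assumes Y: "Y \<in> pifields A" shows "smooth_on WV (\<lambda>w. Dc w \<xi> Y)"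
proof -
  have "cov A D (const_vector_field c \<psi> \<xi>) Y \<in> pifields A"
    by (rule cov_in[OF const_vector_field[OF c cut] Y])
  from pifieldsD(3)[OF this c]
  have "smooth_on WV (\<lambda>w. cov A D (const_vector_field c \<psi> \<xi>) Y (P w) c)"
    by (rule smooth_on_subset) (use V_sub in \<open>auto simp: WV_def\<close>)
  then show ?thesis
    by (rule smooth_on_cong[OF open_WV, rotated])
      (simp add: cov_def const_vector_field_def P_slitTM P_fst P_\<psi> Dc_def)
qed

lemma Dc_metric:
  assumes w: "w \<in> WV"
  shows "dird \<xi> (dird (0, a) (dird (0, b) En)) w = gm w (Dc w \<xi> (cf a)) b + gm w a (Dc w \<xi> (cf b))"
proof -
  let ?x = "tt w \<xi>"
  have "dir_deriv (slit_atlas A) (P w) ?x (\<lambda>u. finsler_metric L u (cf a u) (cf b u))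
      = dird (?x (sc c)) (dird (0, a) (dird (0, b) En)) w"
    by (rule dir_deriv_P[OF w tt_in[OF w] dird_has_derivative[OF smooth_on_dird[OF smooth_on_dird[OF En_smooth]] w]])
      (simp add: cf_P gm_finsler)
  then show ?thesis
    using metric_compatible[OF P_slitTM[OF w] tt_in[OF w] cf_pifield cf_pifield, of \<xi> a b]
    unfolding D_eq[OF w tt_in[OF w] cf_pifield] tt_self[OF w] cf_P[OF w] gm_finsler[OF w] by simp
qed

lemma \<psi>_Cinf: "(\<lambda>u. \<psi> (fst u)) \<in> Cinf (slit_atlas A)"
  using cutoff_lift[OF c cut] by (simp add: slit.cutoff_def o_def)

text \<open>The Leibniz rule for a factor with value 1 and derivative 0 at the point. In this form
  the locality of \<open>D\<close> is used.\<close>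

lemma D_local_scale:
  assumes w: "w \<in> WV" and x: "x \<in> TS (P w)" and Y: "Y \<in> pifields A"
  shows "D (P w) x (\<lambda>u\<in>slitTM A. \<psi> (fst u) *\<^sub>R Y u) = D (P w) x Y"
proof -
  have "dir_deriv (slit_atlas A) (P w) x (\<lambda>u. \<psi> (fst u)) = 0"
    by (rule dir_deriv_P[OF w x has_derivative_const]) (rule P_\<psi>)
  then show ?thesis using D_leibniz[OF P_slitTM[OF w] x \<psi>_Cinf Y] P_\<psi>[OF w] by simp
qed

text \<open>In the expansion \<open>\<eta> = \<Sum> y\<^sup>k \<partial>\<^sub>k\<close> only the coefficients vary, so \<open>\<eta>\<close> can be exchanged for the
  constant field with the same value at the given point.\<close>

lemma Dc_eta:
  assumes w: "w \<in> WV"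
  shows "Dc w \<xi> (eta A) = snd \<xi> + Dc w \<xi> (cf (snd w))"
proof -
  let ?x = "tt w \<xi>"
  let ?u = "P w"
  let ?eta' = "\<lambda>u\<in>slitTM A. \<psi> (fst u) *\<^sub>R eta A u"
  have u: "?u \<in> slitTM A" and x: "?x \<in> TS ?u" using P_slitTM tt_in w by blast+
  have e': "?eta' \<in> pifields A" by (rule pifields_scale[OF \<psi>_Cinf eta_pifield])
  \<comment> \<open>Coefficients and coordinate fields carry one factor \<psi> each, so the
    expansion produces \<psi>^2 times \<eta>; it is written as a nested product so that
    \<open>D_local_scale\<close> can remove one factor at a time.\<close>
  have eq1: "(\<lambda>u\<in>slitTM A. \<Sum>k\<in>Basis. fibre_coord c \<psi> k u *\<^sub>R cf k u) =
      (\<lambda>u\<in>slitTM A. \<psi> (fst u) *\<^sub>R ?eta' u)"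
  proof (rule restrict_ext)
    fix u assume u: "u \<in> slitTM A"
    have in_c: "u \<in> fst (sc c) \<longleftrightarrow> fst u \<in> fst c" by (rule slit_in_chart[OF u])
    show "(\<Sum>k\<in>Basis. fibre_coord c \<psi> k u *\<^sub>R cf k u) = \<psi> (fst u) *\<^sub>R ?eta' u"
    proof (cases "fst u \<in> fst c")
      case True
      have "(\<Sum>k\<in>Basis. fibre_coord c \<psi> k u *\<^sub>R cf k u) =
          (\<Sum>k\<in>Basis. (\<psi> (fst u) * \<psi> (fst u)) *\<^sub>R ((snd u c \<bullet> k) *\<^sub>R tvec c (fst u) k))"
        using u True in_c by (intro sum.cong) (simp_all add: fibre_coord_def const_field_def)
      also have "\<dots> = (\<psi> (fst u) * \<psi> (fst u)) *\<^sub>R tvec c (fst u) (snd u c)"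
        by (simp only: scaleR_sum_right[symmetric] tvec_sum[OF c True])
      also have "tvec c (fst u) (snd u c) = snd u"
        using tangent_eq_tvec[OF _ c True] slitTM_D[OF u] by metis
      finally show ?thesis unfolding restrict_apply'[OF u] eta_def scaleR_scaleR .
    next
      case False
      obtain d where "d \<in> A" "u \<in> fst (sc d)" using u slitTM_iff by blast
      then have "fst u \<in> mcarrier A" by (simp add: slit_fst mcarrierI)
      then have "\<psi> (fst u) = 0" using cutoff_zero[OF cut _ False] by blast
      moreover have "(\<Sum>k\<in>Basis. fibre_coord c \<psi> k u *\<^sub>R cf k u) = 0"
        using False in_c by (intro sum.neutral ballI) (simp add: fibre_coord_def)
      ultimately show ?thesis by simp
    qed
  qed
  have eq2: "(\<lambda>u\<in>slitTM A. \<Sum>k\<in>Basis. (snd w \<bullet> k) *\<^sub>R cf k u) = cf (snd w)"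
  proof
    fix u
    show "(\<lambda>u\<in>slitTM A. \<Sum>k\<in>Basis. (snd w \<bullet> k) *\<^sub>R cf k u) u = cf (snd w) u"
    proof (cases "u \<in> slitTM A \<and> fst u \<in> fst c")
      case True
      then have "(\<Sum>k\<in>Basis. (snd w \<bullet> k) *\<^sub>R cf k u) = (\<Sum>k\<in>Basis. \<psi> (fst u) *\<^sub>R ((snd w \<bullet> k) *\<^sub>R tvec c (fst u) k))"
        by (intro sum.cong) (simp_all add: const_field_def)
      also have "\<dots> = \<psi> (fst u) *\<^sub>R tvec c (fst u) (snd w)"
        using True by (simp only: scaleR_sum_right[symmetric] tvec_sum[OF c])
      finally show ?thesis using True by (simp add: const_field_def)
    next
      case False
      then show ?thesis by (cases "u \<in> slitTM A") (simp_all add: const_field_def)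
    qed
  qed
  have coord: "dir_deriv (slit_atlas A) ?u ?x (fibre_coord c \<psi> k) = snd \<xi> \<bullet> k" for k
  proof -
    have "dir_deriv (slit_atlas A) ?u ?x (fibre_coord c \<psi> k) = snd (?x (sc c)) \<bullet> k"
      by (rule dir_deriv_P[OF w x, of "\<lambda>w. snd w \<bullet> k"])
        (auto simp: fibre_coord_def P_in P_\<psi> P_component intro!: derivative_eq_intros)
    then show ?thesis by (simp add: tt_self[OF w])
  qed
  have fc: "fibre_coord c \<psi> k ?u = snd w \<bullet> k" for k
    by (simp add: fibre_coord_def P_in P_\<psi> P_component w)
  have "D ?u ?x (eta A) = D ?u ?x (\<lambda>u\<in>slitTM A. \<Sum>k\<in>Basis. fibre_coord c \<psi> k u *\<^sub>R cf k u)"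
    unfolding eq1 using D_local_scale[OF w x e'] D_local_scale[OF w x eta_pifield] by simp
  also have "\<dots> = (\<Sum>k\<in>Basis. dir_deriv (slit_atlas A) ?u ?x (fibre_coord c \<psi> k) *\<^sub>R cf k ?u
      + fibre_coord c \<psi> k ?u *\<^sub>R D ?u ?x (cf k))"
    by (rule D_sum[OF u x finite_Basis fibre_coord_Cinf[OF c cut] cf_pifield])
  also have "\<dots> = (\<Sum>k\<in>Basis. (snd \<xi> \<bullet> k) *\<^sub>R tv w k) + (\<Sum>k\<in>Basis. (snd w \<bullet> k) *\<^sub>R D ?u ?x (cf k))"
    unfolding coord fc cf_P[OF w] by (rule sum.distrib)
  also have "(\<Sum>k\<in>Basis. (snd \<xi> \<bullet> k) *\<^sub>R tv w k) = tv w (snd \<xi>)"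
    by (rule tvec_sum[OF c P_fst[OF w]])
  also have "(\<Sum>k\<in>Basis. (snd w \<bullet> k) *\<^sub>R D ?u ?x (cf k)) = D ?u ?x (cf (snd w))"
    using D_sum[OF u x finite_Basis Cinf_const cf_pifield, of "\<lambda>k. snd w \<bullet> k" "\<lambda>k. k"]
    unfolding eq2 dir_deriv_const[OF u x] by simp
  finally have "D ?u ?x (eta A) = tv w (snd \<xi>) + D ?u ?x (cf (snd w))" .
  then show ?thesis unfolding Dc_def by (simp add: tv_self[OF w])
qed

end

sublocale chart_nbhd \<subseteq> en: local_energy V "energy c"
proof
  show "open V" by (rule open_V)
  show "smooth_on (V \<times> - {0}) En" using En_smooth by (simp add: WV_def)
  show "energy c (x, t *\<^sub>R y) = t\<^sup>2 * energy c (x, y)" if "x \<in> V" "t > 0" for x y t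
    using energy_hom[OF c _ that(2)] that(1) V_sub by blast
  fix w :: "'e \<times> 'e" and v :: 'e assume "w \<in> V \<times> - {0}" and v: "v \<noteq> 0"
  then have w: "w \<in> WV" by (simp add: WV_def)
  have "tv w v \<noteq> 0" using tangent_eq_zero_iff[OF tv_in[OF w] c P_fst[OF w]] tv_self[OF w] v by metis
  from finsler_metric_pos[OF P_slitTM[OF w] tv_in[OF w] this]
  show "0 < gm w v v" unfolding gm_finsler[OF w] .
qed

context chart_nbhd
begin

lemma en_W: "en.W = WV"
  by (simp add: en.W_def WV_def)

lemma gm_sym: "w \<in> WV \<Longrightarrow> gm w a b = gm w b a"
  using en.g_sym unfolding en.g_def en.\<theta>_def en_W .

lemma gm_nondegenerate: "w \<in> WV \<Longrightarrow> (\<And>b. gm w a b = gm w a' b) \<Longrightarrow> a = a'"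
  using en.g_nondegenerate unfolding en.\<theta>_def en_W .

lemma gm_linear: "w \<in> WV \<Longrightarrow> linear (\<lambda>a. gm w a b)"
  using linear_compose[OF bounded_linear.linear[OF bounded_linear_Pair[OF bounded_linear_zero bounded_linear_ident]]
      dird_linear[OF smooth_on_dird[OF En_smooth]], of w "(0, b)"]
  by (simp add: o_def)

section \<open>The nonlinear connection and the torsion conditions\<close>

definition "Nh w a = - snd (hlift A D (P w) (tv w a) (sc c))"

text \<open>A vertical vector along which \<eta> is parallel is also horizontal, and regularity
  leaves only zero.\<close>

lemma vertical_injective:
  assumes w: "w \<in> WV" and 0: "Dc w (0, b) (eta A) = 0" shows "b = 0"
proof -
  have z: "tv w 0 = 0" by (rule tvec_zero[OF c P_fst[OF w]])
  have "tt w (0, b) \<in> vertical_space A (P w) \<inter> horizontal_space A D (P w)"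
    using tt_in[OF w] rho_P[OF w tt_in[OF w]] D_eq[OF w tt_in[OF w] eta_pifield] 0
    by (simp add: vertical_space_def horizontal_space_def tt_self[OF w] z)
  moreover have "vertical_space A (P w) \<inter> horizontal_space A D (P w) = {0}"
    using regular P_slitTM[OF w] unfolding regular_connection_def by blast
  ultimately have "tt w (0, b) = 0" by blast
  then have "tt w (0, b) (sc c) = 0" by simp
  then show ?thesis by (simp add: tt_self[OF w] zero_prod_def)
qed

lemma hlift_P:
  assumes w: "w \<in> WV" shows "hlift A D (P w) (tv w a) = tt w (a, - Nh w a)"
    and "Dc w (a, - Nh w a) (eta A) = 0"
proof -
  let ?h = "hlift A D (P w) (tv w a)"
  have h: "?h \<in> TS (P w)" "D (P w) ?h (eta A) = 0" "rho A (P w) ?h = tv w a"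
    using hlift_horizontal[OF P_slitTM[OF w] tv_in[OF w]] by (auto simp: horizontal_space_def)
  have "fst (?h (sc c)) = a" using h(3) unfolding rho_P[OF w h(1)] using tv_self[OF w] by metis
  then have hc: "?h (sc c) = (a, - Nh w a)" by (simp add: Nh_def prod_eq_iff)
  then show 1: "?h = tt w (a, - Nh w a)" using tt_eq[OF w h(1)] by simp
  show "Dc w (a, - Nh w a) (eta A) = 0"
    using h(2) unfolding Dc_def 1 by simp
qed

lemma Nh_equation: assumes w: "w \<in> WV" shows "Dc w (0, Nh w a) (eta A) = Dc w (a, 0) (eta A)"
  using linear_diff[OF Dc_linear[OF w eta_pifield], of "(a, 0)" "(0, Nh w a)"] hlift_P(2)[OF w, of a] by simp

text \<open>The torsion conditions involve Lie brackets of horizontal lifts, so some regularity must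
  be known before they can be used. \<open>Nh_equation\<close> is a linear system with smooth
  coefficients and injective matrix, which gives differentiability at each point. Smoothness follows
  in \<open>Nh_smooth\<close>, once the torsion conditions have shown the matrix to be the
  identity.\<close>

lemma Nh_differentiable:
  assumes w: "w \<in> WV" shows "(\<lambda>w. Nh w a) differentiable (at w)"
proof (rule linear_equation_solution_differentiable[OF open_WV w])
  show "linear (\<lambda>b. Dc y (0, b) (eta A))" if "y \<in> WV" for y
    using linear_compose[OF bounded_linear.linear[OF bounded_linear_Pair[OF bounded_linear_zero bounded_linear_ident]]
      Dc_linear[OF that eta_pifield]] by (simp add: o_def)
  show "(\<lambda>y. Dc y (0, b) (eta A)) differentiable (at w)" for b
    by (rule smooth_on_differentiable[OF Dc_smooth[OF eta_pifield] w])
  show "(\<lambda>y. Dc y (a, 0) (eta A)) differentiable (at w)"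
    by (rule smooth_on_differentiable[OF Dc_smooth[OF eta_pifield] w])
qed (use vertical_injective[OF w] Nh_equation in auto)

definition "hfield a = hlift_field A D (cf a)"
definition "vfield a = vlift_field A (cf a)"

lemma hfield_in: "u \<in> slitTM A \<Longrightarrow> hfield a u \<in> TS u"
  using hlift_horizontal(1)[OF _ pifieldsD(1)[OF cf_pifield]]
  by (simp add: hfield_def hlift_field_def horizontal_space_def)

lemma vfield_in: assumes u: "u \<in> slitTM A" shows "vfield a u \<in> TS u"
proof -
  obtain d where d: "d \<in> A" "u \<in> fst (sc d)" using u slitTM_iff by blast
  show ?thesis
    using u slit.tvec_tangent[OF sc_in[OF d(1)] d(2)]
    by (simp add: vfield_def vlift_field_def vlift_eq_tvec[OF d pifieldsD(1)[OF cf_pifield u]])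
qed

lemma hfield_P: "w \<in> WV \<Longrightarrow> hfield a (P w) = tt w (a, - Nh w a)"
  by (simp add: hfield_def hlift_field_def P_slitTM cf_P hlift_P)

lemma vfield_P: assumes w: "w \<in> WV" shows "vfield a (P w) = tt w (0, a)"
  using vlift_eq_tvec[OF c P_in[OF w] tv_in[OF w], of a] w
  by (simp add: vfield_def vlift_field_def P_slitTM cf_P tv_self)

lemma rho_hfield: "rho_field A (hfield a) = cf a"
  unfolding hfield_def by (rule rho_field_hlift_field[OF cf_pifield])

lemma rho_vfield: "rho_field A (vfield a) = (\<lambda>u\<in>slitTM A. 0)"
  unfolding vfield_def by (rule rho_field_vlift_field[OF cf_pifield])

lemma hfield_has_derivative:
  assumes w: "w \<in> WV"
  shows "((\<lambda>x. hfield a (chart_inv (sc c) x) (sc c)) has_derivative (\<lambda>v. (0, - dird v (\<lambda>w. Nh w a) w)))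
    (at (snd (sc c) (P w)))"
  unfolding P_chart[OF w]
proof (rule has_derivative_transform_within_open[OF _ open_WV w])
  have "((\<lambda>w. Nh w a) has_derivative (\<lambda>v. dird v (\<lambda>w. Nh w a) w)) (at w)"
    using frechet_derivative_worksI[OF Nh_differentiable[OF w]] unfolding dird_def .
  then show "((\<lambda>w. (a, - Nh w a)) has_derivative (\<lambda>v. (0, - dird v (\<lambda>w. Nh w a) w))) (at w)"
    by (intro has_derivative_Pair has_derivative_const has_derivative_minus)
qed (simp add: chart_inv_P hfield_P tt_self)

lemma vfield_has_derivative:
  assumes w: "w \<in> WV"
  shows "((\<lambda>x. vfield a (chart_inv (sc c) x) (sc c)) has_derivative (\<lambda>v. 0)) (at (snd (sc c) (P w)))"
  unfolding P_chart[OF w]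
  by (rule has_derivative_transform_within_open[OF has_derivative_const open_WV w])
    (simp add: chart_inv_P vfield_P tt_self)

lemma bracket_hfield:
  assumes w: "w \<in> WV"
  shows "lie_bracket (slit_atlas A) (hfield a) (hfield b) (P w) =
    tt w (0, dird (b, - Nh w b) (\<lambda>w. Nh w a) w - dird (a, - Nh w a) (\<lambda>w. Nh w b) w)"
  using slit.lie_bracket_eq_tvec[OF sc_in[OF c] P_in[OF w] hfield_in hfield_in
      hfield_has_derivative[OF w] hfield_has_derivative[OF w], of a b]
  by (simp add: hfield_P[OF w] tt_self[OF w])

lemma bracket_vfield_hfield:
  assumes w: "w \<in> WV"
  shows "lie_bracket (slit_atlas A) (vfield a) (hfield b) (P w) = tt w (0, - dird (0, a) (\<lambda>w. Nh w b) w)"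
  using slit.lie_bracket_eq_tvec[OF sc_in[OF c] P_in[OF w] vfield_in hfield_in
      vfield_has_derivative[OF w] hfield_has_derivative[OF w], of a b]
  by (simp add: hfield_P[OF w] vfield_P[OF w] tt_self[OF w])

lemma rho_field_vertical:
  assumes w: "w \<in> WV" and X: "X (P w) = tt w (0, z)" shows "rho_field A X (P w) = 0"
  using rho_P[OF w tt_in[OF w], of "(0, z)"] tvec_zero[OF c P_fst[OF w]]
  by (simp add: rho_field_def P_slitTM[OF w] X tt_self[OF w])

text \<open>The bracket of two lifted coordinate fields is vertical, hence killed by
  \<open>rho\<close>; the condition Q = 0 is then the symmetry of the horizontal connection
  coefficients.\<close>

lemma F_sym:
  assumes w: "w \<in> WV" shows "Dc w (a, - Nh w a) (cf b) = Dc w (b, - Nh w b) (cf a)"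
proof -
  have "h_torsion A D (cf a) (cf b) (P w) = 0"
    using cartan cf_pifield P_slitTM[OF w] unfolding cartan_connection_def by blast
  then have "D (P w) (hfield a (P w)) (cf b) = D (P w) (hfield b (P w)) (cf a)"
    using rho_field_vertical[of w "lie_bracket (slit_atlas A) (hfield a) (hfield b)", OF w bracket_hfield[OF w]]
    unfolding h_torsion_def torsion_def hfield_def[symmetric] rho_hfield cov_def
      restrict_apply'[OF P_slitTM[OF w]] by simp
  then show ?thesis unfolding hfield_P[OF w] Dc_def by simp
qed

lemma hv_torsion_P:
  assumes w: "w \<in> WV" shows "hv_torsion A D (cf a) (cf b) (P w) = tv w (Dc w (0, a) (cf b))"
proof -
  have "hv_torsion A D (cf a) (cf b) (P w) = D (P w) (vfield a (P w)) (cf b)"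
    using rho_field_vertical[of w "lie_bracket (slit_atlas A) (vfield a) (hfield b)", OF w bracket_vfield_hfield[OF w]]
     D_zero[OF P_slitTM[OF w] hfield_in[OF P_slitTM[OF w]]]
    unfolding hv_torsion_def torsion_def hfield_def[symmetric] vfield_def[symmetric] rho_hfield rho_vfield cov_def restrict_apply'[OF P_slitTM[OF w]] by simp
  then show ?thesis using D_eq[OF w tt_in[OF w] cf_pifield] by (simp add: vfield_P[OF w] tt_self[OF w])
qed

lemma V_sym:
  assumes w: "w \<in> WV" shows "gm w (Dc w (0, v) (cf a)) b = gm w (Dc w (0, v) (cf b)) a"
proof -
  have "finsler_metric L (P w) (hv_torsion A D (cf v) (cf a) (P w)) (cf b (P w)) =
      finsler_metric L (P w) (hv_torsion A D (cf v) (cf b) (P w)) (cf a (P w))"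
    using cartan cf_pifield P_slitTM[OF w] unfolding cartan_connection_def by blast
  then show ?thesis by (simp only: hv_torsion_P[OF w] cf_P[OF w] gm_finsler[OF w])
qed

text \<open>By \<open>V_sym\<close> the two terms of metric compatibility are equal, so each is half
  a vertical derivative of g. With the supporting element as an argument that derivative is
  zero.\<close>

lemma Dc_vertical_supporting:
  assumes w: "w \<in> WV" shows "Dc w (0, v) (cf (snd w)) = 0"
proof (rule gm_nondegenerate[OF w])
  fix b
  have "dird (0, v) (dird (0, snd w) (dird (0, b) En)) w = 0"
    using en.dird_g_supporting_vertical w unfolding en.g_def en.\<theta>_def en_W by blast
  then have "gm w (Dc w (0, v) (cf (snd w))) b = 0"
    using Dc_metric[OF w, of "(0, v)" "snd w" b] V_sym[OF w, of v b "snd w"]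
      gm_sym[OF w, of "snd w" "Dc w (0, v) (cf b)"] by simp
  then show "gm w (Dc w (0, v) (cf (snd w))) b = gm w 0 b"
    using linear_0[OF gm_linear[OF w]] by simp
qed

text \<open>The map K restricted to vertical lifts is the identity. This removes the unknown matrix
  from \<open>Nh_equation\<close> and makes \<open>Nh\<close> a component of the covariant
  derivative of \<eta>.\<close>

lemma Dc_vertical_eta: "w \<in> WV \<Longrightarrow> Dc w (0, v) (eta A) = v"
  by (simp add: Dc_eta Dc_vertical_supporting)

lemma Nh_eq: "w \<in> WV \<Longrightarrow> Nh w a = Dc w (a, 0) (eta A)"
  using Nh_equation Dc_vertical_eta by metis

lemma Nh_smooth: "smooth_on WV (\<lambda>w. Nh w a)"
  by (rule smooth_on_cong[OF open_WV _ Dc_smooth[OF eta_pifield]]) (rule Nh_eq[symmetric])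

lemma Nh_linear:
  assumes w: "w \<in> WV" shows "linear (Nh w)"
proof -
  have "Nh w = (\<lambda>a. Dc w (a, 0) (eta A))" using Nh_eq[OF w] by blast
  then show ?thesis
    using linear_compose[OF bounded_linear.linear[OF bounded_linear_Pair[OF bounded_linear_ident bounded_linear_zero]]
      Dc_linear[OF w eta_pifield]] by (simp add: o_def)
qed

lemma Dc_horizontal_supporting: "w \<in> WV \<Longrightarrow> Dc w (a, - Nh w a) (cf (snd w)) = Nh w a"
  using Dc_eta[of w "(a, - Nh w a)"] hlift_P(2)[of w a] by simp

end

sublocale chart_nbhd \<subseteq> lf: local_finsler V "energy c" Nh
proof (intro local_finsler.intro local_finsler_axioms.intro en.local_energy_axioms)
  show "linear (Nh w)" if "w \<in> V \<times> - {0}" for w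
    using that Nh_linear by (simp add: WV_def)
  show "smooth_on (V \<times> - {0}) (\<lambda>w. Nh w a)" for a
    using Nh_smooth by (simp add: WV_def)
  fix w :: "'e \<times> 'e" and a b :: 'e
  assume "w \<in> V \<times> - {0}"
  then have w: "w \<in> WV" by (simp add: WV_def)
  let ?y = "snd w"
  \<comment> \<open>Koszul's computation: metric compatibility expands the three derivatives into
    six terms, \<open>F_sym\<close> cancels four of them, and the other two are each g(N a, b) by
    \<open>Dc_horizontal_supporting\<close>.\<close>
  show "dird (a, - Nh w a) (dird (0, ?y) (dird (0, b) En)) w + dird (?y, - Nh w ?y) (dird (0, a) (dird (0, b) En)) w
      - dird (b, - Nh w b) (dird (0, a) (dird (0, ?y) En)) w = 2 * gm w (Nh w a) b"
    unfolding Dc_metric[OF w]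
    using F_sym[OF w, of ?y a] F_sym[OF w, of b a] F_sym[OF w, of b ?y] Dc_horizontal_supporting[OF w, of a]
      gm_sym[OF w, of ?y "Dc w (a, - Nh w a) (cf b)"] by simp
qed

section \<open>Flatness in coordinates\<close>

context chart_nbhd
begin

lemma cov_hfield_eta: "cov A D (hfield a) (eta A) = (\<lambda>u\<in>slitTM A. 0)"
  unfolding cov_def
  using hlift_horizontal(1)[OF _ pifieldsD(1)[OF cf_pifield]]
  by (intro restrict_ext) (simp add: hfield_def hlift_field_def horizontal_space_def)

text \<open>Since \<eta> is parallel along horizontal fields, only the bracket term of the curvature
  survives. The bracket is vertical, and differentiating \<eta> along a vertical vector returns that
  vector by \<open>Dc_vertical_eta\<close>.\<close>

lemma h_curvature_eta:
  assumes w: "w \<in> WV"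
  shows "h_curvature A D (cf a) (cf b) (eta A) (P w) = tv w (lf.Rc a b w)"
proof -
  have "h_curvature A D (cf a) (cf b) (eta A) (P w) =
     D (P w) (lie_bracket (slit_atlas A) (hfield a) (hfield b) (P w)) (eta A)"
    unfolding h_curvature_def curvature_def hfield_def[symmetric] cov_hfield_eta restrict_apply'[OF P_slitTM[OF w]]
    by (simp add: cov_def P_slitTM[OF w] D_zero[OF P_slitTM[OF w] hfield_in[OF P_slitTM[OF w]]])
  also have "\<dots> = tv w (lf.Rc a b w)"
    unfolding bracket_hfield[OF w] D_eq[OF w tt_in[OF w] eta_pifield] tt_self[OF w] Dc_vertical_eta[OF w]
    by (simp add: lf.Rc_def lf.Nn_def lf.hor_def)
  finally show ?thesis .
qed

text \<open>Flatness evaluated on two coordinate fields and \<eta> is the isotropy equation of the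
  coordinate model, as its component in the chart \<open>c\<close> shows.\<close>

lemma curvature_scalar_locally_constant:
  assumes flat: "concircularly_flat A L D" and dim: "DIM('e) \<ge> 3" and w: "w \<in> WV"
  shows "((\<lambda>w. scalar_curvature A L D (P w) / (real DIM('e) * (real DIM('e) - 1))) has_derivative (\<lambda>h. 0)) (at w)"
proof (rule lf.lam_locally_constant[OF dim])
  show "w \<in> en.W" using w by (simp add: en_W)
  fix a b :: 'e and w :: "'e \<times> 'e" assume "w \<in> en.W"
  then have w: "w \<in> WV" by (simp add: en_W)
  let ?lam = "scalar_curvature A L D (P w) / (real DIM('e) * (real DIM('e) - 1))"
  have gy: "gm w a (snd w) = en.\<theta> a w" for a
    using gm_sym[OF w, of a "snd w"] en.euler_\<theta>[of w a] w by (simp add: en.\<theta>_def en_W)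
  have "concircular_curvature A L D (cf a) (cf b) (eta A) (P w) = 0"
    using flat cf_pifield eta_pifield P_slitTM[OF w] unfolding concircularly_flat_def by blast
  then have "tv w (lf.Rc a b w) = ?lam *\<^sub>R G_tensor A L (cf a) (cf b) (eta A) (P w)"
    unfolding concircular_curvature_def restrict_apply'[OF P_slitTM[OF w]] h_curvature_eta[OF w] by simp
  also have "G_tensor A L (cf a) (cf b) (eta A) (P w) = en.\<theta> a w *\<^sub>R tv w b - en.\<theta> b w *\<^sub>R tv w a"
    unfolding G_tensor_def restrict_apply'[OF P_slitTM[OF w]] eta_def P_snd[OF w] cf_P[OF w] gm_finsler[OF w] gy ..
  finally have "tv w (lf.Rc a b w) c = (?lam *\<^sub>R (en.\<theta> a w *\<^sub>R tv w b - en.\<theta> b w *\<^sub>R tv w a)) c" by (rule arg_cong)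
  then show "lf.Rc a b w = ?lam *\<^sub>R (en.\<theta> a w *\<^sub>R b - en.\<theta> b w *\<^sub>R a)"
    by (simp add: tv_self[OF w])
qed

lemma finsler_metric_supporting:
  assumes w: "w \<in> WV" shows "finsler_metric L (P w) (snd (P w)) (snd (P w)) = (L (P w))\<^sup>2"
proof -
  have "gm w (snd w) (snd w) = 2 * En w"
    using en.euler_\<theta>[of w "snd w"] en.euler_En[of w] w by (simp add: en.\<theta>_def en_W)
  then show ?thesis unfolding P_snd[OF w] gm_finsler[OF w] by (simp add: energy_def)
qed

end

section \<open>Constancy of the curvature\<close>

lemma connected_space_locally_constant:
  assumes conn: "connected_space T"
    and loc: "\<And>p. p \<in> topspace T \<Longrightarrow> \<exists>W. openin T W \<and> p \<in> W \<and> (\<forall>q\<in>W. f q = f p)"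
    and "p \<in> topspace T" "q \<in> topspace T"
  shows "f p = f q"
proof (rule ccontr)
  assume ne: "f p \<noteq> f q"
  have op: "openin T {x \<in> topspace T. f x \<in> S}" for S
  proof (subst openin_subopen, intro ballI)
    fix x assume x: "x \<in> {x \<in> topspace T. f x \<in> S}"
    then obtain W where W: "openin T W" "x \<in> W" "\<forall>q\<in>W. f q = f x" using loc by blast
    have "q \<in> {x \<in> topspace T. f x \<in> S}" if "q \<in> W" for q
    proof -
      have "f q = f x" using W(3) that by blast
      then show ?thesis using x that openin_subset[OF W(1)] by auto
    qed
    then show "\<exists>W. openin T W \<and> x \<in> W \<and> W \<subseteq> {x \<in> topspace T. f x \<in> S}"
      using W(1,2) by blast
  qed
  let ?E1 = "{x \<in> topspace T. f x \<in> {f p}}" and ?E2 = "{x \<in> topspace T. f x \<in> - {f p}}"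
  have "topspace T \<subseteq> ?E1 \<union> ?E2" "?E1 \<inter> ?E2 = {}" by blast+
  moreover have "p \<in> ?E1" "q \<in> ?E2" using assms(3,4) ne by simp_all
  ultimately show False
    using conn op[of "{f p}"] op[of "- {f p}"] unfolding connected_space_def by blast
qed

context chart_nbhd
begin

text \<open>\<open>phi_tensor\<close> is a definite description, so existence and uniqueness are
  both required. The witness is the projection along the supporting element onto its g-orthogonal
  complement; uniqueness is the nondegeneracy of g.\<close>

lemma phi_tensor_P:
  assumes w: "w \<in> WV" and x: "x \<in> fibre A (P w)"
  shows "phi_tensor A L (P w) x =
    x - (finsler_metric L (P w) x (snd (P w)) / (L (P w))\<^sup>2) *\<^sub>R snd (P w)"
proof -
  let ?u = "P w"
  let ?y = "snd w"
  let ?L2 = "(L ?u)\<^sup>2"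
  define a where "a = x c"
  have xa: "x = tv w a" unfolding a_def by (rule tv_eq[OF w x])
  have L2: "gm w ?y ?y = ?L2" using finsler_metric_supporting[OF w] unfolding P_snd[OF w] gm_finsler[OF w] .
  define z where "z = a - (gm w a ?y / ?L2) *\<^sub>R ?y"
  have rhs: "x - (finsler_metric L ?u x (snd ?u) / ?L2) *\<^sub>R snd ?u = tv w z"
  proof (rule tangent_eqI[OF _ tv_in[OF w] c P_fst[OF w]])
    show "x - (finsler_metric L ?u x (snd ?u) / ?L2) *\<^sub>R snd ?u \<in> fibre A ?u"
      unfolding P_snd[OF w] using x tv_in[OF w] by (intro tangent_diff tangent_scale)
    show "(x - (finsler_metric L ?u x (snd ?u) / ?L2) *\<^sub>R snd ?u) c = tv w z c"
      unfolding xa P_snd[OF w] gm_finsler[OF w] by (simp add: tv_self[OF w] z_def)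
  qed
  have ang: "angular_metric L ?u x (tv w b) = gm w z b" for b
  proof -
    have "gm w z b = gm w a b - (gm w a ?y / ?L2) * gm w ?y b"
      unfolding z_def using linear_diff[OF gm_linear[OF w]] linear_scale[OF gm_linear[OF w]] by simp
    then show ?thesis
      unfolding angular_metric_def ell_def xa P_snd[OF w] gm_finsler[OF w]
      by (simp add: gm_sym[OF w, of ?y a] power2_eq_square)
  qed
  have "phi_tensor A L ?u x = tv w z"
    unfolding phi_tensor_def raise_on_def
  proof (rule the_equality)
    show "tv w z \<in> fibre A ?u \<and> (\<forall>v\<in>fibre A ?u. finsler_metric L ?u (tv w z) v = angular_metric L ?u x v)"
      using tv_in[OF w] tv_eq[OF w] ang gm_finsler[OF w] by metis
    fix v assume v: "v \<in> fibre A ?u \<and> (\<forall>z\<in>fibre A ?u. finsler_metric L ?u v z = angular_metric L ?u x z)"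
    then have v': "v = tv w (v c)" using tv_eq[OF w] by blast
    have "gm w (v c) b = gm w z b" for b
      using v tv_in[OF w] gm_finsler[OF w] ang v' by metis
    then have "v c = z" by (rule gm_nondegenerate[OF w])
    then show "v = tv w z" using v' by simp
  qed
  then show ?thesis using rhs by simp
qed

text \<open>With \<eta> in the first and third slots, G(\<eta>, X) \<eta> = L^2 X - g(X, \<eta>)
  \<eta>, which is L^2 times the projection in \<open>phi_tensor_P\<close>. The division by L^2 is
  legitimate because g(\<eta>, \<eta>) = L^2 is positive.\<close>

lemma deviation_P:
  assumes flat: "concircularly_flat A L D" and w: "w \<in> WV" and X: "X \<in> pifields A"
    and k: "scalar_curvature A L D (P w) / (real DIM('e) * (real DIM('e) - 1)) = k"
  shows "deviation A D X (P w) = (k * (L (P w))\<^sup>2) *\<^sub>R phi_tensor A L (P w) (X (P w))"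
proof -
  let ?u = "P w"
  have u: "?u \<in> slitTM A" by (rule P_slitTM[OF w])
  have pos: "(L ?u)\<^sup>2 \<noteq> 0"
    using finsler_metric_pos[OF u, of "snd ?u"] slitTM_D[OF u] finsler_metric_supporting[OF w] by auto
  have "concircular_curvature A L D (eta A) X (eta A) ?u = 0"
    using flat X eta_pifield u unfolding concircularly_flat_def by blast
  then have "deviation A D X ?u = k *\<^sub>R G_tensor A L (eta A) X (eta A) ?u"
    unfolding concircular_curvature_def restrict_apply'[OF u] k deviation_def h_curvature_hat_def by simp
  also have "\<dots> = k *\<^sub>R ((L ?u)\<^sup>2 *\<^sub>R X ?u - finsler_metric L ?u (X ?u) (snd ?u) *\<^sub>R snd ?u)"
    unfolding G_tensor_def eta_def restrict_apply'[OF u] finsler_metric_supporting[OF w] ..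
  also have "\<dots> = (k * (L ?u)\<^sup>2) *\<^sub>R (X ?u - (finsler_metric L ?u (X ?u) (snd ?u) / (L ?u)\<^sup>2) *\<^sub>R snd ?u)"
    using pos by (simp only: scaleR_diff_right scaleR_scaleR) simp
  finally show ?thesis unfolding phi_tensor_P[OF w pifieldsD(1)[OF X u]] .
qed

end

context cartan_finsler
begin

lemma chart_nbhd_exists:
  assumes c: "c \<in> A" "p \<in> fst c"
  obtains \<psi> r where "r > 0" "chart_nbhd A L D c \<psi> (ball (snd c p) r)"
proof -
  have "smooth_manifold A" using finsler by (simp add: finsler_manifold_def)
  then obtain \<psi> r where r: "cutoff c \<psi>" "r > 0" "ball (snd c p) r \<subseteq> snd c ` fst c"
    "\<And>q. q \<in> fst c \<Longrightarrow> snd c q \<in> ball (snd c p) r \<Longrightarrow> \<psi> q = 1"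
    using cutoff_exists[OF _ c] by metis
  then have "chart_nbhd A L D c \<psi> (ball (snd c p) r)"
    using c by unfold_locales (auto simp: cdom_def)
  then show ?thesis using that r(2) by blast
qed

lemma slit_point_chart: "c \<in> A \<Longrightarrow> u \<in> fst (sc c) \<Longrightarrow> slit_point c (snd (sc c) u) = u"
  using slit_chart_inv slit.chart_inv_chart[OF sc_in] slit_image by (metis imageI)

text \<open>Over a coordinate ball the slit bundle is a product of connected sets, so
  \<open>lam\<close> takes one value there, over all base points and directions at once.
  Connectedness of the base joins these local values.\<close>

lemma curvature_scalar_constant:
  assumes conn: "connected_space (manifold_topology A)" and dim: "DIM('e) \<ge> 3"
    and flat: "concircularly_flat A L D"
  obtains k where "\<And>u. u \<in> slitTM A \<Longrightarrow> scalar_curvature A L D u / (real DIM('e) * (real DIM('e) - 1)) = k"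
proof -
  define lam where "lam u = scalar_curvature A L D u / (real DIM('e) * (real DIM('e) - 1))" for u
  have loc: "\<exists>W. openin (manifold_topology A) W \<and> p \<in> W \<and>
      (\<forall>u\<in>slitTM A. \<forall>u'\<in>slitTM A. fst u \<in> W \<longrightarrow> fst u' \<in> W \<longrightarrow> lam u = lam u')" if p: "p \<in> mcarrier A" for p
  proof -
    obtain c where cp: "c \<in> A" "p \<in> fst c" using p by (rule mcarrierE)
    obtain \<psi> r where r: "r > 0" "chart_nbhd A L D c \<psi> (ball (snd c p) r)" using chart_nbhd_exists[OF cp] .
    interpret chart_nbhd A L D c \<psi> "ball (snd c p) r" by (rule r(2))
    have "connected (- {0 :: 'e})" by (rule connected_punctured_universe) (use dim in simp)
    then have WV: "connected WV" unfolding WV_def by (simp add: connected_Times)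
    have const: "lam (P w) = lam (P w')" if "w \<in> WV" "w' \<in> WV" for w w'
      using has_derivative_zero_unique_connected[OF open_WV WV, of "\<lambda>w. lam (P w)" w w'] that
        curvature_scalar_locally_constant[OF flat dim] unfolding lam_def by blast
    let ?W = "{q \<in> fst c. snd c q \<in> ball (snd c p) r}"
    have in_WV: "snd (sc c) u \<in> WV \<and> P (snd (sc c) u) = u" if u: "u \<in> slitTM A" "fst u \<in> ?W" for u
    proof -
      have uc: "u \<in> fst (sc c)" using slit_in_chart[OF u(1)] u(2) by blast
      then have "snd u c \<noteq> 0" by (rule slit_component_nonzero[OF cp(1)])
      then show ?thesis using u slit_point_chart[OF cp(1) uc] by (simp add: WV_def slit_snd)
    qed
    have "lam u = lam u'" if "u \<in> slitTM A" "u' \<in> slitTM A" "fst u \<in> ?W" "fst u' \<in> ?W" for u u'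
      using const in_WV[OF that(1,3)] in_WV[OF that(2,4)] by metis
    then have "\<forall>u\<in>slitTM A. \<forall>u'\<in>slitTM A. fst u \<in> ?W \<longrightarrow> fst u' \<in> ?W \<longrightarrow> lam u = lam u'"
      by blast
    moreover have "openin (manifold_topology A) ?W" by (rule openin_chart_preimage[OF cp(1) open_ball])
    moreover have "p \<in> ?W" using cp r(1) by simp
    ultimately show ?thesis by blast
  qed
  \<comment> \<open>A choice of one nonzero vector over each point turns \<open>lam\<close> into a
    function on the base; by \<open>loc\<close> its values do not depend on the choice.\<close>
  define v where "v p = (SOME v. (p, v) \<in> slitTM A)" for p
  have v: "(p, v p) \<in> slitTM A" if p: "p \<in> mcarrier A" for p
  proof -
    obtain c where c: "c \<in> A" "p \<in> fst c" using p by (rule mcarrierE)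
    obtain b :: 'e where "b \<noteq> 0" using nonempty_Basis nonzero_Basis by blast
    then have "tvec c p b \<noteq> 0" using tangent_eq_zero_iff[OF tvec_tangent[OF c] c] tvec_self[OF c] by metis
    then have "(p, tvec c p b) \<in> slitTM A"
      unfolding slitTM_iff using c tvec_tangent[OF c] by (auto simp: slit_fst intro!: bexI[of _ c])
    then show ?thesis unfolding v_def by (rule someI[of "\<lambda>v. (p, v) \<in> slitTM A"])
  qed
  have base: "fst u \<in> mcarrier A" if "u \<in> slitTM A" for u
    using that by (auto simp: slitTM_iff slit_fst intro: mcarrierI simp del: split_paired_Ex)
  have lam_v: "lam u = lam (fst u, v (fst u))" if u: "u \<in> slitTM A" for u
    using loc[OF base[OF u]] u v[OF base[OF u]] by (metis fst_conv)
  have "lam (p, v p) = lam (q, v q)" if "p \<in> mcarrier A" "q \<in> mcarrier A" for p q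
  proof (rule connected_space_locally_constant[OF conn, unfolded topspace_manifold, where f="\<lambda>p. lam (p, v p)"])
    fix p assume p: "p \<in> mcarrier A"
    obtain W where W: "openin (manifold_topology A) W" "p \<in> W"
      "\<forall>u\<in>slitTM A. \<forall>u'\<in>slitTM A. fst u \<in> W \<longrightarrow> fst u' \<in> W \<longrightarrow> lam u = lam u'"
      using loc[OF p] by blast
    have "W \<subseteq> mcarrier A" using openin_subset[OF W(1)] unfolding topspace_manifold .
    then show "\<exists>W. openin (manifold_topology A) W \<and> p \<in> W \<and> (\<forall>q\<in>W. lam (q, v q) = lam (p, v p))"
      using W v p by (intro exI[of _ W]) (metis fst_conv subsetD)
  qed (use that in auto)
  then have "lam u = lam u'" if "u \<in> slitTM A" "u' \<in> slitTM A" for u u'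
    using lam_v base that by metis
  then show ?thesis using that unfolding lam_def by metis
qed

end

theorem theoremA:
  fixes A :: "('a, 'e::euclidean_space) chart set"
    and L :: "('a, 'e) tm \<Rightarrow> real"
    and D :: "('a, 'e) connection"
  assumes "finsler_manifold A L"
    and "connected_space (manifold_topology A)"
    and "DIM('e) \<ge> 3"
    and "cartan_connection A L D"
    and "concircularly_flat A L D"
  shows "of_constant_curvature A L D"
proof -
  interpret cartan_finsler A L D
    using assms by unfold_locales (simp_all add: finsler_manifold_def smooth_manifold_def)
  obtain k where k: "\<And>u. u \<in> slitTM A \<Longrightarrow> scalar_curvature A L D u / (real DIM('e) * (real DIM('e) - 1)) = k"
    using curvature_scalar_constant[OF assms(2,3,5)] by metis
  have "deviation A D X u = (k * (L u)\<^sup>2) *\<^sub>R phi_tensor A L u (X u)"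
    if X: "X \<in> pifields A" and u: "u \<in> slitTM A" for X u
  proof -
    obtain c where cu: "c \<in> A" "u \<in> fst (sc c)" using u slitTM_iff by blast
    have p: "fst u \<in> fst c" using cu(2) by (simp add: slit_fst)
    obtain \<psi> r where r: "r > 0" "chart_nbhd A L D c \<psi> (ball (snd c (fst u)) r)" using chart_nbhd_exists[OF cu(1) p] .
    interpret chart_nbhd A L D c \<psi> "ball (snd c (fst u)) r" by (rule r(2))
    have w: "snd (sc c) u \<in> WV"
      using slit_component_nonzero[OF cu] r(1) by (simp add: WV_def slit_snd)
    from deviation_P[OF assms(5) w X k] show ?thesis
      using P_slitTM[OF w] slit_point_chart[OF cu] by simp
  qed
  then show ?thesis
    unfolding of_constant_curvature_def of_scalar_curvature_def
    using Cinf_const by (intro exI[of _ "\<lambda>u. k"]) auto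
qed

end
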